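(* Let $\Sigma$ be a hyperelliptic Riemann surface of genus $g\geq 3$ with a fixed nonsingular even spin structure $\xi_\epsilon$, let $P\in\Sigma$ be a standard point, and let $Q$ be any vertex of the standard spin graph $\mathcal{S}_P$. Then the set $\mathtt{G}_Q=\{\sigma^{\mathsf{W}_Q} : \mathsf{W}_Q \text{ a spin chain at } Q\}$ of permutations of the $g$-element set $\{\mathcal{A}_Q\}$ is a group (under composition), and it is isomorphic to the alternating group $\mathtt{A}_g\triangleleft \mathtt{S}_g$.
   Context: Setting. $\Sigma$ is a compact hyperelliptic Riemann surface of genus $g$; $\widetilde{Q}$ denotes the image of $Q$ under the hyperelliptic involution. $\xi_\epsilon$ is a nonsingular even spin bundle: a line bundle with $\xi_\epsilon^{\otimes 2}\cong K_\Sigma$ and $h^0(\xi_\epsilon)=0$. For each $Q\in\Sigma$ there is, up to scalar, a unique meromorphic section of $\xi_\epsilon$ whose only pole is a simple pole at $Q$; its zero divisor $\mathcal{A}_Q$ is an effective divisor of degree $g$, and $\{\mathcal{A}_Q\}$ denotes the set of points of $\mathcal{A}_Q$. One has $R\in\{\mathcal{A}_Q\}$ iff $Q\in\{\mathcal{A}_R\}$. Spin graph. $\{\mathcal{S}_P\}$ is the smallest set of points containing $P$ such that $Q\in\{\mathcal{S}_P\}$ implies $\{\mathcal{A}_Q\}\subset\{\mathcal{S}_P\}$. The spin graph $\mathcal{S}_P$ has vertex set $\{\mathcal{S}_P\}$ and an edge $QR$ whenever $R\in\{\mathcal{A}_Q\}$. $P$ is a standard point (and $\mathcal{S}_P$ a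 standard spin graph) if $\{\mathcal{S}_P\}$ has $2g+2$ points. In that case, writing $\{\mathcal{A}_P\}=\{P_1,\dots,P_g\}$, the vertices are the distinct points $P,\widetilde P,P_k,\widetilde P_k$ ($1\le k\le g$), $\{\mathcal{A}_{P_k}\}=\{P\}\cup\{\widetilde P_j: j\ne k\}$, and $\{\mathcal{A}_{\widetilde Q}\}$ is the set of conjugates of the points of $\{\mathcal{A}_Q\}$; thus the edges are $PP_k$, $\widetilde P\widetilde P_k$, and $P_k\widetilde P_j$ ($j\neq k$). Faces. A face $F$ of a standard spin graph is a quadrangle ($4$-cycle) in the graph, no two of whose vertices are conjugate. Transport along an edge. Let $F$ be a face with vertices in cyclic order $Q_1,Q_2,Q_3,Q_4$. The bijection $\sigma^F_{Q_1Q_2}:\{\mathcal{A}_{Q_1}\}\to\{\mathcal{A}_{Q_2}\}$ is defined by $Q_4\mapsto Q_1$, $Q_2\mapsto Q_3$, $\widetilde Q_3\mapsto\widetilde Q_4$, and $T\mapsto\widetilde T$ for every other $T\in\{\mathcal{A}_{Q_1}\}$. (The same rule, with the cyclic order read from the relevant edge, defines $\sigma^F_{QR}$ for every oriented edge $QR$ of $F$; $\sigma^F_{RQ}$ is the inverse of $\sigma^F_{QR}$.) Spin chains. A spin chain at $Q$ is $\mathsf{W}_Q=\{\mathsf{L}_Q=QQ_1Q_2\dots Q_NQ;\,F_1,\dots,F_{N+1}\}$, where $\mathsf{L}_Q$ is a loop (closed walk along edges of the graph) at $Q$ and $F_1,\dots,F_{N+1}$ are faces with $QQ_1\subset F_1$,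 $Q_{i-1}Q_i\subset F_i$ for $2\le i\le N$, and $Q_NQ\subset F_{N+1}$. Its permutation of $\{\mathcal{A}_Q\}$ is $\sigma^{\mathsf{W}_Q}=\sigma^{F_{N+1}}_{Q_NQ}\circ\sigma^{F_N}_{Q_{N-1}Q_N}\circ\dots\circ\sigma^{F_2}_{Q_1Q_2}\circ\sigma^{F_1}_{QQ_1}$. *)

theory Defs
  imports
    "HOL-Complex_Analysis.Complex_Analysis"
    "HOL-Algebra.Bij"
    "HOL-Algebra.Sym_Groups"
    "HOL-Library.Function_Algebras"
begin

section \<open>Riemann surfaces\<close>

text \<open>
  A chart is a pair of an open coordinate domain and a coordinate map on it. The surface itself is
  the Hausdorff space given by the type; its complex structure is an atlas of such charts.
\<close>

type_synonym 'a chart = "'a set \<times> ('a \<Rightarrow> complex)"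

locale riemann_surface =
  fixes A :: "'a::t2_space chart set"
  assumes connected_surface: "connected (UNIV :: 'a set)"
    and atlas_cover: "(\<Union>(U, \<phi>)\<in>A. U) = UNIV"
    and atlas_chart: "(U, \<phi>) \<in> A \<Longrightarrow>
      open U \<and> open (\<phi> ` U) \<and> homeomorphism U (\<phi> ` U) \<phi> (inv_into U \<phi>)"
    and atlas_compatible: "(U, \<phi>) \<in> A \<Longrightarrow> (V, \<psi>) \<in> A \<Longrightarrow>
      (\<psi> \<circ> inv_into U \<phi>) holomorphic_on \<phi> ` (U \<inter> V)"

locale compact_riemann_surface = riemann_surface A for A :: "'a::t2_space chart set" +
  assumes compact_surface: "compact (UNIV :: 'a set)"

definition hol_on :: "'a chart set \<Rightarrow> 'a set \<Rightarrow> ('a \<Rightarrow> complex) \<Rightarrow> bool" where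
  "hol_on A W f \<longleftrightarrow> (\<forall>(U, \<phi>)\<in>A. (f \<circ> inv_into U \<phi>) holomorphic_on \<phi> ` (U \<inter> W))"

text \<open>
  \<open>nicely_meromorphic_on\<close> excludes arbitrary values at removable singularities and fixes the value
  \<open>0\<close> at poles, so that a meromorphic function is determined by its germ off a discrete set.
\<close>

definition mer_on :: "'a chart set \<Rightarrow> 'a set \<Rightarrow> ('a \<Rightarrow> complex) \<Rightarrow> bool" where
  "mer_on A W f \<longleftrightarrow> (\<forall>(U, \<phi>)\<in>A. (f \<circ> inv_into U \<phi>) nicely_meromorphic_on \<phi> ` (U \<inter> W))"

text \<open>
  The order of a meromorphic function that is not locally zero, positive at zeros and negative at
  poles. It does not depend on the chosen chart.
\<close>

definition order_at :: "'a chart set \<Rightarrow> ('a \<Rightarrow> complex) \<Rightarrow> 'a \<Rightarrow> int" where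
  "order_at A f p =
     (case (SOME c. c \<in> A \<and> p \<in> fst c) of (U, \<phi>) \<Rightarrow> zorder (f \<circ> inv_into U \<phi>) (\<phi> p))"


section \<open>Holomorphic line bundles\<close>

text \<open>
  A line bundle is given by an open cover and a holomorphic cocycle. A section is a family of
  functions \<open>s i\<close> on the members of the cover with \<open>s i = trans i j * s j\<close> on overlaps.
\<close>

record ('i, 'a) cocycle =
  lb_idx :: "'i set"
  lb_dom :: "'i \<Rightarrow> 'a set"
  lb_trans :: "'i \<Rightarrow> 'i \<Rightarrow> 'a \<Rightarrow> complex"

definition line_bundle :: "'a::t2_space chart set \<Rightarrow> ('i, 'a) cocycle \<Rightarrow> bool" where
  "line_bundle A L \<longleftrightarrow>
     (\<Union>i\<in>lb_idx L. lb_dom L i) = UNIV \<and>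
     (\<forall>i\<in>lb_idx L. open (lb_dom L i)) \<and>
     (\<forall>i\<in>lb_idx L. \<forall>j\<in>lb_idx L. hol_on A (lb_dom L i \<inter> lb_dom L j) (lb_trans L i j)) \<and>
     (\<forall>i\<in>lb_idx L. \<forall>p\<in>lb_dom L i. lb_trans L i i p = 1) \<and>
     (\<forall>i\<in>lb_idx L. \<forall>j\<in>lb_idx L. \<forall>k\<in>lb_idx L. \<forall>p\<in>lb_dom L i \<inter> lb_dom L j \<inter> lb_dom L k.
        lb_trans L i j p * lb_trans L j k p = lb_trans L i k p)"

definition tensor_bundle :: "('i, 'a) cocycle \<Rightarrow> ('j, 'a) cocycle \<Rightarrow> ('i \<times> 'j, 'a) cocycle" where
  "tensor_bundle L M =
     \<lparr>lb_idx = lb_idx L \<times> lb_idx M,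
      lb_dom = (\<lambda>(i, j). lb_dom L i \<inter> lb_dom M j),
      lb_trans = (\<lambda>(i, j) (i', j') p. lb_trans L i i' p * lb_trans M j j' p)\<rparr>"

text \<open>
  An isomorphism is given by nowhere vanishing functions \<open>h j i\<close>, through which a section \<open>s\<close> of
  \<open>L\<close> becomes the section of \<open>M\<close> with components \<open>h j i * s i\<close>.
\<close>

definition bundle_iso :: "'a chart set \<Rightarrow> ('i, 'a) cocycle \<Rightarrow> ('j, 'a) cocycle \<Rightarrow> bool" where
  "bundle_iso A L M \<longleftrightarrow> (\<exists>h :: 'j \<Rightarrow> 'i \<Rightarrow> 'a \<Rightarrow> complex.
     (\<forall>j\<in>lb_idx M. \<forall>i\<in>lb_idx L. hol_on A (lb_dom M j \<inter> lb_dom L i) (h j i) \<and>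
        (\<forall>p\<in>lb_dom M j \<inter> lb_dom L i. h j i p \<noteq> 0)) \<and>
     (\<forall>j\<in>lb_idx M. \<forall>i\<in>lb_idx L. \<forall>i'\<in>lb_idx L. \<forall>p\<in>lb_dom M j \<inter> lb_dom L i \<inter> lb_dom L i'.
        h j i p * lb_trans L i i' p = h j i' p) \<and>
     (\<forall>j\<in>lb_idx M. \<forall>j'\<in>lb_idx M. \<forall>i\<in>lb_idx L. \<forall>p\<in>lb_dom M j \<inter> lb_dom M j' \<inter> lb_dom L i.
        h j i p = lb_trans M j j' p * h j' i p))"

text \<open>
  Sections of the canonical bundle are differentials: \<open>s\<^sub>1 d\<phi> = s\<^sub>2 d\<psi>\<close> amounts to
  \<open>s\<^sub>1 = (d\<psi>/d\<phi>) s\<^sub>2\<close>.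
\<close>

definition canonical_bundle :: "'a chart set \<Rightarrow> ('a chart, 'a) cocycle" where
  "canonical_bundle A =
     \<lparr>lb_idx = A,
      lb_dom = fst,
      lb_trans = (\<lambda>(U, \<phi>) (V, \<psi>) p. deriv (\<psi> \<circ> inv_into U \<phi>) (\<phi> p))\<rparr>"

text \<open>Components are extended by \<open>0\<close> so that equality of sections is equality of functions.\<close>

definition bundle_section :: "('i, 'a) cocycle \<Rightarrow> ('i \<Rightarrow> 'a \<Rightarrow> complex) \<Rightarrow> bool" where
  "bundle_section L s \<longleftrightarrow>
     (\<forall>i p. i \<notin> lb_idx L \<or> p \<notin> lb_dom L i \<longrightarrow> s i p = 0) \<and>
     (\<forall>i\<in>lb_idx L. \<forall>j\<in>lb_idx L. \<forall>p\<in>lb_dom L i \<inter> lb_dom L j. s i p = lb_trans L i j p * s j p)"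

definition hol_sections :: "'a chart set \<Rightarrow> ('i, 'a) cocycle \<Rightarrow> ('i \<Rightarrow> 'a \<Rightarrow> complex) set" where
  "hol_sections A L = {s. bundle_section L s \<and> (\<forall>i\<in>lb_idx L. hol_on A (lb_dom L i) (s i))}"

definition mer_sections :: "'a chart set \<Rightarrow> ('i, 'a) cocycle \<Rightarrow> ('i \<Rightarrow> 'a \<Rightarrow> complex) set" where
  "mer_sections A L = {s. bundle_section L s \<and> (\<forall>i\<in>lb_idx L. mer_on A (lb_dom L i) (s i))}"

definition section_order ::
    "'a chart set \<Rightarrow> ('i, 'a) cocycle \<Rightarrow> ('i \<Rightarrow> 'a \<Rightarrow> complex) \<Rightarrow> 'a \<Rightarrow> int" where
  "section_order A L s p = order_at A (s (SOME i. i \<in> lb_idx L \<and> p \<in> lb_dom L i)) p"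

definition scale_section :: "complex \<Rightarrow> ('i \<Rightarrow> 'a \<Rightarrow> complex) \<Rightarrow> 'i \<Rightarrow> 'a \<Rightarrow> complex" where
  "scale_section c s = (\<lambda>i p. c * s i p)"

global_interpretation section_space:
  vector_space "scale_section :: complex \<Rightarrow> ('i \<Rightarrow> 'a \<Rightarrow> complex) \<Rightarrow> _"
  by unfold_locales (auto simp: scale_section_def fun_eq_iff algebra_simps)

text \<open>
  \<open>has_h0 A L n\<close>: the space of holomorphic sections has finite dimension \<open>n\<close>. A relation is used
  because \<open>dim\<close> takes the value \<open>0\<close> on infinite-dimensional spaces.
\<close>

definition has_h0 :: "'a chart set \<Rightarrow> ('i, 'a) cocycle \<Rightarrow> nat \<Rightarrow> bool" where
  "has_h0 A L n \<longleftrightarrow>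
     (\<exists>B. finite B \<and> card B = n \<and> section_space.independent B \<and>
          section_space.span B = hol_sections A L)"

definition has_genus :: "'a chart set \<Rightarrow> nat \<Rightarrow> bool" where
  "has_genus A g \<longleftrightarrow> has_h0 A (canonical_bundle A) g"


section \<open>Hyperelliptic involution\<close>

text \<open>
  \<open>fibre_mult A z p q\<close> is the multiplicity of \<open>q\<close> in the fibre over \<open>z p\<close> of the map to the
  Riemann sphere defined by the meromorphic function \<open>z\<close>; at a pole \<open>p\<close> this is the fibre over
  infinity.
\<close>

definition fibre_mult :: "'a chart set \<Rightarrow> ('a \<Rightarrow> complex) \<Rightarrow> 'a \<Rightarrow> 'a \<Rightarrow> int" where
  "fibre_mult A z p q =
     (if order_at A z p < 0 then max 0 (- order_at A z q)
      else max 0 (order_at A (\<lambda>x. z x - z p) q))"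

text \<open>
  \<open>J\<close> is the sheet interchange of a two-sheeted branched covering of the Riemann sphere: the fibre
  through \<open>p\<close>, as a divisor, is \<open>p + J p\<close>.
\<close>

definition hyperelliptic_involution :: "'a chart set \<Rightarrow> ('a \<Rightarrow> 'a) \<Rightarrow> bool" where
  "hyperelliptic_involution A J \<longleftrightarrow>
     (\<exists>z. mer_on A UNIV z \<and> (\<exists>p q. z p \<noteq> z q) \<and>
          (\<forall>p q. fibre_mult A z p q = of_bool (q = p) + of_bool (q = J p)))"


section \<open>Spin bundles\<close>

text \<open>A spin bundle without holomorphic sections is automatically even.\<close>

definition nonsingular_even_spin_bundle :: "'a::t2_space chart set \<Rightarrow> ('i, 'a) cocycle \<Rightarrow> bool" where
  "nonsingular_even_spin_bundle A L \<longleftrightarrow>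
     line_bundle A L \<and> bundle_iso A (tensor_bundle L L) (canonical_bundle A) \<and> has_h0 A L 0"

definition simple_polar_section ::
    "'a chart set \<Rightarrow> ('i, 'a) cocycle \<Rightarrow> 'a \<Rightarrow> ('i \<Rightarrow> 'a \<Rightarrow> complex) \<Rightarrow> bool" where
  "simple_polar_section A L Q s \<longleftrightarrow>
     s \<in> mer_sections A L \<and> s \<noteq> 0 \<and>
     section_order A L s Q = -1 \<and> (\<forall>R. R \<noteq> Q \<longrightarrow> section_order A L s R \<ge> 0)"

text \<open>
  The set of points of the zero divisor of the section with a single simple pole at \<open>Q\<close>; the
  existential quantifier is harmless as that section is unique up to a scalar.
\<close>

definition spin_zeros :: "'a chart set \<Rightarrow> ('i, 'a) cocycle \<Rightarrow> 'a \<Rightarrow> 'a set" where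
  "spin_zeros A L Q = {R. \<exists>s. simple_polar_section A L Q s \<and> section_order A L s R > 0}"


section \<open>Spin graphs and spin chains\<close>

text \<open>
  Below, \<open>Z\<close> is the map sending \<open>Q\<close> to the point set of its zero divisor and \<open>J\<close> is the
  hyperelliptic involution.
\<close>

inductive_set spin_vertices :: "('a \<Rightarrow> 'a set) \<Rightarrow> 'a \<Rightarrow> 'a set"
  for Z :: "'a \<Rightarrow> 'a set" and P :: 'a where
  base: "P \<in> spin_vertices Z P"
| step: "Q \<in> spin_vertices Z P \<Longrightarrow> R \<in> Z Q \<Longrightarrow> R \<in> spin_vertices Z P"

definition spin_edges :: "('a \<Rightarrow> 'a set) \<Rightarrow> 'a \<Rightarrow> 'a set set" where
  "spin_edges Z P = {{Q, R} | Q R. Q \<in> spin_vertices Z P \<and> R \<in> Z Q}"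

definition standard_point :: "('a \<Rightarrow> 'a set) \<Rightarrow> nat \<Rightarrow> 'a \<Rightarrow> bool" where
  "standard_point Z g P \<longleftrightarrow> card (spin_vertices Z P) = 2 * g + 2"

text \<open>Faces are represented by their sets of four edges, hence carry no orientation.\<close>

definition four_cycle :: "'a \<Rightarrow> 'a \<Rightarrow> 'a \<Rightarrow> 'a \<Rightarrow> 'a set set" where
  "four_cycle a b c d = {{a, b}, {b, c}, {c, d}, {d, a}}"

definition spin_face :: "('a \<Rightarrow> 'a set) \<Rightarrow> ('a \<Rightarrow> 'a) \<Rightarrow> 'a \<Rightarrow> 'a set set \<Rightarrow> bool" where
  "spin_face Z J P F \<longleftrightarrow>
     (\<exists>a b c d. distinct [a, b, c, d] \<and> F = four_cycle a b c d \<and> F \<subseteq> spin_edges Z P \<and>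
        pairwise (\<lambda>x y. x \<noteq> J y) {a, b, c, d})"

text \<open>
  For an edge \<open>QR\<close> of a face \<open>F\<close> there is exactly one way to complete \<open>Q, R\<close> to a cyclic
  enumeration \<open>Q, R, S, T\<close> of the vertices of \<open>F\<close>.
\<close>

definition transport :: "('a \<Rightarrow> 'a) \<Rightarrow> 'a set set \<Rightarrow> 'a \<Rightarrow> 'a \<Rightarrow> 'a \<Rightarrow> 'a" where
  "transport J F Q R X =
     (case (THE (S, T). distinct [Q, R, S, T] \<and> F = four_cycle Q R S T) of (S, T) \<Rightarrow>
        if X = T then Q
        else if X = R then S
        else if X = J S then J T
        else J X)"

text \<open>
  A spin chain at \<open>Q\<close> is a closed walk \<open>vs\<close> (starting and ending with \<open>Q\<close>) together with a list
  of faces, one for each step of the walk.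
\<close>

definition spin_chain ::
    "('a \<Rightarrow> 'a set) \<Rightarrow> ('a \<Rightarrow> 'a) \<Rightarrow> 'a \<Rightarrow> 'a \<Rightarrow> 'a list \<Rightarrow> 'a set set list \<Rightarrow> bool" where
  "spin_chain Z J P Q vs Fs \<longleftrightarrow>
     Fs \<noteq> [] \<and> length vs = Suc (length Fs) \<and> hd vs = Q \<and> last vs = Q \<and>
     (\<forall>i<length Fs. {vs ! i, vs ! Suc i} \<in> spin_edges Z P \<and>
        spin_face Z J P (Fs ! i) \<and> {vs ! i, vs ! Suc i} \<in> Fs ! i)"

fun chain_map :: "('a \<Rightarrow> 'a) \<Rightarrow> 'a list \<Rightarrow> 'a set set list \<Rightarrow> 'a \<Rightarrow> 'a" where
  "chain_map J (Q # R # vs) (F # Fs) = chain_map J (R # vs) Fs \<circ> transport J F Q R"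
| "chain_map J _ _ = id"

text \<open>Restricted to \<open>Z Q\<close>, as elements of \<open>BijGroup (Z Q)\<close> are extensional functions.\<close>

definition spin_perms :: "('a \<Rightarrow> 'a set) \<Rightarrow> ('a \<Rightarrow> 'a) \<Rightarrow> 'a \<Rightarrow> 'a \<Rightarrow> ('a \<Rightarrow> 'a) set" where
  "spin_perms Z J P Q = {restrict (chain_map J vs Fs) (Z Q) | vs Fs. spin_chain Z J P Q vs Fs}"

end

theory Submission
  imports Defs
begin

text \<open>
  Let \<open>s\<close> be the section with a simple pole at \<open>Q\<close> only. If \<open>s\<close> vanishes at \<open>R \<noteq> J Q\<close>, then
  \<open>s (z - z Q) / (z - z R)\<close> has its only pole at \<open>J R\<close>; hence \<open>{Q} \<union> J (Z Q)\<close> is the equivalence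
  class of each of its points. Antisymmetrizing \<open>s\<^sup>2 / dz\<close> yields a differential whose divisor is
  \<open>div s + J (div s)\<close>. Dividing it by \<open>s\<close> gives \<open>Z (J Q) = J (Z Q)\<close>, and multiplying it by
  functions of \<open>z\<close> gives as many independent holomorphic differentials as \<open>s\<close> has zeros, so that
  \<open>card (Z Q) \<le> g\<close>. Thus a standard spin graph consists of a class \<open>C\<close> of \<open>g + 1\<close> points and its
  disjoint conjugate, with \<open>x\<close> adjacent to \<open>J y\<close> for \<open>x \<noteq> y\<close> in \<open>C\<close>.

  Identifying conjugate points, a face is a 4-cycle of labels in \<open>C\<close>, and transport along an edge
  from \<open>i\<close> to \<open>j\<close> is the cyclic permutation \<open>i \<mapsto> j \<mapsto> k \<mapsto> l \<mapsto> i\<close> of the labels of the face. It is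
  odd, and closed walks have even length because the graph is bipartite, so spin chains give even
  permutations. Going along an edge through one face and back through another face with the same
  labels yields every 3-cycle, and these generate the alternating group.
\<close>

text \<open>Neither Riemann-Roch nor the degree of a divisor is used to count zeros. Two facts
  replace them: a meromorphic function without poles on the compact surface has no zeros, and a
  nonzero section of \<open>\<xi>\<close> cannot be holomorphic. Existence of a section with a
  simple pole at \<open>Q\<close> is not established beforehand: \<open>Z Q\<close> is empty in its
  absence, and in general only \<open>card (Z Q) \<le> g\<close> is proved; counting the vertices of
  a standard graph turns this into an equality there.

  The involution is given merely as a map of points that completes the fibres of \<open>z\<close>.
  That it respects the complex structure is derived from coordinates in which
  \<open>local_fun\<close>, built from \<open>z\<close>, becomes a first or second power. Its fixed
  points are the delicate places: invariant functions have even order there, antisymmetric ones odd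
  order, and this parity decides which divisors come from functions of \<open>z\<close>.

  Orders and identities are treated as properties of punctured germs, because values at cancelling
  zeros and poles are accidental; \<open>normalized\<close> restores them when a section is
  required.\<close>

section \<open>Local analysis in the plane: filters, local inverses, orders\<close>

lemma filtermap_at_continuous_inverse:
  fixes f :: "'a::t2_space \<Rightarrow> 'b::t2_space"
  assumes "continuous_on U f" "continuous_on V g" "open U" "open V" "f ` U = V" "g ` V = U"
    and "\<And>x. x \<in> U \<Longrightarrow> g (f x) = x" "\<And>y. y \<in> V \<Longrightarrow> f (g y) = y" "p \<in> U"
  shows "filtermap f (at p) = at (f p)"
proof (rule filtermap_fun_inverse[where g = g])
  have fp: "f p \<in> V" and gfp: "g (f p) = p" using assms by auto
  have evU: "eventually (\<lambda>x. x \<in> U) (at p)"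
    using assms by (auto intro!: eventually_at_in_open')
  have evV: "eventually (\<lambda>x. x \<in> V) (at (f p))"
    using assms fp by (auto intro!: eventually_at_in_open')
  have "(g \<longlongrightarrow> g (f p)) (at (f p))"
    using assms(2) fp continuous_on_eq_continuous_at[OF assms(4)] isCont_def by blast
  moreover have "eventually (\<lambda>y. y \<noteq> f p) (at (f p))"
    by (simp add: eventually_at_filter)
  hence "eventually (\<lambda>y. g y \<noteq> p) (at (f p))"
    using evV by eventually_elim (use assms in force)
  ultimately show "filterlim g (at p) (at (f p))"
    by (simp add: filterlim_at gfp)
  have "(f \<longlongrightarrow> f p) (at p)"
    using assms(1,9) continuous_on_eq_continuous_at[OF assms(3)] isCont_def by blast
  moreover have "eventually (\<lambda>x. x \<noteq> p) (at p)"
    by (simp add: eventually_at_filter)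
  hence "eventually (\<lambda>x. f x \<noteq> f p) (at p)"
    using evU by eventually_elim (use assms in metis)
  ultimately show "filterlim f (at (f p)) (at p)"
    by (simp add: filterlim_at)
  show "eventually (\<lambda>y. f (g y) = y) (at (f p))"
    using evV by eventually_elim (use assms in auto)
qed

lemma analytic_local_inverse:
  assumes "g analytic_on {a}" "deriv g a \<noteq> 0"
  obtains k V W where "open V" "a \<in> V" "open W" "g a \<in> W" "g holomorphic_on V" "k holomorphic_on W"
    "g ` V = W" "k ` W = V" "\<And>x. x \<in> V \<Longrightarrow> k (g x) = x" "\<And>y. y \<in> W \<Longrightarrow> g (k y) = y"
    "\<And>y. y \<in> W \<Longrightarrow> deriv k y \<noteq> 0"
proof -
  obtain S where S: "open S" "a \<in> S" "g holomorphic_on S"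
    using assms(1) analytic_at by blast
  obtain r where r: "r > 0" "ball a r \<subseteq> S" "open (g ` ball a r)" "inj_on g (ball a r)"
    using has_complex_derivative_locally_invertible[OF S(3,2,1) assms(2)] by blast
  have hol: "g holomorphic_on ball a r" using S r holomorphic_on_subset by blast
  obtain k where k: "k holomorphic_on (g ` ball a r)"
    "\<And>z. z \<in> ball a r \<Longrightarrow> deriv g z * deriv k (g z) = 1" "\<And>z. z \<in> ball a r \<Longrightarrow> k (g z) = z"
    using holomorphic_has_inverse[OF hol _ r(4)] by blast
  show thesis
  proof (rule that[of "ball a r" "g ` ball a r" k])
    show "deriv k y \<noteq> 0" if "y \<in> g ` ball a r" for y using k(2) that by fastforce
    show "k ` g ` ball a r = ball a r" using k(3) by force
  qed (use r k hol in auto)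
qed

lemma analytic_filtermap_at:
  fixes g :: "complex \<Rightarrow> complex"
  assumes "g analytic_on {a}" "deriv g a \<noteq> 0"
  shows "filtermap g (at a) = at (g a)"
proof -
  obtain k V W where *: "open V" "a \<in> V" "open W" "g a \<in> W" "g holomorphic_on V" "k holomorphic_on W"
    "g ` V = W" "k ` W = V" "\<And>x. x \<in> V \<Longrightarrow> k (g x) = x" "\<And>y. y \<in> W \<Longrightarrow> g (k y) = y"
    using analytic_local_inverse[OF assms] by metis
  show ?thesis
    by (rule filtermap_at_continuous_inverse[of V g W k])
       (use * in \<open>auto intro: holomorphic_on_imp_continuous_on\<close>)
qed

text \<open>Independence of orders from coordinates: the order of a composition is a product, and
  the inner factor \<open>g x - g a\<close> has a simple zero because
  \<open>deriv g a \<noteq> 0\<close>.\<close>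

lemma zorder_compose_regular:
  assumes "f meromorphic_on {g a}" "g analytic_on {a}" "deriv g a \<noteq> 0"
    and "eventually (\<lambda>w. f w \<noteq> 0) (at (g a))"
  shows "zorder (f \<circ> g) a = zorder f (g a)"
proof -
  have ev: "eventually (\<lambda>w. g w \<noteq> g a) (at a)"
  proof -
    have "eventually (\<lambda>y. y \<noteq> g a) (filtermap g (at a))"
      unfolding analytic_filtermap_at[OF assms(2,3)] by (simp add: eventually_at_filter)
    thus ?thesis by (simp add: eventually_filtermap)
  qed
  have "zorder (\<lambda>x. g x - g a) a = 1"
  proof (rule zorder_zero_eqI')
    show "(\<lambda>x. g x - g a) analytic_on {a}" using assms by (intro analytic_intros)
    show "(deriv ^^ i) (\<lambda>x. g x - g a) a = 0" if "i < nat 1" for i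
      using that by simp
    have "deriv (\<lambda>x. g x - g a) a = deriv g a"
      using assms(2) by (subst deriv_diff)
        (auto dest: analytic_on_imp_differentiable_at)
    thus "(deriv ^^ nat 1) (\<lambda>x. g x - g a) a \<noteq> 0" using assms by simp
  qed auto
  moreover have "zorder (f \<circ> g) a = zorder f (g a) * zorder (\<lambda>x. g x - g a) a"
    using assms ev by (intro zorder_compose') (auto simp: meromorphic_at_iff)
  ultimately show ?thesis by simp
qed

text \<open>Writing \<open>g w = k w * (w - a) ^ m\<close> with \<open>k a \<noteq> 0\<close>, an
  \<open>m\<close>-th root of \<open>k\<close> turns the zero into a power of a coordinate.
  Exponents 1 and 2 are the ones that a two-sheeted covering produces.\<close>

lemma analytic_root_coordinate:
  assumes "g analytic_on {a}" "eventually (\<lambda>w. g w \<noteq> 0) (at a)" "zorder g a = int m"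
    "m = 1 \<or> m = 2"
  obtains h where "h analytic_on {a}" "h a = 0" "deriv h a \<noteq> 0" "eventually (\<lambda>w. g w = h w ^ m) (nhds a)"
proof -
  obtain S where S: "open S" "a \<in> S" "g holomorphic_on S"
    using assms(1) analytic_at by blast
  have fr: "\<exists>\<^sub>F w in at a. g w \<noteq> 0" using assms(2) by (simp add: eventually_frequently)
  obtain r k where r: "r > 0" "k holomorphic_on cball a r" "k a \<noteq> 0"
    and eq: "\<And>w. w \<in> cball a r - {a} \<Longrightarrow> g w = k w * (w - a) powi int m"
  proof -
    have iso: "isolated_singularity_at g a" "not_essential g a"
      using analytic_on_imp_meromorphic_on[OF assms(1)] by (auto simp: meromorphic_at_iff)
    show ?thesis
      using zorder_exist[OF iso fr] that unfolding assms(3) by blast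
  qed
  have ga: "g a = 0"
    using zorder_pos_iff'[OF assms(1) fr] assms by auto
  have eq': "g w = k w * (w - a) ^ m" if "w \<in> ball a r" for w
    using eq[of w] that ga assms(4) by (cases "w = a") (auto simp: power_int_def)
  have kan: "k analytic_on {a}"
    using r by (meson analytic_at ball_subset_cball centre_in_ball holomorphic_on_subset open_ball)
  \<comment> \<open>Dividing by \<open>k a\<close> moves the value at \<open>a\<close> to 1, away
    from the branch cut of \<open>csqrt\<close>; the factor \<open>csqrt c\<close> undoes
    this.\<close>
  define c where "c = k a"
  have "(\<lambda>w. k w / c) analytic_on {a}"
    using r kan unfolding c_def by (intro analytic_intros) auto
  define l where "l = (\<lambda>w. if m = 1 then k w else csqrt c * csqrt (k w / c))"
  have lan: "l analytic_on {a}"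
  proof (cases "m = 1")
    case True thus ?thesis using kan by (simp add: l_def)
  next
    case False
    have "(csqrt \<circ> (\<lambda>w. k w / c)) analytic_on {a}"
      by (rule analytic_on_compose[OF \<open>(\<lambda>w. k w / c) analytic_on {a}\<close>])
         (use r in \<open>auto simp: c_def intro!: analytic_on_csqrt'\<close>)
    thus ?thesis using False unfolding l_def by (auto simp: o_def intro!: analytic_intros)
  qed
  have lm: "l w ^ m = k w" for w
    using assms(4) r by (auto simp: l_def power_mult_distrib c_def)
  define h where "h = (\<lambda>w. l w * (w - a))"
  show thesis
  proof (rule that[of h])
    show "h analytic_on {a}" unfolding h_def by (intro analytic_intros lan)
    show "h a = 0" by (simp add: h_def)
    have "(l has_field_derivative deriv l a) (at a)"
      using lan analytic_on_imp_differentiable_at DERIV_deriv_iff_field_differentiable by blast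
    hence "(h has_field_derivative (deriv l a * (a - a) + 1 * l a)) (at a)"
      unfolding h_def by (auto intro!: derivative_eq_intros)
    hence "deriv h a = l a" by (simp add: DERIV_imp_deriv)
    moreover have "l a \<noteq> 0" using lm[of a] r assms(4) by auto
    ultimately show "deriv h a \<noteq> 0" by simp
    have "eventually (\<lambda>w. w \<in> ball a r) (nhds a)" using r by (intro eventually_nhds_in_open) auto
    thus "eventually (\<lambda>w. g w = h w ^ m) (nhds a)"
      by eventually_elim (simp add: eq' h_def power_mult_distrib lm)
  qed
qed

text \<open>With \<open>F w = k w * w powi n\<close> and \<open>k 0 \<noteq> 0\<close>, the ratio
  \<open>F (- w) / F w\<close> equals \<open>(-1) powi n * (k (- w) / k w)\<close>. It tends to
  \<open>(-1) powi n\<close> at 0 and is constantly \<open>c\<close>.\<close>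

lemma zorder_parity:
  assumes "F meromorphic_on {0}" "eventually (\<lambda>w. F w \<noteq> 0) (at 0)"
    "eventually (\<lambda>w. F (- w) = c * F w) (at 0)"
  shows "c = (-1) powi zorder F 0"
proof -
  obtain r k where r: "r > 0" "k holomorphic_on cball 0 r" "k 0 \<noteq> 0"
    and eq: "\<And>w. w \<in> cball 0 r - {0} \<Longrightarrow> F w = k w * w powi zorder F 0 \<and> k w \<noteq> 0"
  proof -
    have iso: "isolated_singularity_at F 0" "not_essential F 0"
      using assms(1) by (auto simp: meromorphic_at_iff)
    have "\<exists>\<^sub>F w in at 0. F w \<noteq> 0" using assms(2) by (simp add: eventually_frequently)
    from zorder_exist[OF iso this] show ?thesis using that by auto
  qed
  define n where "n = zorder F 0"
  have kc: "isCont k 0"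
    using r by (meson analytic_at analytic_at_imp_isCont ball_subset_cball centre_in_ball holomorphic_on_subset open_ball)
  have kc': "isCont (\<lambda>w. k (- w)) 0"
    by (rule isCont_o2) (use kc in \<open>auto intro: continuous_intros\<close>)
  have "((\<lambda>w. (-1) powi n * (k (- w) / k w)) \<longlongrightarrow> (-1) powi n * (k (- 0) / k 0)) (at 0)"
    using r isContD[OF kc] isContD[OF kc'] by (intro tendsto_intros) auto
  moreover have "eventually (\<lambda>w. w \<in> cball 0 r - {0}) (at (0::complex))"
    using r eventually_at_in_open[of "ball 0 r" "0::complex"] by (auto elim!: eventually_mono)
  hence "eventually (\<lambda>w. (-1) powi n * (k (- w) / k w) = c) (at 0)" using assms(3)
  proof eventually_elim
    case (elim w)
    have 1: "F w = k w * w powi n" "k w \<noteq> 0" "F (- w) = k (- w) * (- w) powi n"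
      using eq[of w] eq[of "- w"] elim by (auto simp: n_def)
    have "(- w) powi n = (-1) powi n * w powi n"
      by (simp add: power_int_minus_left)
    moreover have "w powi n \<noteq> 0" using elim by auto
    ultimately show ?case using 1 elim by (simp add: field_simps)
  qed
  hence "((\<lambda>w. (-1) powi n * (k (- w) / k w)) \<longlongrightarrow> c) (at 0)"
    by (simp add: tendsto_eventually)
  ultimately have "c = (-1) powi n * (k 0 / k 0)"
    using tendsto_unique by force
  thus ?thesis using r by (simp add: n_def)
qed

lemma meromorphic_at_cong:
  assumes "eventually (\<lambda>w. f w = g w) (at z)"
  shows "f meromorphic_on {z} \<longleftrightarrow> g meromorphic_on {z}"
  by (rule meromorphic_on_cong) (use assms in auto)

section \<open>Charts as local identifications with the plane\<close>

context riemann_surface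
begin

lemma obtain_chart:
  obtains U \<phi> where "(U, \<phi>) \<in> A" "p \<in> U"
proof -
  have "p \<in> (\<Union>(U, \<phi>)\<in>A. U)" using atlas_cover by simp
  thus thesis using that by auto
qed

lemma chart_homeo:
  assumes "(U, \<phi>) \<in> A"
  shows "open U" "open (\<phi> ` U)" "continuous_on U \<phi>" "continuous_on (\<phi> ` U) (inv_into U \<phi>)"
    "\<And>x. x \<in> U \<Longrightarrow> inv_into U \<phi> (\<phi> x) = x" "inv_into U \<phi> ` \<phi> ` U = U"
  using atlas_chart[OF assms] unfolding homeomorphism_def by auto

text \<open>Through these equations every limit and every "eventually" at a point of the surface
  becomes the same statement in the plane.\<close>

lemma chart_filtermap:
  assumes "(U, \<phi>) \<in> A" "p \<in> U"
  shows "filtermap \<phi> (at p) = at (\<phi> p)" "filtermap (inv_into U \<phi>) (at (\<phi> p)) = at p"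
proof -
  note c = chart_homeo[OF assms(1)]
  show "filtermap \<phi> (at p) = at (\<phi> p)"
    by (rule filtermap_at_continuous_inverse[of U \<phi> "\<phi> ` U" "inv_into U \<phi>"])
       (use c assms in \<open>auto simp: f_inv_into_f\<close>)
  have "filtermap (inv_into U \<phi>) (at (\<phi> p)) = at (inv_into U \<phi> (\<phi> p))"
    by (rule filtermap_at_continuous_inverse[of "\<phi> ` U" "inv_into U \<phi>" U \<phi>])
       (use c assms in \<open>auto simp: f_inv_into_f\<close>)
  thus "filtermap (inv_into U \<phi>) (at (\<phi> p)) = at p" using c assms by simp
qed

lemma eventually_chart:
  assumes "(U, \<phi>) \<in> A" "p \<in> U"
  shows "eventually P (at p) \<longleftrightarrow> eventually (\<lambda>w. P (inv_into U \<phi> w)) (at (\<phi> p))"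
  by (simp add: eventually_filtermap flip: chart_filtermap(2)[OF assms])

lemma at_neq_bot [simp]: "at (p :: 'a) \<noteq> bot"
proof -
  obtain U \<phi> where c: "(U, \<phi>) \<in> A" "p \<in> U" by (rule obtain_chart)
  have "filtermap (inv_into U \<phi>) (at (\<phi> p)) \<noteq> bot" by (simp add: filtermap_bot_iff)
  thus ?thesis using chart_filtermap(2)[OF c] by simp
qed

lemma transition:
  assumes "(U, \<phi>) \<in> A" "(V, \<psi>) \<in> A" "p \<in> U" "p \<in> V"
  shows "(\<psi> \<circ> inv_into U \<phi>) analytic_on {\<phi> p}" "deriv (\<psi> \<circ> inv_into U \<phi>) (\<phi> p) \<noteq> 0"
    "(\<psi> \<circ> inv_into U \<phi>) (\<phi> p) = \<psi> p"
    "eventually (\<lambda>w. (f \<circ> inv_into U \<phi>) w = ((f \<circ> inv_into V \<psi>) \<circ> (\<psi> \<circ> inv_into U \<phi>)) w) (nhds (\<phi> p))"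
proof -
  note cU = chart_homeo[OF assms(1)] and cV = chart_homeo[OF assms(2)]
  let ?T = "\<psi> \<circ> inv_into U \<phi>" and ?W = "\<phi> ` (U \<inter> V)"
  have img: "?W = \<phi> ` U \<inter> inv_into U \<phi> -` V"
    using cU(5) by auto
  have W: "open ?W" unfolding img
    using continuous_open_preimage[OF cU(4,2) cV(1)] by (simp add: Int_commute vimage_def Int_def)
  have hol: "?T holomorphic_on ?W" using atlas_compatible assms by blast
  have pW: "\<phi> p \<in> ?W" using assms by auto
  show "?T analytic_on {\<phi> p}" using hol W pW analytic_at by blast
  have inj: "inj_on ?T ?W"
    by (rule inj_on_inverseI[of _ "\<phi> \<circ> inv_into V \<psi>"]) (use cU(5) cV(5) in auto)
  show "deriv ?T (\<phi> p) \<noteq> 0"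
    using holomorphic_injective_imp_regular[OF hol W inj pW] .
  show "?T (\<phi> p) = \<psi> p" using cU(5) assms by simp
  have "eventually (\<lambda>w. w \<in> ?W) (nhds (\<phi> p))" using W pW by (rule eventually_nhds_in_open)
  thus "eventually (\<lambda>w. (f \<circ> inv_into U \<phi>) w = ((f \<circ> inv_into V \<psi>) \<circ> ?T) w) (nhds (\<phi> p))"
    by eventually_elim (use cU(5) cV(5) in auto)
qed

section \<open>Meromorphic germs and their orders\<close>

definition mero :: "('a \<Rightarrow> complex) \<Rightarrow> 'a \<Rightarrow> bool" where
  "mero f p \<longleftrightarrow> (\<forall>U \<phi>. (U, \<phi>) \<in> A \<longrightarrow> p \<in> U \<longrightarrow> (f \<circ> inv_into U \<phi>) meromorphic_on {\<phi> p})"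

definition ev_nz :: "('a \<Rightarrow> complex) \<Rightarrow> 'a \<Rightarrow> bool" where
  "ev_nz f p \<longleftrightarrow> eventually (\<lambda>x. f x \<noteq> 0) (at p)"

abbreviation ord :: "('a \<Rightarrow> complex) \<Rightarrow> 'a \<Rightarrow> int" where
  "ord \<equiv> order_at A"

lemma meroI_chart:
  assumes "(U, \<phi>) \<in> A" "p \<in> U" "(f \<circ> inv_into U \<phi>) meromorphic_on {\<phi> p}"
  shows "mero f p"
  unfolding mero_def
proof (intro allI impI)
  fix V \<psi> assume V: "(V, \<psi>) \<in> A" "p \<in> V"
  note t = transition[OF V(1) assms(1) V(2) assms(2)]
  have "(\<lambda>w. (f \<circ> inv_into U \<phi>) ((\<phi> \<circ> inv_into V \<psi>) w)) meromorphic_on {\<psi> p}"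
    by (rule meromorphic_on_compose[OF assms(3) t(1)]) (use t(3) in auto)
  moreover have "eventually (\<lambda>w. (f \<circ> inv_into V \<psi>) w = (f \<circ> inv_into U \<phi>) ((\<phi> \<circ> inv_into V \<psi>) w)) (at (\<psi> p))"
    using t(4)[of f] by (auto simp: eventually_at_filter elim: eventually_mono)
  ultimately show "(f \<circ> inv_into V \<psi>) meromorphic_on {\<psi> p}"
    by (simp add: meromorphic_at_cong)
qed

lemma order_at_chart:
  assumes "(U, \<phi>) \<in> A" "p \<in> U" "mero f p" "ev_nz f p"
  shows "ord f p = zorder (f \<circ> inv_into U \<phi>) (\<phi> p)"
proof -
  obtain V \<psi> where V: "(SOME c. c \<in> A \<and> p \<in> fst c) = (V, \<psi>)" by fastforce
  have "(V, \<psi>) \<in> A \<and> p \<in> fst (V, \<psi>)"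
    unfolding V[symmetric] by (rule someI_ex) (use assms in force)
  hence V': "(V, \<psi>) \<in> A" "p \<in> V" by auto
  note t = transition[OF V'(1) assms(1) V'(2) assms(2)]
  have "ord f p = zorder (f \<circ> inv_into V \<psi>) (\<psi> p)"
    by (simp add: order_at_def V)
  also have "\<dots> = zorder ((f \<circ> inv_into U \<phi>) \<circ> (\<phi> \<circ> inv_into V \<psi>)) (\<psi> p)"
    using t(4)[of f] by (intro zorder_cong) (auto simp: eventually_at_filter elim!: eventually_mono)
  also have "\<dots> = zorder (f \<circ> inv_into U \<phi>) ((\<phi> \<circ> inv_into V \<psi>) (\<psi> p))"
    using assms t eventually_chart[OF assms(1,2), of "\<lambda>x. f x \<noteq> 0"]
    by (intro zorder_compose_regular) (auto simp: mero_def ev_nz_def)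
  finally show ?thesis using t(3) by simp
qed

text \<open>Germs at \<open>0\<close> of inverses of local coordinates centred at \<open>p\<close>.\<close>

definition param :: "(complex \<Rightarrow> 'a) \<Rightarrow> 'a \<Rightarrow> bool" where
  "param \<gamma> p \<longleftrightarrow> \<gamma> 0 = p \<and> (\<exists>U \<phi>. (U, \<phi>) \<in> A \<and> p \<in> U \<and> eventually (\<lambda>w. \<gamma> w \<in> U) (nhds 0) \<and>
     (\<phi> \<circ> \<gamma>) analytic_on {0} \<and> deriv (\<phi> \<circ> \<gamma>) 0 \<noteq> 0)"

lemma param_filtermap:
  assumes "param \<gamma> p"
  shows "filtermap \<gamma> (at 0) = at p"
proof -
  obtain U \<phi> where U: "\<gamma> 0 = p" "(U, \<phi>) \<in> A" "p \<in> U" "eventually (\<lambda>w. \<gamma> w \<in> U) (nhds 0)"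
    "(\<phi> \<circ> \<gamma>) analytic_on {0}" "deriv (\<phi> \<circ> \<gamma>) 0 \<noteq> 0"
    using assms unfolding param_def by blast
  have "eventually (\<lambda>w. \<gamma> w = inv_into U \<phi> ((\<phi> \<circ> \<gamma>) w)) (at 0)"
    using U(4) chart_homeo(5)[OF U(2)] by (auto simp: eventually_at_filter elim!: eventually_mono)
  hence "filtermap \<gamma> (at 0) = filtermap (inv_into U \<phi>) (filtermap (\<phi> \<circ> \<gamma>) (at 0))"
    by (auto simp: filter_eq_iff eventually_filtermap elim: eventually_elim2)
  also have "\<dots> = at p"
    using analytic_filtermap_at[OF U(5,6)] chart_filtermap(2)[OF U(2,3)] U(1) by simp
  finally show ?thesis .
qed

lemma eventually_param:
  assumes "param \<gamma> p"
  shows "eventually P (at p) \<longleftrightarrow> eventually (\<lambda>w. P (\<gamma> w)) (at 0)"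
  by (simp add: eventually_filtermap flip: param_filtermap[OF assms])

lemma tendsto_param:
  assumes "param \<gamma> p"
  shows "filterlim f F (at p) \<longleftrightarrow> filterlim (f \<circ> \<gamma>) F (at 0)"
  by (simp add: filterlim_filtermap o_def flip: param_filtermap[OF assms])

lemma mero_param:
  assumes "param \<gamma> p"
  shows "mero f p \<longleftrightarrow> (f \<circ> \<gamma>) meromorphic_on {0}"
proof -
  obtain U \<phi> where U: "\<gamma> 0 = p" "(U, \<phi>) \<in> A" "p \<in> U" "eventually (\<lambda>w. \<gamma> w \<in> U) (nhds 0)"
    "(\<phi> \<circ> \<gamma>) analytic_on {0}" "deriv (\<phi> \<circ> \<gamma>) 0 \<noteq> 0"
    using assms unfolding param_def by blast
  have ev: "eventually (\<lambda>w. \<gamma> w = inv_into U \<phi> ((\<phi> \<circ> \<gamma>) w)) (at 0)"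
    using U(4) chart_homeo(5)[OF U(2)] by (auto simp: eventually_at_filter elim!: eventually_mono)
  obtain k V W where k: "open V" "0 \<in> V" "open W" "(\<phi> \<circ> \<gamma>) 0 \<in> W" "k holomorphic_on W"
     "k ` W = V" "\<And>x. x \<in> V \<Longrightarrow> k ((\<phi> \<circ> \<gamma>) x) = x" "\<And>y. y \<in> W \<Longrightarrow> (\<phi> \<circ> \<gamma>) (k y) = y"
    using analytic_local_inverse[OF U(5,6)] by metis
  have kp: "k (\<phi> p) = 0" using k(7)[of 0] k(2) U(1) by simp
  have kan: "k analytic_on {\<phi> p}" using k U(1) analytic_at by fastforce
  show ?thesis
  proof
    assume "mero f p"
    hence "(f \<circ> inv_into U \<phi>) meromorphic_on {\<phi> p}" using U by (auto simp: mero_def)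
    hence "(\<lambda>w. (f \<circ> inv_into U \<phi>) ((\<phi> \<circ> \<gamma>) w)) meromorphic_on {0}"
      by (rule meromorphic_on_compose[OF _ U(5)]) (use U in auto)
    moreover have "eventually (\<lambda>w. (f \<circ> \<gamma>) w = (f \<circ> inv_into U \<phi>) ((\<phi> \<circ> \<gamma>) w)) (at 0)"
      using ev by eventually_elim simp
    ultimately show "(f \<circ> \<gamma>) meromorphic_on {0}"
      by (simp add: meromorphic_at_cong)
  next
    assume "(f \<circ> \<gamma>) meromorphic_on {0}"
    hence "(\<lambda>w. (f \<circ> \<gamma>) (k w)) meromorphic_on {\<phi> p}"
      by (rule meromorphic_on_compose[OF _ kan]) (use kp in auto)
    moreover have "eventually (\<lambda>w. (f \<circ> inv_into U \<phi>) w = (f \<circ> \<gamma>) (k w)) (at (\<phi> p))"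
    proof -
      have "eventually (\<lambda>w. \<gamma> w \<in> U) (filtermap k (nhds (\<phi> p)))"
        using U(4) kp analytic_at_imp_isCont[OF kan] by (metis filterlim_def isCont_def tendsto_at_iff_tendsto_nhds filter_leD)
      hence 1: "eventually (\<lambda>w. \<gamma> (k w) \<in> U) (nhds (\<phi> p))" by (simp add: eventually_filtermap)
      moreover have "eventually (\<lambda>w. w \<in> W) (nhds (\<phi> p))"
        using k U(1) by (intro eventually_nhds_in_open) auto
      ultimately have "eventually (\<lambda>w. (f \<circ> inv_into U \<phi>) w = (f \<circ> \<gamma>) (k w)) (nhds (\<phi> p))"
      proof eventually_elim
        case (elim w)
        have "inv_into U \<phi> w = inv_into U \<phi> (\<phi> (\<gamma> (k w)))" using k(8)[OF elim(2)] by simp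
        also have "\<dots> = \<gamma> (k w)" using chart_homeo(5)[OF U(2)] elim by simp
        finally show ?case by simp
      qed
      thus ?thesis by (auto simp: eventually_at_filter elim: eventually_mono)
    qed
    ultimately have "(f \<circ> inv_into U \<phi>) meromorphic_on {\<phi> p}"
      by (simp add: meromorphic_at_cong)
    thus "mero f p" using meroI_chart U by blast
  qed
qed

lemma order_at_param:
  assumes "param \<gamma> p" "mero f p" "ev_nz f p"
  shows "ord f p = zorder (f \<circ> \<gamma>) 0"
proof -
  obtain U \<phi> where U: "\<gamma> 0 = p" "(U, \<phi>) \<in> A" "p \<in> U" "eventually (\<lambda>w. \<gamma> w \<in> U) (nhds 0)"
    "(\<phi> \<circ> \<gamma>) analytic_on {0}" "deriv (\<phi> \<circ> \<gamma>) 0 \<noteq> 0"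
    using assms unfolding param_def by blast
  have ev: "eventually (\<lambda>w. \<gamma> w = inv_into U \<phi> ((\<phi> \<circ> \<gamma>) w)) (at 0)"
    using U(4) chart_homeo(5)[OF U(2)] by (auto simp: eventually_at_filter elim!: eventually_mono)
  have "zorder (f \<circ> \<gamma>) 0 = zorder ((f \<circ> inv_into U \<phi>) \<circ> (\<phi> \<circ> \<gamma>)) 0"
    using ev by (intro zorder_cong) (auto elim!: eventually_mono)
  also have "\<dots> = zorder (f \<circ> inv_into U \<phi>) ((\<phi> \<circ> \<gamma>) 0)"
    using assms U eventually_chart[OF U(2,3), of "\<lambda>x. f x \<noteq> 0"]
    by (intro zorder_compose_regular) (auto simp: mero_def ev_nz_def)
  finally show ?thesis using order_at_chart[OF U(2,3) assms(2,3)] U(1) by simp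
qed

lemma obtain_param:
  obtains \<gamma> where "param \<gamma> p"
proof -
  obtain U \<phi> where U: "(U, \<phi>) \<in> A" "p \<in> U" by (rule obtain_chart)
  note c = chart_homeo[OF U(1)]
  let ?g = "\<lambda>w. inv_into U \<phi> (\<phi> p + w)"
  have "open ((\<lambda>w. \<phi> p + w) -` (\<phi> ` U))"
    by (intro open_vimage c continuous_intros)
  hence "eventually (\<lambda>w. w \<in> (\<lambda>w. \<phi> p + w) -` (\<phi> ` U)) (nhds 0)"
    using U by (intro eventually_nhds_in_open) auto
  hence 1: "eventually (\<lambda>w. \<phi> p + w \<in> \<phi> ` U) (nhds 0)" by simp
  have 2: "eventually (\<lambda>w. (\<phi> \<circ> ?g) w = \<phi> p + w) (nhds 0)"
    using 1 by eventually_elim (simp add: f_inv_into_f)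
  have "param ?g p"
    unfolding param_def
  proof (intro conjI exI)
    show "inv_into U \<phi> (\<phi> p + 0) = p" using c U by simp
    show "eventually (\<lambda>w. ?g w \<in> U) (nhds 0)" using 1 by eventually_elim (rule inv_into_into)
    have "(\<lambda>w. \<phi> p + w) analytic_on {0}" by (intro analytic_intros)
    thus "(\<phi> \<circ> ?g) analytic_on {0}" using analytic_at_cong[OF 2 refl] by blast
    have "deriv (\<phi> \<circ> ?g) 0 = deriv (\<lambda>w. \<phi> p + w) 0" using 2 by (rule deriv_cong_ev) simp
    also have "\<dots> = 1" by (intro DERIV_imp_deriv) (auto intro!: derivative_eq_intros)
    finally show "deriv (\<phi> \<circ> ?g) 0 \<noteq> 0" by simp
  qed (use U in auto)
  thus thesis by (rule that)
qed

lemma mero_cong: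
  assumes "eventually (\<lambda>x. f x = g x) (at p)"
  shows "mero f p \<longleftrightarrow> mero g p"
proof -
  obtain \<gamma> where g: "param \<gamma> p" by (rule obtain_param)
  show ?thesis using assms unfolding mero_param[OF g] eventually_param[OF g]
    by (intro meromorphic_on_cong) auto
qed

lemma ev_nz_cong:
  assumes "eventually (\<lambda>x. f x = g x) (at p)"
  shows "ev_nz f p \<longleftrightarrow> ev_nz g p"
  unfolding ev_nz_def by (rule eventually_cong[OF assms]) simp

lemma ord_cong:
  assumes "eventually (\<lambda>x. f x = g x) (at p)"
  shows "ord f p = ord g p"
proof -
  obtain V \<psi> where V: "(SOME c. c \<in> A \<and> p \<in> fst c) = (V, \<psi>)" by fastforce
  obtain U \<phi> where U: "(U, \<phi>) \<in> A" "p \<in> U" by (rule obtain_chart)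
  have "(V, \<psi>) \<in> A \<and> p \<in> fst (V, \<psi>)"
    unfolding V[symmetric] by (rule someI_ex) (use U in force)
  hence V': "(V, \<psi>) \<in> A" "p \<in> V" by auto
  show ?thesis unfolding order_at_def V
    using assms unfolding eventually_chart[OF V'] by (auto intro!: zorder_cong)
qed

lemma mero_const [simp, intro]: "mero (\<lambda>_. c) p"
  unfolding mero_def by (auto simp: o_def)

lemma mero_mult: "mero f p \<Longrightarrow> mero g p \<Longrightarrow> mero (\<lambda>x. f x * g x) p"
  and mero_diff: "mero f p \<Longrightarrow> mero g p \<Longrightarrow> mero (\<lambda>x. f x - g x) p"
  and mero_divide: "mero f p \<Longrightarrow> mero g p \<Longrightarrow> mero (\<lambda>x. f x / g x) p"
  and mero_power_int: "mero f p \<Longrightarrow> mero (\<lambda>x. f x powi n) p"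
  unfolding mero_def o_def by (auto intro!: meromorphic_intros)

lemma mero_eventually_zero_or_nonzero:
  assumes "mero f p"
  shows "eventually (\<lambda>x. f x = 0) (at p) \<or> ev_nz f p"
proof -
  obtain \<gamma> where g: "param \<gamma> p" by (rule obtain_param)
  have m: "isolated_singularity_at (f \<circ> \<gamma>) 0" "not_essential (f \<circ> \<gamma>) 0"
    using assms unfolding mero_param[OF g] meromorphic_at_iff by auto
  show ?thesis unfolding ev_nz_def eventually_param[OF g]
    using not_essential_frequently_0_imp_eventually_0[OF m] by (auto simp: frequently_def)
qed

lemma ev_nz_not_zero:
  assumes "ev_nz f p" shows "\<not> eventually (\<lambda>x. f x = 0) (at p)"
proof
  assume "eventually (\<lambda>x. f x = 0) (at p)"
  hence "eventually (\<lambda>x. False) (at p)"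
    using assms unfolding ev_nz_def by eventually_elim simp
  thus False by simp
qed

lemma ev_nz_mult: "ev_nz f p \<Longrightarrow> ev_nz g p \<Longrightarrow> ev_nz (\<lambda>x. f x * g x) p"
  and ev_nz_divide: "ev_nz f p \<Longrightarrow> ev_nz g p \<Longrightarrow> ev_nz (\<lambda>x. f x / g x) p"
  unfolding ev_nz_def by (auto elim: eventually_elim2)

lemma ev_nz_power_int: "ev_nz f p \<Longrightarrow> ev_nz (\<lambda>x. f x powi n) p"
  unfolding ev_nz_def by (erule eventually_mono) simp

lemma ev_nz_const [simp]: "ev_nz (\<lambda>_. c) p \<longleftrightarrow> c \<noteq> 0"
  by (auto simp: ev_nz_def)

lemma ord_const [simp]: "c \<noteq> 0 \<Longrightarrow> ord (\<lambda>_. c) p = 0"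
  by (simp add: order_at_def o_def case_prod_unfold)

lemma
  assumes "mero f p" "ev_nz f p"
  shows ord_mult: "mero g p \<Longrightarrow> ev_nz g p \<Longrightarrow> ord (\<lambda>x. f x * g x) p = ord f p + ord g p"
    and ord_divide: "mero g p \<Longrightarrow> ev_nz g p \<Longrightarrow> ord (\<lambda>x. f x / g x) p = ord f p - ord g p"
    and ord_power_int: "ord (\<lambda>x. f x powi n) p = n * ord f p"
proof -
  obtain \<gamma> where g: "param \<gamma> p" by (rule obtain_param)
  have fr: "mero h p \<Longrightarrow> ev_nz h p \<Longrightarrow> (h \<circ> \<gamma>) meromorphic_on {0} \<and> (\<exists>\<^sub>F w in at 0. (h \<circ> \<gamma>) w \<noteq> 0)" for h
    unfolding mero_param[OF g] ev_nz_def eventually_param[OF g] by (simp add: eventually_frequently)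
  note f = fr[OF assms]
  show "ord (\<lambda>x. f x * g x) p = ord f p + ord g p" if h: "mero g p" "ev_nz g p" for g
    using zorder_mult[of "f \<circ> \<gamma>" 0 "g \<circ> \<gamma>"] f fr[OF h]
      order_at_param[OF g mero_mult[OF assms(1) h(1)] ev_nz_mult[OF assms(2) h(2)]]
      order_at_param[OF g assms] order_at_param[OF g h] by (simp add: o_def)
  show "ord (\<lambda>x. f x / g x) p = ord f p - ord g p" if h: "mero g p" "ev_nz g p" for g
    using zorder_divide[of "f \<circ> \<gamma>" 0 "g \<circ> \<gamma>"] f fr[OF h]
      order_at_param[OF g mero_divide[OF assms(1) h(1)] ev_nz_divide[OF assms(2) h(2)]]
      order_at_param[OF g assms] order_at_param[OF g h] by (simp add: o_def)
  show "ord (\<lambda>x. f x powi n) p = n * ord f p"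
    using zorder_power_int[of "f \<circ> \<gamma>" 0 n] f
      order_at_param[OF g mero_power_int[OF assms(1)] ev_nz_power_int[OF assms(2)], of n]
      order_at_param[OF g assms] by (simp add: o_def)
qed

lemma
  assumes "mero f p" "ev_nz f p"
  shows ord_nonneg_imp_tendsto: "ord f p \<ge> 0 \<Longrightarrow> \<exists>c. (f \<longlongrightarrow> c) (at p)"
    and ord_pos_iff_tendsto: "ord f p > 0 \<longleftrightarrow> (f \<longlongrightarrow> 0) (at p)"
    and ord_neg_imp_at_infinity: "ord f p < 0 \<Longrightarrow> filterlim f at_infinity (at p)"
proof -
  obtain \<gamma> where g: "param \<gamma> p" by (rule obtain_param)
  define h where "h = f \<circ> \<gamma>"
  have h: "h meromorphic_on {0}" "eventually (\<lambda>w. h w \<noteq> 0) (at 0)"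
    using assms by (auto simp: mero_param[OF g] ev_nz_def eventually_param[OF g] h_def)
  have o: "ord f p = zorder h 0" using order_at_param[OF g assms] by (simp add: h_def)
  have hf: "\<exists>\<^sub>F w in at 0. h w \<noteq> 0" using h by (simp add: eventually_frequently)
  have hi: "isolated_singularity_at h 0" "not_essential h 0" using h by (auto simp: meromorphic_at_iff)
  have neg: "is_pole h 0 \<longleftrightarrow> zorder h 0 < 0"
    using zorder_neg_imp_is_pole[OF h] isolated_pole_imp_neg_zorder[OF hi(1)] by blast
  thus "ord f p < 0 \<Longrightarrow> filterlim f at_infinity (at p)"
    using o by (metis tendsto_param[OF g] h_def is_pole_def)
  show 1: "\<exists>c. (f \<longlongrightarrow> c) (at p)" if "ord f p \<ge> 0"
    using neg that o hi(2) by (auto simp: tendsto_param[OF g] h_def not_essential_def)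
  have "zorder h 0 > 0 \<longleftrightarrow> h \<midarrow>0\<rightarrow> 0"
  proof
    assume "zorder h 0 > 0"
    hence "isolated_zero h 0" by (rule zorder_pos_imp_isolated_zero[OF h])
    thus "h \<midarrow>0\<rightarrow> 0" by (simp add: isolated_zero_def)
  next
    assume "h \<midarrow>0\<rightarrow> 0"
    hence "isolated_zero h 0" using h by (simp add: isolated_zero_def)
    thus "zorder h 0 > 0" using h zorder_isolated_zero_pos' hi by blast
  qed
  thus "ord f p > 0 \<longleftrightarrow> (f \<longlongrightarrow> 0) (at p)" using o by (simp add: tendsto_param[OF g] h_def)
qed

text \<open>Both alternatives describe open sets of points, so connectedness leaves only one of them.\<close>

lemma eventually_propagates:
  assumes "\<And>p. eventually B (at p) \<or> eventually (\<lambda>x. \<not> B x) (at (p :: 'a))"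
    and "eventually B (at p)"
  shows "eventually B (at (q :: 'a))"
proof -
  have op: "open {p :: 'a. eventually C (at p)}" if "C = B \<or> C = (\<lambda>x. \<not> B x)" for C
  proof (subst open_subopen, intro ballI)
    fix x assume "x \<in> {p. eventually C (at p)}"
    then obtain S where S: "open S" "x \<in> S" "\<And>y. y \<in> S \<Longrightarrow> y \<noteq> x \<Longrightarrow> C y"
      unfolding eventually_at_topological mem_Collect_eq by blast
    have "eventually C (at y)" if "y \<in> S" for y
    proof (cases "y = x")
      case True thus ?thesis using S unfolding eventually_at_topological by blast
    next
      case False
      have "open (S - {x})" "y \<in> S - {x}" using S False that by auto
      thus ?thesis unfolding eventually_at_topological using S(3) by blast
    qed
    thus "\<exists>T. open T \<and> x \<in> T \<and> T \<subseteq> {p. eventually C (at p)}" using S by blast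
  qed
  have disj: "{p :: 'a. eventually B (at p)} \<inter> {p. eventually (\<lambda>x. \<not> B x) (at p)} = {}"
    by (auto dest: eventually_happens[OF eventually_conj])
  have "{p :: 'a. eventually B (at p)} = {} \<or> {p :: 'a. eventually (\<lambda>x. \<not> B x) (at p)} = {}"
    using connectedD[OF connected_surface op op, of B "\<lambda>x. \<not> B x"] disj assms(1) by auto
  thus ?thesis using assms by blast
qed

text \<open>The identity theorem: each germ is locally zero or locally nonvanishing, and
  connectedness makes the alternative global.\<close>

lemma nonzero_everywhere:
  assumes "\<And>p. mero f p" "ev_nz f p"
  shows "ev_nz f q"
  using assms mero_eventually_zero_or_nonzero[of f]
  unfolding ev_nz_def
  by (intro eventually_propagates[of "\<lambda>x. f x \<noteq> 0" p q]) auto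

end

section \<open>Removing singularities; passage between germs and functions on open sets\<close>

context riemann_surface
begin

lemma filterlim_chart:
  assumes "(U, \<phi>) \<in> A" "p \<in> U"
  shows "filterlim f F (at p) \<longleftrightarrow> filterlim (f \<circ> inv_into U \<phi>) F (at (\<phi> p))"
  by (simp add: filterlim_filtermap o_def flip: chart_filtermap(2)[OF assms])

text \<open>Chart-free form of \<open>remove_sings\<close>. The value 0 at poles is the one
  prescribed by \<open>nicely_meromorphic_on\<close>, so that normalizing a \<open>mero\<close>
  function meets \<open>mer_on\<close>.\<close>

definition normalized :: "('a \<Rightarrow> complex) \<Rightarrow> 'a \<Rightarrow> complex" where
  "normalized f p = (if \<exists>c. (f \<longlongrightarrow> c) (at p) then Lim (at p) f else 0)"

lemma normalized_tendsto: "(f \<longlongrightarrow> c) (at p) \<Longrightarrow> normalized f p = c"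
  unfolding normalized_def by (auto intro!: tendsto_Lim)

lemma normalized_chart:
  assumes "(U, \<phi>) \<in> A" "p \<in> U"
  shows "normalized f p = remove_sings (f \<circ> inv_into U \<phi>) (\<phi> p)"
proof (cases "\<exists>c. (f \<longlongrightarrow> c) (at p)")
  case True
  then obtain c where c: "(f \<longlongrightarrow> c) (at p)" by blast
  have "remove_sings (f \<circ> inv_into U \<phi>) (\<phi> p) = c"
    using c unfolding filterlim_chart[OF assms] by (rule remove_sings_eqI)
  thus ?thesis using normalized_tendsto[OF c] by simp
next
  case False
  thus ?thesis unfolding normalized_def remove_sings_def filterlim_chart[OF assms] by simp
qed

lemma eventually_normalized:
  assumes "mero f p"
  shows "eventually (\<lambda>x. normalized f x = f x) (at p)"
proof -
  obtain U \<phi> where U: "(U, \<phi>) \<in> A" "p \<in> U" by (rule obtain_chart)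
  have "isolated_singularity_at (f \<circ> inv_into U \<phi>) (\<phi> p)"
    using assms U by (auto simp: mero_def meromorphic_at_iff)
  hence "eventually (\<lambda>w. remove_sings (f \<circ> inv_into U \<phi>) w = (f \<circ> inv_into U \<phi>) w) (at (\<phi> p))"
    by (rule eventually_remove_sings_eq_at)
  hence "eventually (\<lambda>x. remove_sings (f \<circ> inv_into U \<phi>) (\<phi> x) = f (inv_into U \<phi> (\<phi> x))) (at p)"
    by (simp add: eventually_filtermap flip: chart_filtermap(1)[OF U])
  moreover have "eventually (\<lambda>x. x \<in> U) (at p)"
    using chart_homeo(1)[OF U(1)] U by (intro eventually_at_in_open') auto
  ultimately show ?thesis
    by eventually_elim (use normalized_chart[OF U(1)] chart_homeo(5)[OF U(1)] in auto)
qed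

lemma open_chart_image:
  assumes "(U, \<phi>) \<in> A" "open W"
  shows "open (\<phi> ` (U \<inter> W))"
proof -
  note c = chart_homeo[OF assms(1)]
  have "\<phi> ` (U \<inter> W) = \<phi> ` U \<inter> inv_into U \<phi> -` W"
    using c(5) by auto
  thus ?thesis using continuous_open_preimage[OF c(4,2) assms(2)]
    by (simp add: Int_commute vimage_def Int_def)
qed

lemma
  assumes "open W" "\<And>p. p \<in> W \<Longrightarrow> mero f p" "\<And>p. p \<in> W \<Longrightarrow> g p = normalized f p"
  shows mer_on_normalized: "mer_on A W g"
    and hol_on_normalized: "(\<And>p. p \<in> W \<Longrightarrow> \<exists>c. (f \<longlongrightarrow> c) (at p)) \<Longrightarrow> hol_on A W g"
proof -
  have *: "g (inv_into U \<phi> w) = remove_sings (f \<circ> inv_into U \<phi>) w"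
    if "(U, \<phi>) \<in> A" "w \<in> \<phi> ` (U \<inter> W)" for U \<phi> w
    using that assms(3) normalized_chart[OF that(1), of _ f] chart_homeo(5)[OF that(1)] by auto
  have m: "(f \<circ> inv_into U \<phi>) meromorphic_on \<phi> ` (U \<inter> W)" if "(U, \<phi>) \<in> A" for U \<phi>
    using assms(2) that by (subst meromorphic_on_meromorphic_at) (auto simp: mero_def)
  show "mer_on A W g"
    unfolding mer_on_def
  proof (intro ballI, clarify)
    fix U \<phi> assume U: "(U, \<phi>) \<in> A"
    let ?O = "\<phi> ` (U \<inter> W)" and ?r = "remove_sings (f \<circ> inv_into U \<phi>)"
    have op: "open ?O" by (rule open_chart_image[OF U assms(1)])
    have n: "?r nicely_meromorphic_on ?O" by (rule remove_sings_nicely_meromorphic[OF m[OF U]])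
    have ev: "eventually (\<lambda>w. (g \<circ> inv_into U \<phi>) w = ?r w) (at z)" if "z \<in> ?O" for z
    proof -
      have "eventually (\<lambda>w. w \<in> ?O) (at z)" using op that by (intro eventually_at_in_open') auto
      thus ?thesis by eventually_elim (use *[OF U] in auto)
    qed
    show "(g \<circ> inv_into U \<phi>) nicely_meromorphic_on ?O"
      unfolding nicely_meromorphic_on_def
    proof (intro conjI ballI)
      show "(g \<circ> inv_into U \<phi>) meromorphic_on ?O"
        using meromorphic_on_cong[OF ev refl] n unfolding nicely_meromorphic_on_def by blast
      fix z assume z: "z \<in> ?O"
      have "is_pole ?r z \<and> ?r z = 0 \<or> ?r \<midarrow>z\<rightarrow> ?r z"
        using n z unfolding nicely_meromorphic_on_def by blast
      moreover have "is_pole (g \<circ> inv_into U \<phi>) z \<longleftrightarrow> is_pole ?r z"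
        using ev[OF z] by (intro is_pole_cong) auto
      moreover have "(g \<circ> inv_into U \<phi>) z = ?r z" using *[OF U z] by simp
      moreover have "(g \<circ> inv_into U \<phi>) \<midarrow>z\<rightarrow> c \<longleftrightarrow> ?r \<midarrow>z\<rightarrow> c" for c
        using ev[OF z] by (intro filterlim_cong) auto
      ultimately show "is_pole (g \<circ> inv_into U \<phi>) z \<and> (g \<circ> inv_into U \<phi>) z = 0 \<or>
          (g \<circ> inv_into U \<phi>) \<midarrow>z\<rightarrow> (g \<circ> inv_into U \<phi>) z" by metis
    qed
  qed
  assume lim: "\<And>p. p \<in> W \<Longrightarrow> \<exists>c. (f \<longlongrightarrow> c) (at p)"
  show "hol_on A W g"
    unfolding hol_on_def
  proof (intro ballI, clarify)
    fix U \<phi> assume U: "(U, \<phi>) \<in> A"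
    let ?O = "\<phi> ` (U \<inter> W)" and ?r = "remove_sings (f \<circ> inv_into U \<phi>)"
    have "?r analytic_on {w}" if "w \<in> ?O" for w
    proof -
      obtain p where p: "p \<in> U" "p \<in> W" "w = \<phi> p" using \<open>w \<in> ?O\<close> by blast
      obtain c where "(f \<longlongrightarrow> c) (at p)" using lim p by blast
      hence "(f \<circ> inv_into U \<phi>) \<midarrow>w\<rightarrow> c" using filterlim_chart[OF U p(1)] p(3) by auto
      moreover have "isolated_singularity_at (f \<circ> inv_into U \<phi>) w"
        using m[OF U] that unfolding meromorphic_on_altdef by blast
      ultimately show ?thesis by (intro remove_sings_analytic_at)
    qed
    hence "?r holomorphic_on ?O"
      using analytic_on_analytic_at analytic_imp_holomorphic by blast
    thus "(g \<circ> inv_into U \<phi>) holomorphic_on ?O"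
      by (rule holomorphic_transform) (use *[OF U] in auto)
  qed
qed

lemma mer_on_imp_mero:
  assumes "mer_on A W f" "p \<in> W"
  shows "mero f p"
  unfolding mero_def
proof (intro allI impI)
  fix U \<phi> assume U: "(U, \<phi>) \<in> A" "p \<in> U"
  hence "(f \<circ> inv_into U \<phi>) meromorphic_on \<phi> ` (U \<inter> W)"
    using assms(1) by (auto simp: mer_on_def nicely_meromorphic_on_def)
  thus "(f \<circ> inv_into U \<phi>) meromorphic_on {\<phi> p}"
    by (rule meromorphic_on_subset) (use U assms in auto)
qed

lemma mer_on_nice:
  assumes "mer_on A W f" "p \<in> W"
  shows "filterlim f at_infinity (at p) \<and> f p = 0 \<or> (f \<longlongrightarrow> f p) (at p)"
proof -
  obtain U \<phi> where U: "(U, \<phi>) \<in> A" "p \<in> U" by (rule obtain_chart)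
  hence "(f \<circ> inv_into U \<phi>) nicely_meromorphic_on \<phi> ` (U \<inter> W)" "\<phi> p \<in> \<phi> ` (U \<inter> W)"
    using assms by (auto simp: mer_on_def)
  hence "is_pole (f \<circ> inv_into U \<phi>) (\<phi> p) \<and> (f \<circ> inv_into U \<phi>) (\<phi> p) = 0 \<or>
         (f \<circ> inv_into U \<phi>) \<midarrow>\<phi> p\<rightarrow> (f \<circ> inv_into U \<phi>) (\<phi> p)"
    unfolding nicely_meromorphic_on_def by blast
  thus ?thesis unfolding filterlim_chart[OF U] is_pole_def
    using chart_homeo(5)[OF U] by simp
qed

lemma mer_on_eventually_zero:
  assumes "mer_on A W f" "p \<in> W" "eventually (\<lambda>x. f x = 0) (at p)"
  shows "f p = 0"
proof -
  have "(f \<longlongrightarrow> 0) (at p)" using assms(3) by (simp add: tendsto_eventually)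
  thus ?thesis using mer_on_nice[OF assms(1,2)] tendsto_unique[of "at p"] by auto
qed

lemma hol_on_mero_isCont:
  assumes "hol_on A W f" "open W" "p \<in> W"
  shows "mero f p" "(f \<longlongrightarrow> f p) (at p)"
proof -
  have an: "(f \<circ> inv_into U \<phi>) analytic_on {\<phi> p}" if U: "(U, \<phi>) \<in> A" "p \<in> U" for U \<phi>
  proof -
    have "(f \<circ> inv_into U \<phi>) holomorphic_on \<phi> ` (U \<inter> W)"
      using assms(1) U(1) by (auto simp: hol_on_def)
    moreover have "open (\<phi> ` (U \<inter> W))" "\<phi> p \<in> \<phi> ` (U \<inter> W)"
      using open_chart_image[OF U(1) assms(2)] U assms by auto
    ultimately show ?thesis using analytic_at by blast
  qed
  thus "mero f p" unfolding mero_def using analytic_on_imp_meromorphic_on by blast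
  obtain U \<phi> where U: "(U, \<phi>) \<in> A" "p \<in> U" by (rule obtain_chart)
  show "(f \<longlongrightarrow> f p) (at p)"
    using analytic_at_imp_isCont[OF an[OF U]] chart_homeo(5)[OF U]
    unfolding isCont_def filterlim_chart[OF U] by simp
qed

text \<open>Zeros and poles are isolated, since off \<open>p\<close> the function is nearby analytic
  and nonzero. Compactness turns this into finiteness of divisors.\<close>

lemma eventually_ord_zero:
  assumes "mero f p" "ev_nz f p"
  shows "eventually (\<lambda>x. mero f x \<and> ev_nz f x \<and> ord f x = 0) (at p)"
proof -
  obtain U \<phi> where U: "(U, \<phi>) \<in> A" "p \<in> U" by (rule obtain_chart)
  let ?F = "f \<circ> inv_into U \<phi>"
  have "isolated_singularity_at ?F (\<phi> p)"
    using assms(1) U by (auto simp: mero_def meromorphic_at_iff)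
  then obtain r where r: "r > 0" "?F analytic_on ball (\<phi> p) r - {\<phi> p}"
    by (auto simp: isolated_singularity_at_def)
  have "eventually (\<lambda>w. w \<in> ball (\<phi> p) r - {\<phi> p}) (at (\<phi> p))"
    using r by (intro eventually_at_in_open) auto
  moreover have "eventually (\<lambda>w. ?F w \<noteq> 0) (at (\<phi> p))"
    using assms(2) eventually_chart[OF U, of "\<lambda>x. f x \<noteq> 0"] by (simp add: ev_nz_def)
  ultimately have "eventually (\<lambda>w. ?F analytic_on {w} \<and> ?F w \<noteq> 0) (at (\<phi> p))"
    by eventually_elim (use r in \<open>auto intro: analytic_on_subset\<close>)
  hence "eventually (\<lambda>x. ?F analytic_on {\<phi> x} \<and> ?F (\<phi> x) \<noteq> 0) (at p)"
    by (simp add: eventually_filtermap flip: chart_filtermap(1)[OF U])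
  moreover have "eventually (\<lambda>x. x \<in> U) (at p)"
    using chart_homeo(1)[OF U(1)] U by (intro eventually_at_in_open') auto
  ultimately show ?thesis
  proof eventually_elim
    case (elim x)
    have m: "mero f x"
      using elim U by (intro meroI_chart[of U \<phi>]) (auto intro: analytic_on_imp_meromorphic_on)
    have nz: "ev_nz f x"
      unfolding ev_nz_def eventually_chart[OF U(1) elim(2)]
      using analytic_at_neq_imp_eventually_neq[of ?F "\<phi> x" 0] elim(1) by simp
    show ?case using order_at_chart[OF U(1) elim(2) m nz] zorder_eq_0I elim m nz by auto
  qed
qed

end

section \<open>Consequences of compactness\<close>

context compact_riemann_surface
begin

lemma finite_support_ord:
  assumes "\<And>p. mero f p" "\<And>p. ev_nz f p"
  shows "finite {p. ord f p \<noteq> 0}"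
proof (rule ccontr)
  assume "infinite {p. ord f p \<noteq> 0}"
  then obtain x where x: "x islimpt {p. ord f p \<noteq> 0}"
    using Heine_Borel_imp_Bolzano_Weierstrass[OF compact_surface] by blast
  have "eventually (\<lambda>y. ord f y = 0) (at x)"
    using eventually_ord_zero[OF assms] by (rule eventually_mono) auto
  thus False using x by (auto simp: islimpt_conv_frequently_at frequently_def)
qed

text \<open>The maximum principle: once singularities are removed, the modulus attains its maximum,
  so the function is constant near that point and, by the identity theorem, everywhere. This stands
  in for a comparison of degrees.\<close>

lemma no_zeros_no_poles:
  assumes "\<And>p. mero f p" "\<And>p. ev_nz f p" "\<And>p. ord f p \<ge> 0"
  shows "ord f p = 0"
proof -
  define g where "g = normalized f"
  have lim: "\<exists>c. (f \<longlongrightarrow> c) (at p)" for p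
    using ord_nonneg_imp_tendsto[OF assms] .
  have h: "hol_on A UNIV g"
    by (rule hol_on_normalized[of UNIV f]) (use assms lim g_def in auto)
  have "isCont g p" for p using hol_on_mero_isCont[OF h] by (simp add: isCont_def)
  hence "continuous_on UNIV (\<lambda>p. norm (g p))"
    by (intro continuous_intros) (simp add: continuous_on_eq_continuous_at)
  then obtain q where q: "\<And>p. norm (g p) \<le> norm (g q)"
    using continuous_attains_sup[OF compact_surface] by blast
  obtain U \<phi> where U: "(U, \<phi>) \<in> A" "q \<in> U" by (rule obtain_chart)
  let ?G = "g \<circ> inv_into U \<phi>"
  have hG: "?G holomorphic_on \<phi> ` U" using h U by (auto simp: hol_on_def)
  obtain r where r: "r > 0" "ball (\<phi> q) r \<subseteq> \<phi> ` U"
    using chart_homeo(2)[OF U(1)] U(2) open_contains_ball by blast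
  have "?G constant_on ball (\<phi> q) r"
  proof (rule maximum_modulus_principle[where U = "ball (\<phi> q) r" and \<xi> = "\<phi> q"])
    show "?G holomorphic_on ball (\<phi> q) r" using hG r holomorphic_on_subset by blast
    show "norm (?G z) \<le> norm (?G (\<phi> q))" for z
      using q chart_homeo(5)[OF U] by simp
  qed (use r in auto)
  then obtain c where c: "\<And>w. w \<in> ball (\<phi> q) r \<Longrightarrow> ?G w = c" unfolding constant_on_def by blast
  have "eventually (\<lambda>w. w \<in> ball (\<phi> q) r) (at (\<phi> q))"
    using r by (intro eventually_at_in_open') auto
  hence "eventually (\<lambda>w. ?G w = c) (at (\<phi> q))" by eventually_elim (rule c)
  hence ev: "eventually (\<lambda>x. g x = c) (at q)" by (simp add: eventually_chart[OF U])
  have mg: "mero (\<lambda>x. g x - c) p" for p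
    using hol_on_mero_isCont(1)[OF h] by (intro mero_diff mero_const) auto
  have "\<not> ev_nz (\<lambda>x. g x - c) q" using ev ev_nz_not_zero[of "\<lambda>x. g x - c" q] by auto
  hence "\<not> ev_nz (\<lambda>x. g x - c) p" for p using nonzero_everywhere[of "\<lambda>x. g x - c" p q] mg by blast
  hence all: "eventually (\<lambda>x. g x = c) (at p)" for p
    using mero_eventually_zero_or_nonzero[OF mg, of p] by auto
  have fc: "eventually (\<lambda>x. f x = c) (at p)" for p
    using all[of p] eventually_normalized[OF assms(1)[of p]] unfolding g_def
    by eventually_elim simp
  have "c \<noteq> 0" using fc[of p] ev_nz_not_zero[OF assms(2)[of p]] by auto
  thus ?thesis using ord_cong[OF fc[of p]] by simp
qed

end

section \<open>Meromorphic sections\<close>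

context riemann_surface
begin

context
  fixes L :: "('i, 'a) cocycle"
  assumes L: "line_bundle A L"
begin

lemma line_bundle_dom:
  "\<exists>i\<in>lb_idx L. p \<in> lb_dom L i" "i \<in> lb_idx L \<Longrightarrow> open (lb_dom L i)"
  using L unfolding line_bundle_def by auto

lemma line_bundle_trans:
  assumes "i \<in> lb_idx L" "j \<in> lb_idx L" "p \<in> lb_dom L i" "p \<in> lb_dom L j"
  shows "lb_trans L i j p \<noteq> 0" "mero (lb_trans L i j) p" "(lb_trans L i j \<longlongrightarrow> lb_trans L i j p) (at p)"
    "ev_nz (lb_trans L i j) p" "ord (lb_trans L i j) p = 0"
proof -
  have "lb_trans L i j p * lb_trans L j i p = lb_trans L i i p" "lb_trans L i i p = 1"
    using L assms unfolding line_bundle_def by auto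
  thus nz: "lb_trans L i j p \<noteq> 0" by auto
  have op: "open (lb_dom L i \<inter> lb_dom L j)" using line_bundle_dom(2) assms by auto
  have h: "hol_on A (lb_dom L i \<inter> lb_dom L j) (lb_trans L i j)"
    using L assms unfolding line_bundle_def by blast
  show m: "mero (lb_trans L i j) p" and lim: "(lb_trans L i j \<longlongrightarrow> lb_trans L i j p) (at p)"
    using hol_on_mero_isCont[OF h op] assms by auto
  show ev: "ev_nz (lb_trans L i j) p"
    unfolding ev_nz_def using tendsto_imp_eventually_ne[OF lim nz] .
  have "\<not> ord (lb_trans L i j) p < 0"
    using ord_neg_imp_at_infinity[OF m ev] lim not_tendsto_and_filterlim_at_infinity[of "at p"] by auto
  moreover have "\<not> ord (lb_trans L i j) p > 0"
    using ord_pos_iff_tendsto[OF m ev] lim nz tendsto_unique[of "at p"] by auto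
  ultimately show "ord (lb_trans L i j) p = 0" by linarith
qed

lemma eventually_in_dom:
  assumes "i \<in> lb_idx L" "p \<in> lb_dom L i"
  shows "eventually (\<lambda>x. x \<in> lb_dom L i) (at p)"
  using line_bundle_dom(2) assms by (intro eventually_at_in_open') auto

lemma mer_section_mero:
  assumes "s \<in> mer_sections A L" "i \<in> lb_idx L" "p \<in> lb_dom L i"
  shows "mero (s i) p"
  using assms mer_on_imp_mero unfolding mer_sections_def by blast

lemma mer_section_trans:
  assumes "s \<in> mer_sections A L" "i \<in> lb_idx L" "j \<in> lb_idx L" "p \<in> lb_dom L i" "p \<in> lb_dom L j"
  shows "s i p = lb_trans L i j p * s j p"
  using assms unfolding mer_sections_def bundle_section_def by blast

text \<open>\<open>section_order\<close> uses an arbitrarily chosen trivialization; transition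
  functions have order 0, so any other one gives the same number.\<close>

lemma section_order_eq:
  assumes s: "s \<in> mer_sections A L" and i: "i \<in> lb_idx L" "p \<in> lb_dom L i"
  shows "section_order A L s p = ord (s i) p"
proof -
  define j where "j = (SOME i. i \<in> lb_idx L \<and> p \<in> lb_dom L i)"
  have j: "j \<in> lb_idx L" "p \<in> lb_dom L j"
    using someI[of "\<lambda>i. i \<in> lb_idx L \<and> p \<in> lb_dom L i" i] i unfolding j_def by auto
  note t = line_bundle_trans[OF i(1) j(1) i(2) j(2)]
  have ev: "eventually (\<lambda>x. s i x = lb_trans L i j x * s j x) (at p)"
    using eventually_in_dom[OF i] eventually_in_dom[OF j]
    by eventually_elim (use mer_section_trans[OF s i(1) j(1)] in auto)
  have "ord (s i) p = ord (s j) p"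
  proof (cases "ev_nz (s j) p")
    case True
    have "ord (s i) p = ord (\<lambda>x. lb_trans L i j x * s j x) p" by (rule ord_cong[OF ev])
    also have "\<dots> = ord (s j) p" using ord_mult[OF t(2,4) mer_section_mero[OF s j] True] t by simp
    finally show ?thesis .
  next
    \<comment> \<open>The order of a vanishing germ is unspecified, but here \<open>s i\<close> and
      \<open>s j\<close> have the same germ, so their orders still agree.\<close>
    case False
    hence z: "eventually (\<lambda>x. s j x = 0) (at p)"
      using mero_eventually_zero_or_nonzero mer_section_mero[OF s j] by blast
    have "eventually (\<lambda>x. s i x = s j x) (at p)" using ev z by eventually_elim simp
    thus ?thesis by (rule ord_cong)
  qed
  thus ?thesis by (simp add: section_order_def j_def)
qed

lemma mer_section_ev_nz:
  assumes s: "s \<in> mer_sections A L" "s \<noteq> 0" and i: "i \<in> lb_idx L" "p \<in> lb_dom L i"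
  shows "ev_nz (s i) p"
proof (rule ccontr)
  \<comment> \<open>Vanishing in all trivializations at once is a predicate on points, so
    connectedness can be applied to the section as a whole instead of to one component.\<close>
  define B where "B = (\<lambda>x. \<forall>i\<in>lb_idx L. x \<in> lb_dom L i \<longrightarrow> s i x = 0)"
  have B: "B x \<longleftrightarrow> s i x = 0" if "i \<in> lb_idx L" "x \<in> lb_dom L i" for i x
    unfolding B_def using mer_section_trans[OF s(1)] that by (metis mult_zero_right)
  have Bev: "eventually (\<lambda>x. B x = (s i x = 0)) (at p)" if "i \<in> lb_idx L" "p \<in> lb_dom L i" for i p
    using eventually_in_dom[OF that] by eventually_elim (rule B[OF that(1)])
  assume "\<not> ev_nz (s i) p"
  hence "eventually (\<lambda>x. s i x = 0) (at p)"
    using mero_eventually_zero_or_nonzero mer_section_mero[OF s(1) i] by blast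
  hence "eventually B (at p)" using Bev[OF i] by eventually_elim simp
  moreover have "eventually B (at q) \<or> eventually (\<lambda>x. \<not> B x) (at q)" for q
  proof -
    obtain j where j: "j \<in> lb_idx L" "q \<in> lb_dom L j" using line_bundle_dom(1) by blast
    have "eventually B (at q) \<longleftrightarrow> eventually (\<lambda>x. s j x = 0) (at q)"
      "eventually (\<lambda>x. \<not> B x) (at q) \<longleftrightarrow> eventually (\<lambda>x. s j x \<noteq> 0) (at q)"
      by (rule eventually_cong[OF Bev[OF j]]; simp)+
    thus ?thesis
      using mero_eventually_zero_or_nonzero[OF mer_section_mero[OF s(1) j]]
      unfolding ev_nz_def by blast
  qed
  ultimately have all: "eventually B (at q)" for q by (rule eventually_propagates[rotated])
  have "s j q = 0" for j q
  proof (cases "j \<in> lb_idx L \<and> q \<in> lb_dom L j")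
    case True
    have "eventually (\<lambda>x. s j x = 0) (at q)"
      using all[of q] Bev[of j q] True by (auto elim: eventually_elim2)
    thus ?thesis using mer_on_eventually_zero[of "lb_dom L j" "s j" q] True s(1)
      by (auto simp: mer_sections_def)
  next
    case False thus ?thesis using s(1) by (auto simp: mer_sections_def bundle_section_def)
  qed
  thus False using s(2) by (auto simp: fun_eq_iff)
qed

text \<open>Makes a genuine section out of components whose cocycle relation holds near each point
  but possibly not at it, as happens for products and derivatives with poles.\<close>

definition normalized_section :: "('i \<Rightarrow> 'a \<Rightarrow> complex) \<Rightarrow> 'i \<Rightarrow> 'a \<Rightarrow> complex" where
  "normalized_section F i p = (if i \<in> lb_idx L \<and> p \<in> lb_dom L i then normalized (F i) p else 0)"

context
  fixes F :: "'i \<Rightarrow> 'a \<Rightarrow> complex"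
  assumes mF: "\<And>i p. i \<in> lb_idx L \<Longrightarrow> p \<in> lb_dom L i \<Longrightarrow> mero (F i) p"
    and tF: "\<And>i j p. i \<in> lb_idx L \<Longrightarrow> j \<in> lb_idx L \<Longrightarrow> p \<in> lb_dom L i \<Longrightarrow> p \<in> lb_dom L j \<Longrightarrow>
       eventually (\<lambda>x. F i x = lb_trans L i j x * F j x) (at p)"
begin

lemma bundle_section_normalized: "bundle_section L (normalized_section F)"
  unfolding bundle_section_def
proof (intro conjI ballI allI impI)
  fix i j p assume i: "i \<in> lb_idx L" "j \<in> lb_idx L" "p \<in> lb_dom L i \<inter> lb_dom L j"
  have lim: "(F k \<longlongrightarrow> lb_trans L k l p * c) (at p)"
    if "k \<in> lb_idx L" "l \<in> lb_idx L" "p \<in> lb_dom L k" "p \<in> lb_dom L l" "(F l \<longlongrightarrow> c) (at p)" for k l c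
    using filterlim_cong[OF refl refl tF[OF that(1-4)]]
      tendsto_mult[OF line_bundle_trans(3)[OF that(1-4)] that(5)] by simp
  have "normalized (F i) p = lb_trans L i j p * normalized (F j) p"
  proof (cases "\<exists>c. (F j \<longlongrightarrow> c) (at p)")
    case True
    then obtain c where c: "(F j \<longlongrightarrow> c) (at p)" by blast
    show ?thesis using lim[of i j] c i by (auto simp: normalized_tendsto)
  next
    case False
    hence "\<not> (\<exists>c. (F i \<longlongrightarrow> c) (at p))" using lim[of j i] i by auto
    thus ?thesis using False by (simp add: normalized_def)
  qed
  thus "normalized_section F i p = lb_trans L i j p * normalized_section F j p"
    using i by (simp add: normalized_section_def)
qed (auto simp: normalized_section_def)

lemma normalized_section_mer: "normalized_section F \<in> mer_sections A L"
  using bundle_section_normalized mF line_bundle_dom(2)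
  by (auto simp: mer_sections_def normalized_section_def intro!: mer_on_normalized[where f = "F i" for i])

lemma normalized_section_hol:
  assumes "\<And>i p. i \<in> lb_idx L \<Longrightarrow> p \<in> lb_dom L i \<Longrightarrow> \<exists>c. (F i \<longlongrightarrow> c) (at p)"
  shows "normalized_section F \<in> hol_sections A L"
  using bundle_section_normalized mF line_bundle_dom(2) assms
  by (auto simp: hol_sections_def normalized_section_def intro!: hol_on_normalized[where f = "F i" for i])

lemma eventually_normalized_section:
  assumes "i \<in> lb_idx L" "p \<in> lb_dom L i"
  shows "eventually (\<lambda>x. normalized_section F i x = F i x) (at p)"
  using eventually_normalized[OF mF[OF assms]] eventually_in_dom[OF assms]
  by eventually_elim (use assms in \<open>auto simp: normalized_section_def\<close>)

end

text \<open>Transition factors cancel in \<open>s i / t i\<close>, so the quotients taken in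
  different trivializations are one function on the surface.\<close>

lemma section_quotient:
  assumes s: "s \<in> mer_sections A L" and t: "t \<in> mer_sections A L" "t \<noteq> 0"
  obtains f where "\<And>p. mero f p"
    "\<And>i p. i \<in> lb_idx L \<Longrightarrow> p \<in> lb_dom L i \<Longrightarrow> eventually (\<lambda>x. s i x = f x * t i x) (at p)"
proof -
  define k where "k x = (SOME i. i \<in> lb_idx L \<and> x \<in> lb_dom L i)" for x
  have k: "k x \<in> lb_idx L" "x \<in> lb_dom L (k x)" for x
    using someI_ex[of "\<lambda>i. i \<in> lb_idx L \<and> x \<in> lb_dom L i"] line_bundle_dom(1)[of x]
    unfolding k_def by auto
  define f where "f x = s (k x) x / t (k x) x" for x
  have f: "f x = s i x / t i x" if "i \<in> lb_idx L" "x \<in> lb_dom L i" for i x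
    using mer_section_trans[OF s that(1) k(1) that(2) k(2)]
      mer_section_trans[OF t(1) that(1) k(1) that(2) k(2)]
      line_bundle_trans(1)[OF that(1) k(1) that(2) k(2)] by (simp add: f_def)
  have ev: "eventually (\<lambda>x. f x = s i x / t i x) (at p)" if "i \<in> lb_idx L" "p \<in> lb_dom L i" for i p
    using eventually_in_dom[OF that] by eventually_elim (rule f[OF that(1)])
  show thesis
  proof (rule that[of f])
    fix p
    show "mero f p"
      using mero_cong[OF ev[OF k]] mero_divide mer_section_mero s t k by blast
  next
    fix i p assume i: "i \<in> lb_idx L" "p \<in> lb_dom L i"
    show "eventually (\<lambda>x. s i x = f x * t i x) (at p)"
      using ev[OF i] mer_section_ev_nz[OF t i] unfolding ev_nz_def by eventually_elim simp
  qed
qed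

end

end

section \<open>Functions of order zero and changes of local parameter\<close>

context riemann_surface
begin

lemma ord_eq_0I:
  assumes "mero f p" "(f \<longlongrightarrow> c) (at p)" "c \<noteq> 0"
  shows "ev_nz f p" "ord f p = 0"
proof -
  show nz: "ev_nz f p" unfolding ev_nz_def using tendsto_imp_eventually_ne[OF assms(2,3)] .
  have "\<not> ord f p < 0"
    using ord_neg_imp_at_infinity[OF assms(1) nz] assms(2) not_tendsto_and_filterlim_at_infinity[of "at p"] by auto
  moreover have "\<not> ord f p > 0"
    using ord_pos_iff_tendsto[OF assms(1) nz] assms tendsto_unique[of "at p"] by auto
  ultimately show "ord f p = 0" by linarith
qed

lemma tendsto_imp_ord_nonneg:
  assumes "mero f p" "ev_nz f p" "(f \<longlongrightarrow> c) (at p)"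
  shows "ord f p \<ge> 0"
  using ord_neg_imp_at_infinity[OF assms(1,2)] assms(3) not_tendsto_and_filterlim_at_infinity[of "at p" f c]
  by fastforce

lemma param_isCont:
  assumes "param \<gamma> p"
  shows "(\<gamma> \<longlongrightarrow> p) (at 0)"
  using param_filtermap[OF assms] by (simp add: filterlim_def at_within_le_nhds)

text \<open>Allows coordinates adapted to a given function without enlarging the atlas.\<close>

lemma param_compose:
  assumes g: "param \<gamma> p" and k: "k analytic_on {0}" "k 0 = 0" "deriv k 0 \<noteq> 0"
  shows "param (\<gamma> \<circ> k) p"
proof -
  obtain U \<phi> where U: "\<gamma> 0 = p" "(U, \<phi>) \<in> A" "p \<in> U" "eventually (\<lambda>w. \<gamma> w \<in> U) (nhds 0)"
    "(\<phi> \<circ> \<gamma>) analytic_on {0}" "deriv (\<phi> \<circ> \<gamma>) 0 \<noteq> 0"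
    using g unfolding param_def by blast
  have kc: "(k \<longlongrightarrow> 0) (nhds 0)"
    using analytic_at_imp_isCont[OF k(1)] tendsto_at_iff_tendsto_nhds[of k 0] k(2)
    unfolding isCont_def by (simp only:)
  show ?thesis unfolding param_def
  proof (intro conjI exI)
    show "(\<gamma> \<circ> k) 0 = p" using U k by simp
    show "(U, \<phi>) \<in> A" "p \<in> U" by fact+
    show "eventually (\<lambda>w. (\<gamma> \<circ> k) w \<in> U) (nhds 0)"
      using kc U(4) by (auto simp: filterlim_iff)
    have "((\<phi> \<circ> \<gamma>) \<circ> k) analytic_on {0}"
      by (rule analytic_on_compose[OF k(1)]) (use U k in auto)
    thus "(\<phi> \<circ> (\<gamma> \<circ> k)) analytic_on {0}" by (simp add: o_assoc)
    have "deriv ((\<phi> \<circ> \<gamma>) \<circ> k) 0 = deriv (\<phi> \<circ> \<gamma>) (k 0) * deriv k 0"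
      using U(5) k by (intro deriv_chain) (auto intro: analytic_on_imp_differentiable_at)
    thus "deriv (\<phi> \<circ> (\<gamma> \<circ> k)) 0 \<noteq> 0" using U k by (simp add: o_assoc)
  qed
qed

lemma param_inj:
  assumes "param \<gamma> p"
  obtains V where "open V" "0 \<in> V" "inj_on \<gamma> V"
proof -
  obtain U \<phi> where U: "(\<phi> \<circ> \<gamma>) analytic_on {0}" "deriv (\<phi> \<circ> \<gamma>) 0 \<noteq> 0"
    using assms unfolding param_def by blast
  obtain k V W where "open V" "0 \<in> V" "open W" "(\<phi> \<circ> \<gamma>) 0 \<in> W" "(\<phi> \<circ> \<gamma>) holomorphic_on V"
    "k holomorphic_on W" "(\<phi> \<circ> \<gamma>) ` V = W" "k ` W = V" "\<And>x. x \<in> V \<Longrightarrow> k ((\<phi> \<circ> \<gamma>) x) = x"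
    "\<And>y. y \<in> W \<Longrightarrow> (\<phi> \<circ> \<gamma>) (k y) = y" "\<And>y. y \<in> W \<Longrightarrow> deriv k y \<noteq> 0"
    by (rule analytic_local_inverse[OF U]) (rule that; assumption)
  moreover have "inj_on \<gamma> V"
    by (rule inj_on_inverseI[of _ "\<lambda>y. k (\<phi> y)"]) (use calculation in auto)
  ultimately show thesis using that by blast
qed

end

section \<open>The hyperelliptic involution\<close>

locale hyperelliptic_surface = compact_riemann_surface A
  for A :: "'a::t2_space chart set" +
  fixes J :: "'a \<Rightarrow> 'a" and z :: "'a \<Rightarrow> complex"
  assumes z_mer: "mer_on A UNIV z"
    and z_nonconst: "\<exists>p q. z p \<noteq> z q"
    and z_fibre: "\<And>p q. fibre_mult A z p q = of_bool (q = p) + of_bool (q = J p)"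
begin

lemma z_mero [simp]: "mero z p"
  using mer_on_imp_mero[OF z_mer] by simp

lemma z_diff_mero [simp]: "mero (\<lambda>x. z x - c) p"
  by (intro mero_diff) auto

lemma z_diff_ev_nz [simp]: "ev_nz (\<lambda>x. z x - c) p"
proof (rule ccontr)
  assume "\<not> ev_nz (\<lambda>x. z x - c) p"
  hence "\<not> ev_nz (\<lambda>x. z x - c) q" for q
    using nonzero_everywhere[of "\<lambda>x. z x - c" q p] by auto
  hence "eventually (\<lambda>x. z x - c = 0) (at q)" for q
    using mero_eventually_zero_or_nonzero[OF z_diff_mero] by blast
  hence lim: "(z \<longlongrightarrow> c) (at q)" for q
    by (intro tendsto_eventually) (simp add: eq_iff_diff_eq_0[symmetric])
  have "z q = c" for q
    using mer_on_nice[OF z_mer, of q] lim[of q] not_tendsto_and_filterlim_at_infinity[of "at q"]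
      tendsto_unique[of "at q"] by auto
  thus False using z_nonconst by auto
qed

lemma z_ev_nz [simp]: "ev_nz z p"
  using z_diff_ev_nz[of 0] by simp

abbreviation pole :: "'a \<Rightarrow> bool" where "pole p \<equiv> ord z p < 0"

lemma pole_z [simp]: "pole p \<Longrightarrow> z p = 0"
  using mer_on_nice[OF z_mer, of p] ord_neg_imp_at_infinity[of z p]
    not_tendsto_and_filterlim_at_infinity[of "at p"] by auto

lemma nonpole_tendsto: "\<not> pole p \<Longrightarrow> (z \<longlongrightarrow> z p) (at p)"
  using mer_on_nice[OF z_mer, of p] ord_nonneg_imp_tendsto[of z p]
    not_tendsto_and_filterlim_at_infinity[of "at p"] by auto

lemma nonpole_iff_tendsto: "\<not> pole p \<longleftrightarrow> (\<exists>c. (z \<longlongrightarrow> c) (at p))"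
  using nonpole_tendsto tendsto_imp_ord_nonneg[of z p] by fastforce

lemma fibre_pole: "pole p \<Longrightarrow> max 0 (- ord z q) = of_bool (q = p) + of_bool (q = J p)"
  using z_fibre[of p q] by (simp add: fibre_mult_def)

lemma fibre_nonpole:
  "\<not> pole p \<Longrightarrow> max 0 (ord (\<lambda>x. z x - z p) q) = of_bool (q = p) + of_bool (q = J p)"
  using z_fibre[of p q] by (simp add: fibre_mult_def)

lemma z_diff_ord_pos_iff: "ord (\<lambda>x. z x - c) p > 0 \<longleftrightarrow> \<not> pole p \<and> z p = c"
proof -
  have "ord (\<lambda>x. z x - c) p > 0 \<longleftrightarrow> ((\<lambda>x. z x - c) \<longlongrightarrow> 0) (at p)"
    by (intro ord_pos_iff_tendsto) auto
  also have "\<dots> \<longleftrightarrow> (z \<longlongrightarrow> c) (at p)" by (rule LIM_zero_iff)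
  also have "\<dots> \<longleftrightarrow> \<not> pole p \<and> z p = c"
    using nonpole_tendsto nonpole_iff_tendsto tendsto_unique[of "at p"] at_neq_bot by metis
  finally show ?thesis .
qed

lemma pole_J [simp]: "pole (J p) \<longleftrightarrow> pole p" and z_J [simp]: "z (J p) = z p"
proof -
  have "(pole (J p) \<longleftrightarrow> pole p) \<and> z (J p) = z p"
  proof (cases "pole p")
    case True
    have "pole (J p)" using fibre_pole[OF True, of "J p"] by (auto simp: max_def of_bool_def split: if_splits)
    thus ?thesis using True by simp
  next
    case False
    have "ord (\<lambda>x. z x - z p) (J p) > 0"
      using fibre_nonpole[OF False, of "J p"] by (auto simp: max_def of_bool_def split: if_splits)
    thus ?thesis using False unfolding z_diff_ord_pos_iff by simp
  qed
  thus "pole (J p) \<longleftrightarrow> pole p" "z (J p) = z p" by auto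
qed

text \<open>The fibres through \<open>p\<close> and \<open>J p\<close> are the same divisor, so
  \<open>p + J p = J p + J (J p)\<close>; it suffices to compare multiplicities at
  \<open>p\<close>.\<close>

lemma J_J [simp]: "J (J p) = p"
proof -
  have "fibre_mult A z p p = fibre_mult A z (J p) p" by (simp add: fibre_mult_def)
  thus ?thesis unfolding z_fibre by (auto simp: of_bool_def split: if_splits)
qed

lemma J_inj: "J x = J y \<longleftrightarrow> x = y" by (metis J_J)

lemma J_swap: "J x = y \<longleftrightarrow> x = J y" by (metis J_J)

lemma z_fibre_points:
  assumes "\<not> pole x" "\<not> pole y" "z x = z y"
  shows "y = x \<or> y = J x"
proof -
  have "ord (\<lambda>w. z w - z x) y > 0" using assms unfolding z_diff_ord_pos_iff by simp
  thus ?thesis using fibre_nonpole[OF assms(1), of y] by (auto simp: of_bool_def split: if_splits)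
qed

text \<open>A coordinate of the sphere centred at the image of \<open>p\<close>, pulled back by
  \<open>z\<close>. Its order at \<open>p\<close> is the ramification index \<open>ram p\<close>,
  and it is the same function for \<open>p\<close> and \<open>J p\<close>.\<close>

definition local_fun :: "'a \<Rightarrow> 'a \<Rightarrow> complex" where
  "local_fun p x = (if pole p then 1 / z x else z x - z p)"

definition ram :: "'a \<Rightarrow> nat" where "ram p = (if J p = p then 2 else 1)"

lemma local_fun_mero: "mero (local_fun p) q" and local_fun_ev_nz: "ev_nz (local_fun p) q"
proof -
  have *: "mero (\<lambda>x. 1 / z x) q" "ev_nz (\<lambda>x. 1 / z x) q"
    by (intro mero_divide ev_nz_divide; simp)+
  show "mero (local_fun p) q" "ev_nz (local_fun p) q"
    unfolding local_fun_def by (cases "pole p"; simp add: *)+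
qed

lemma ord_z_pole: "pole p \<Longrightarrow> ord z p = - int (ram p)"
  using fibre_pole[of p p] by (auto simp: ram_def eq_commute[of "J p"])

lemma ord_z_nonpole: "\<not> pole p \<Longrightarrow> ord (\<lambda>x. z x - z p) p = int (ram p)"
  using fibre_nonpole[of p p] by (auto simp: ram_def eq_commute[of "J p"] max_def of_bool_def split: if_splits)

lemma ord_local_fun: "ord (local_fun p) p = int (ram p)"
proof (cases "pole p")
  case True
  have "ord (\<lambda>x. 1 / z x) p = ord (\<lambda>_. 1) p - ord z p"
    by (intro ord_divide) auto
  thus ?thesis using ord_z_pole[OF True] True by (simp add: local_fun_def[abs_def])
next
  case False thus ?thesis using ord_z_nonpole by (simp add: local_fun_def[abs_def])
qed

text \<open>The normal form of a branched covering: a \<open>ram p\<close>-th root of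
  \<open>local_fun p\<close> has nonzero derivative, and its local inverse supplies the
  parameter.\<close>

lemma obtain_coordinate:
  obtains \<gamma> where "param \<gamma> p" "eventually (\<lambda>w. local_fun p (\<gamma> w) = w ^ ram p) (nhds 0)"
proof -
  obtain \<gamma> where g: "param \<gamma> p" by (rule obtain_param)
  have g0: "\<gamma> 0 = p" using g by (simp add: param_def)
  let ?G = "local_fun p \<circ> \<gamma>"
  have "(local_fun p \<longlongrightarrow> 0) (at p)"
    using ord_pos_iff_tendsto[OF local_fun_mero local_fun_ev_nz, of p p] ord_local_fun[of p] by (simp add: ram_def split: if_splits)
  hence "?G \<midarrow>0\<rightarrow> ?G 0" using g0 by (simp add: tendsto_param[OF g] local_fun_def)
  moreover have "?G meromorphic_on {0}" using local_fun_mero[of p p] by (simp add: mero_param[OF g])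
  ultimately have an: "?G analytic_on {0}"
    by (intro meromorphic_at_isCont_imp_analytic) (auto simp: isCont_def)
  have nz: "eventually (\<lambda>w. ?G w \<noteq> 0) (at 0)"
    using local_fun_ev_nz[of p p] by (simp add: ev_nz_def eventually_param[OF g])
  have zo: "zorder ?G 0 = int (ram p)"
    using order_at_param[OF g local_fun_mero local_fun_ev_nz, of p] ord_local_fun by simp
  obtain h where h: "h analytic_on {0}" "h 0 = 0" "deriv h 0 \<noteq> 0" "eventually (\<lambda>w. ?G w = h w ^ ram p) (nhds 0)"
  proof (rule analytic_root_coordinate[OF an nz zo])
    show "ram p = 1 \<or> ram p = 2" by (simp add: ram_def)
  qed
  obtain k V W where k: "open V" "0 \<in> V" "open W" "h 0 \<in> W" "h holomorphic_on V" "k holomorphic_on W"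
    "h ` V = W" "k ` W = V" "\<And>x. x \<in> V \<Longrightarrow> k (h x) = x" "\<And>y. y \<in> W \<Longrightarrow> h (k y) = y"
    "\<And>y. y \<in> W \<Longrightarrow> deriv k y \<noteq> 0"
    by (rule analytic_local_inverse[OF h(1,3)]) (rule that; assumption)
  have k0: "k 0 = 0" using k(9)[of 0] k(2) h(2) by simp
  have kan: "k analytic_on {0}" using k h analytic_at by metis
  have kc: "(k \<longlongrightarrow> 0) (nhds 0)"
    using analytic_at_imp_isCont[OF kan] tendsto_at_iff_tendsto_nhds[of k 0] k0
    unfolding isCont_def by (simp only:)
  show thesis
  proof (rule that)
    show "param (\<gamma> \<circ> k) p" by (rule param_compose[OF g kan k0]) (use k h in auto)
    have "eventually (\<lambda>w. ?G (k w) = h (k w) ^ ram p) (nhds 0)"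
      using kc h(4) unfolding filterlim_iff by auto
    moreover have "eventually (\<lambda>w. w \<in> W) (nhds 0)"
      using k h by (intro eventually_nhds_in_open) auto
    ultimately show "eventually (\<lambda>w. local_fun p ((\<gamma> \<circ> k) w) = w ^ ram p) (nhds 0)"
      by eventually_elim (simp add: k(10))
  qed
qed

lemma eventually_nonpole: "eventually (\<lambda>x. \<not> pole x) (at p)"
  using eventually_ord_zero[OF z_mero z_ev_nz, of p] by (rule eventually_mono) auto

text \<open>Extracts the holomorphy of \<open>J\<close> from the invariance of \<open>z\<close>. In
  the parameters of \<open>obtain_coordinate\<close>, \<open>J\<close> is the identity between the
  sheets at \<open>p\<close> and \<open>J p\<close> if these differ, and
  \<open>w \<mapsto> - w\<close> at a fixed point.\<close>

lemma J_param:
  obtains \<gamma> \<gamma>' where "param \<gamma> p" "param \<gamma>' (J p)" "eventually (\<lambda>w. J (\<gamma> w) = \<gamma>' w) (at 0)"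
    "J p = p \<Longrightarrow> \<gamma>' = \<gamma> \<circ> uminus"
proof (cases "J p = p")
  case False
  obtain \<gamma> where g: "param \<gamma> p" "eventually (\<lambda>w. local_fun p (\<gamma> w) = w ^ ram p) (nhds 0)"
    by (rule obtain_coordinate)
  obtain \<gamma>' where g': "param \<gamma>' (J p)" "eventually (\<lambda>w. local_fun (J p) (\<gamma>' w) = w ^ ram (J p)) (nhds 0)"
    by (rule obtain_coordinate)
  \<comment> \<open>Equal values of \<open>z\<close> leave two candidates, the point itself and its
    conjugate; disjoint neighbourhoods exclude the first.\<close>
  obtain S T where ST: "open S" "open T" "p \<in> S" "J p \<in> T" "S \<inter> T = {}"
    using hausdorff[of p "J p"] False by metis
  have S: "eventually (\<lambda>w. \<gamma> w \<in> S) (at 0)"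
    using ST(1,3) param_isCont[OF g(1)] topological_tendstoD by blast
  have T: "eventually (\<lambda>w. \<gamma>' w \<in> T) (at 0)"
    using ST(2,4) param_isCont[OF g'(1)] topological_tendstoD by blast
  have "eventually (\<lambda>w. local_fun p (\<gamma> w) = w ^ ram p) (at 0)" "eventually (\<lambda>w. local_fun (J p) (\<gamma>' w) = w ^ ram (J p)) (at 0)"
    using g(2) g'(2) by (auto simp: eventually_at_filter elim: eventually_mono)
  moreover have "eventually (\<lambda>w. \<not> pole (\<gamma> w)) (at 0)" "eventually (\<lambda>w. \<not> pole (\<gamma>' w)) (at 0)"
    using eventually_nonpole[of p] eventually_nonpole[of "J p"]
    unfolding eventually_param[OF g(1)] eventually_param[OF g'(1)] by auto
  ultimately have "eventually (\<lambda>w. J (\<gamma> w) = \<gamma>' w) (at 0)" using S T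
  proof eventually_elim
    case (elim w)
    have "local_fun p (\<gamma> w) = local_fun (J p) (\<gamma>' w)" using elim(1,2) False
      by (simp add: ram_def J_inj)
    hence "local_fun p (\<gamma> w) = local_fun p (\<gamma>' w)" by (simp add: local_fun_def)
    hence "z (\<gamma> w) = z (\<gamma>' w)" by (auto simp: local_fun_def split: if_splits)
    hence "\<gamma>' w = \<gamma> w \<or> \<gamma>' w = J (\<gamma> w)" using elim z_fibre_points by blast
    thus ?case using elim ST by auto
  qed
  thus thesis using that[OF g(1) g'(1)] False by blast
next
  case True
  obtain \<gamma> where g: "param \<gamma> p" "eventually (\<lambda>w. local_fun p (\<gamma> w) = w ^ ram p) (nhds 0)"
    by (rule obtain_coordinate)
  have g': "param (\<gamma> \<circ> uminus) p"
    by (rule param_compose[OF g(1)]) (auto intro!: analytic_intros simp: deriv_minus)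
  \<comment> \<open>At a fixed point neighbourhoods cannot separate the candidates; instead
    injectivity of \<open>\<gamma>\<close> near 0 gives
    \<open>\<gamma> (- w) \<noteq> \<gamma> w\<close> and leaves only the conjugate.\<close>
  obtain V where V: "open V" "0 \<in> V" "inj_on \<gamma> V" using param_inj[OF g(1)] .
  have m: "eventually (\<lambda>w. P (- w)) (at 0)" if "eventually P (at (0 :: complex))" for P
    using that filtermap_at_minus[of "0::complex"] by (metis eventually_filtermap minus_zero)
  have "eventually (\<lambda>w. local_fun p (\<gamma> w) = w ^ ram p) (at 0)"
    using g(2) by (auto simp: eventually_at_filter elim: eventually_mono)
  moreover from m[OF this] have "eventually (\<lambda>w. local_fun p (\<gamma> (- w)) = (- w) ^ ram p) (at 0)" .
  moreover have np: "eventually (\<lambda>w. \<not> pole (\<gamma> w)) (at 0)"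
    using eventually_nonpole[of p] unfolding eventually_param[OF g(1)] .
  moreover have "eventually (\<lambda>w. \<not> pole (\<gamma> (- w))) (at 0)" using m[OF np] .
  moreover have inV: "eventually (\<lambda>w. w \<in> V) (at 0)" using V by (intro eventually_at_in_open') auto
  moreover have "eventually (\<lambda>w. - w \<in> V) (at 0)" using m[OF inV] .
  moreover have "eventually (\<lambda>w. w \<noteq> 0) (at (0::complex))" by (simp add: eventually_at_filter)
  ultimately have "eventually (\<lambda>w. J (\<gamma> w) = (\<gamma> \<circ> uminus) w) (at 0)"
  proof eventually_elim
    case (elim w)
    have "local_fun p (\<gamma> w) = local_fun p (\<gamma> (- w))" using elim(1,2) True by (simp add: ram_def)
    hence "z (\<gamma> w) = z (\<gamma> (- w))" by (auto simp: local_fun_def split: if_splits)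
    hence "\<gamma> (- w) = \<gamma> w \<or> \<gamma> (- w) = J (\<gamma> w)" using elim z_fibre_points by blast
    moreover have "\<gamma> (- w) \<noteq> \<gamma> w" using inj_onD[OF V(3), of "- w" w] elim by auto
    ultimately show ?case by simp
  qed
  thus thesis using that[of \<gamma> "\<gamma> \<circ> uminus"] g g' True by simp
qed

lemma filtermap_J: "filtermap J (at p) = at (J p)"
proof -
  obtain \<gamma> \<gamma>' where g: "param \<gamma> p" "param \<gamma>' (J p)" "eventually (\<lambda>w. J (\<gamma> w) = \<gamma>' w) (at 0)"
    using J_param .
  have "filtermap J (at p) = filtermap (\<lambda>w. J (\<gamma> w)) (at 0)"
    by (simp add: filtermap_filtermap flip: param_filtermap[OF g(1)])
  also have "\<dots> = filtermap \<gamma>' (at 0)"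
    using g(3) by (auto simp: filter_eq_iff eventually_filtermap elim: eventually_elim2)
  finally show ?thesis using param_filtermap[OF g(2)] by simp
qed

lemma eventually_J: "eventually P (at (J p)) \<longleftrightarrow> eventually (\<lambda>x. P (J x)) (at p)"
  by (simp add: eventually_filtermap flip: filtermap_J)

lemma ev_nz_J: "ev_nz (\<lambda>x. f (J x)) p \<longleftrightarrow> ev_nz f (J p)"
  by (simp add: ev_nz_def eventually_J)

lemma mero_J: "mero f (J p) \<Longrightarrow> mero (\<lambda>x. f (J x)) p"
  and ord_J: "mero f (J p) \<Longrightarrow> ev_nz f (J p) \<Longrightarrow> ord (\<lambda>x. f (J x)) p = ord f (J p)"
proof -
  assume f: "mero f (J p)"
  obtain \<gamma> \<gamma>' where g: "param \<gamma> p" "param \<gamma>' (J p)" "eventually (\<lambda>w. J (\<gamma> w) = \<gamma>' w) (at 0)"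
    using J_param .
  have ev: "eventually (\<lambda>w. ((\<lambda>x. f (J x)) \<circ> \<gamma>) w = (f \<circ> \<gamma>') w) (at 0)"
    using g(3) by eventually_elim simp
  show m: "mero (\<lambda>x. f (J x)) p"
    unfolding mero_param[OF g(1)] using f meromorphic_at_cong[OF ev] unfolding mero_param[OF g(2)] by blast
  assume nz: "ev_nz f (J p)"
  show "ord (\<lambda>x. f (J x)) p = ord f (J p)"
    using order_at_param[OF g(1) m] order_at_param[OF g(2) f nz] nz zorder_cong[OF ev refl]
    by (simp only: ev_nz_J)
qed

text \<open>At a fixed point \<open>J\<close> is \<open>w \<mapsto> - w\<close>, so
  \<open>zorder_parity\<close> reads off the sign: invariant germs have even order there,
  antisymmetric ones odd order.\<close>

lemma J_parity:
  assumes "J p = p" "mero f p" "ev_nz f p" "eventually (\<lambda>x. f (J x) = c * f x) (at p)"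
  shows "c = (-1) powi ord f p"
proof -
  obtain \<gamma> \<gamma>' where g: "param \<gamma> p" "param \<gamma>' (J p)" "eventually (\<lambda>w. J (\<gamma> w) = \<gamma>' w) (at 0)"
    "\<gamma>' = \<gamma> \<circ> uminus"
    using J_param assms(1) by metis
  have "c = (-1) powi zorder (f \<circ> \<gamma>) 0"
  proof (rule zorder_parity)
    show "(f \<circ> \<gamma>) meromorphic_on {0}" using assms(2) mero_param[OF g(1)] by blast
    show "eventually (\<lambda>w. (f \<circ> \<gamma>) w \<noteq> 0) (at 0)"
      using assms(3) by (simp add: ev_nz_def eventually_param[OF g(1)])
    have "eventually (\<lambda>w. f (J (\<gamma> w)) = c * f (\<gamma> w)) (at 0)"
      using assms(4) by (simp add: eventually_param[OF g(1)])
    thus "eventually (\<lambda>w. (f \<circ> \<gamma>) (- w) = c * (f \<circ> \<gamma>) w) (at 0)"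
      using g(3) by eventually_elim (use g(4) in simp)
  qed
  thus ?thesis using order_at_param[OF g(1) assms(2,3)] by simp
qed

lemma ord_z_diff_pole: "pole p \<Longrightarrow> ord (\<lambda>x. z x - c) p = ord z p"
proof -
  assume p: "pole p"
  hence inf: "filterlim z at_infinity (at p)" by (intro ord_neg_imp_at_infinity) auto
  have "((\<lambda>x. 1 - c * inverse (z x)) \<longlongrightarrow> 1 - c * 0) (at p)"
    by (intro tendsto_intros filterlim_compose[OF tendsto_inverse_0 inf])
  moreover have "eventually (\<lambda>x. 1 - c * inverse (z x) = (z x - c) / z x) (at p)"
    using z_ev_nz[of p] unfolding ev_nz_def by eventually_elim (simp add: field_simps)
  ultimately have "((\<lambda>x. (z x - c) / z x) \<longlongrightarrow> 1) (at p)"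
    by (simp add: filterlim_cong)
  hence "ord (\<lambda>x. (z x - c) / z x) p = 0"
    by (intro ord_eq_0I) (auto intro: mero_divide)
  thus ?thesis using ord_divide[of "\<lambda>x. z x - c" p z] by simp
qed

lemma ord_z_diff_nonpole: "\<not> pole p \<Longrightarrow> ord (\<lambda>x. z x - c) p \<ge> 0"
  by (rule tendsto_imp_ord_nonneg[where c = "z p - c"]) (auto intro!: tendsto_intros nonpole_tendsto)

lemma ex_pole: "\<exists>p. pole p"
proof (rule ccontr)
  assume np: "\<nexists>p. pole p"
  fix p
  have "ord (\<lambda>x. z x - z p) p = 0"
    by (rule no_zeros_no_poles) (use np ord_z_diff_nonpole in auto)
  thus False using np ord_z_nonpole[of p] by (auto simp: ram_def split: if_splits)
qed

text \<open>A factor belonging to the fibre over infinity is replaced by 1, so that the divisor is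
  \<open>fib a - fib b\<close> without exception.\<close>

definition fquot :: "'a \<Rightarrow> 'a \<Rightarrow> 'a \<Rightarrow> complex" where
  "fquot a b x = (if pole a then 1 else z x - z a) / (if pole b then 1 else z x - z b)"

lemma fquot_J [simp]: "fquot a b (J x) = fquot a b x" by (simp add: fquot_def)

lemma fquot_mero [simp]: "mero (fquot a b) p" and fquot_ev_nz [simp]: "ev_nz (fquot a b) p"
proof -
  have "fquot a b = (\<lambda>x. (if pole a then (\<lambda>_. 1) else (\<lambda>x. z x - z a)) x / (if pole b then (\<lambda>_. 1) else (\<lambda>x. z x - z b)) x)"
    by (auto simp: fquot_def)
  moreover have "mero (if pole a then (\<lambda>_. 1) else (\<lambda>x. z x - z a)) p"
      "ev_nz (if pole a then (\<lambda>_. 1) else (\<lambda>x. z x - z a)) p" for a by auto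
  ultimately show "mero (fquot a b) p" "ev_nz (fquot a b) p" by (auto intro!: mero_divide ev_nz_divide)
qed

definition fib :: "'a \<Rightarrow> 'a \<Rightarrow> int" where "fib a p = of_bool (p = a) + of_bool (p = J a)"

lemma fib_J [simp]: "fib a (J p) = fib a p"
  by (auto simp: fib_def J_swap)

lemma fib_nonneg [simp]: "fib a p \<ge> 0" by (simp add: fib_def)

lemma ord_fquot: "ord (fquot a b) p = fib a p - fib b p"
proof -
  obtain c\<^sub>0 where o: "pole c\<^sub>0" using ex_pole by blast
  \<comment> \<open>Each factor has as divisor the fibre of \<open>a\<close> minus the fibre over
    infinity, the latter written as the fibre through a pole; it cancels in the quotient.\<close>
  define c where "c a = (if pole a then (\<lambda>_. 1) else (\<lambda>x. z x - z a))" for a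
  have m: "mero (c a) p" "ev_nz (c a) p" for a by (auto simp: c_def)
  have "ord (c a) p = fib a p - fib c\<^sub>0 p" for a
  proof (cases "pole a")
    case True
    thus ?thesis using fibre_pole[OF o, of p] fibre_pole[OF True, of p] by (simp add: c_def fib_def)
  next
    case a: False
    show ?thesis
    proof (cases "pole p")
      case True
      have "p \<noteq> a \<and> p \<noteq> J a" using True a by auto
      thus ?thesis using fibre_pole[OF o, of p] True a
        by (simp add: c_def fib_def ord_z_diff_pole)
    next
      case False
      have "p \<noteq> c\<^sub>0 \<and> p \<noteq> J c\<^sub>0" using False o by auto
      thus ?thesis using fibre_nonpole[OF a, of p] ord_z_diff_nonpole[OF False, of "z a"] a
        by (simp add: c_def fib_def)
    qed
  qed
  moreover have "fquot a b = (\<lambda>x. c a x / c b x)" by (auto simp: fquot_def c_def)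
  hence "ord (fquot a b) p = ord (c a) p - ord (c b) p" using ord_divide[OF m m] by simp
  ultimately show ?thesis by simp
qed

text \<open>
  Such a \<open>D\<close> is a combination of fibres; the fibre through \<open>b\<close> is exempted to absorb the degree.
\<close>

lemma invariant_divisor:
  assumes "finite {p. D p \<noteq> 0}" "\<And>p. D (J p) = D p" "\<And>p. J p = p \<Longrightarrow> even (D p)"
  shows "\<exists>f. (\<forall>p. mero f p \<and> ev_nz f p) \<and> (\<forall>x. f (J x) = f x) \<and>
    (\<forall>p. fib b p = 0 \<longrightarrow> ord f p = D p)"
  using assms
proof (induction "card {p. D p \<noteq> 0}" arbitrary: D rule: less_induct)
  case less
  show ?case
  proof (cases "{p. D p \<noteq> 0} = {}")
    case True
    thus ?thesis by (intro exI[of _ "\<lambda>_. 1"]) auto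
  next
    case False
    then obtain a where a: "D a \<noteq> 0" by auto
    \<comment> \<open>A fixed point counts twice in its fibre, so \<open>D a\<close> must be halved;
      this is where evenness enters.\<close>
    define n where "n = (if J a = a then D a div 2 else D a)"
    have n: "n * fib a a = D a" using less.prems(3)[of a] by (auto simp: n_def fib_def eq_commute[of a])
    define D' where "D' p = D p - n * fib a p" for p
    have D'a: "D' a = 0" using n by (simp add: D'_def)
    have zero: "D' p = 0" if "D p = 0" for p
    proof -
      have "p \<noteq> a" "p \<noteq> J a" using a that less.prems(2)[of a] by auto
      thus ?thesis using that by (simp add: D'_def fib_def)
    qed
    have sub: "{p. D' p \<noteq> 0} \<subset> {p. D p \<noteq> 0}" using a D'a zero by blast
    have "\<exists>f. (\<forall>p. mero f p \<and> ev_nz f p) \<and> (\<forall>x. f (J x) = f x) \<and>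
      (\<forall>p. fib b p = 0 \<longrightarrow> ord f p = D' p)"
    proof (rule less.hyps)
      show "card {p. D' p \<noteq> 0} < card {p. D p \<noteq> 0}"
        using sub less.prems(1) by (rule psubset_card_mono[rotated])
      show "finite {p. D' p \<noteq> 0}" using sub less.prems(1) finite_subset by blast
      show "D' (J p) = D' p" for p by (simp add: D'_def less.prems(2))
      show "even (D' p)" if "J p = p" for p
      proof -
        have "even (fib a p)" using that by (auto simp: fib_def)
        thus ?thesis using less.prems(3)[OF that] by (simp add: D'_def)
      qed
    qed
    then obtain f where f: "\<And>p. mero f p" "\<And>p. ev_nz f p" "\<And>x. f (J x) = f x"
      "\<And>p. fib b p = 0 \<Longrightarrow> ord f p = D' p" by blast
    have "ord (\<lambda>x. f x * fquot a b x powi n) p = D p" if "fib b p = 0" for p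
      using ord_mult[OF f(1,2)[of p] mero_power_int[OF fquot_mero] ev_nz_power_int[OF fquot_ev_nz], of a b n]
        ord_power_int[OF fquot_mero fquot_ev_nz, of a b n p] ord_fquot[of a b p] f(4)[OF that] that
      by (simp add: D'_def)
    thus ?thesis
      by (intro exI[of _ "\<lambda>x. f x * fquot a b x powi n"])
         (use f in \<open>auto intro!: mero_mult ev_nz_mult mero_power_int ev_nz_power_int\<close>)
  qed
qed

end

section \<open>Products of functions and sections, and the differential of \<open>z\<close>\<close>

lemma
  assumes f: "f meromorphic_on {a}" "eventually (\<lambda>w. f w \<noteq> 0) (at a)" "zorder f a \<noteq> 0"
  shows deriv_eventually_nonzero: "eventually (\<lambda>w. deriv f w \<noteq> 0) (at a)"
    and zorder_deriv: "zorder (deriv f) a = zorder f a - 1"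
proof -
  obtain F where F: "(\<lambda>w. f (a + w)) has_laurent_expansion F"
    using f(1) by (auto simp: meromorphic_on_def)
  have nz: "F \<noteq> 0" using has_laurent_expansion_eventually_nonzero_iff[OF F] f(2) by simp
  have n: "zorder f a = fls_subdegree F" using has_laurent_expansion_zorder[OF F nz] .
  have "fls_nth (fls_deriv F) (fls_subdegree F - 1) = of_int (fls_subdegree F) * fls_nth F (fls_subdegree F)"
    by simp
  also have "\<dots> \<noteq> 0" using f(3) n nz by simp
  finally have d: "fls_deriv F \<noteq> 0" by (metis fls_zero_nth)
  have "deriv (\<lambda>w. f (a + w)) = (\<lambda>w. deriv f (a + w))"
  proof
    fix w show "deriv (\<lambda>w. f (a + w)) w = deriv f (a + w)"
      by (simp add: deriv_shift_0[of f "a + w"] deriv_shift_0[of "\<lambda>w. f (a + w)" w] o_def add.assoc)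
  qed
  hence "(\<lambda>w. deriv f (a + w)) has_laurent_expansion fls_deriv F"
    using has_laurent_expansion_deriv[OF F] by simp
  thus "eventually (\<lambda>w. deriv f w \<noteq> 0) (at a)"
    using has_laurent_expansion_eventually_nonzero_iff d by blast
  show "zorder (deriv f) a = zorder f a - 1"
    using f by (intro zorder_deriv_minus_1) (auto simp: meromorphic_at_iff eventually_frequently)
qed

context riemann_surface
begin

text \<open>The product \<open>f s\<close>; normalization supplies the values where zeros and poles
  of the factors meet.\<close>

definition twist :: "('i, 'a) cocycle \<Rightarrow> ('a \<Rightarrow> complex) \<Rightarrow> ('i \<Rightarrow> 'a \<Rightarrow> complex) \<Rightarrow> 'i \<Rightarrow> 'a \<Rightarrow> complex" where
  "twist L f s = normalized_section L (\<lambda>i x. f x * s i x)"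

context
  fixes L :: "('i, 'a) cocycle" and s :: "'i \<Rightarrow> 'a \<Rightarrow> complex" and f :: "'a \<Rightarrow> complex"
  assumes L: "line_bundle A L" and s: "s \<in> mer_sections A L" "s \<noteq> 0"
    and f: "\<And>p. mero f p" "\<And>p. ev_nz f p"
begin

lemma twist_mero: "i \<in> lb_idx L \<Longrightarrow> p \<in> lb_dom L i \<Longrightarrow> mero (\<lambda>x. f x * s i x) p"
  by (intro mero_mult f mer_section_mero[OF L s(1)])

lemma twist_trans:
  assumes "i \<in> lb_idx L" "j \<in> lb_idx L" "p \<in> lb_dom L i" "p \<in> lb_dom L j"
  shows "eventually (\<lambda>x. f x * s i x = lb_trans L i j x * (f x * s j x)) (at p)"
  using eventually_in_dom[OF L assms(1,3)] eventually_in_dom[OF L assms(2,4)]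
  by eventually_elim (use mer_section_trans[OF L s(1) assms(1,2)] in auto)

lemma twist_mer: "twist L f s \<in> mer_sections A L"
  unfolding twist_def by (rule normalized_section_mer[OF L twist_mero twist_trans])

lemma twist_eventually:
  "i \<in> lb_idx L \<Longrightarrow> p \<in> lb_dom L i \<Longrightarrow> eventually (\<lambda>x. twist L f s i x = f x * s i x) (at p)"
  unfolding twist_def by (rule eventually_normalized_section[OF L twist_mero twist_trans])

lemma twist_nonzero: "twist L f s \<noteq> 0"
proof
  assume z: "twist L f s = 0"
  obtain i p where i: "i \<in> lb_idx L" "p \<in> lb_dom L i" using line_bundle_dom(1)[OF L] by blast
  have "eventually (\<lambda>x. f x * s i x = 0) (at p)"
    using twist_eventually[OF i] by (rule eventually_mono) (auto simp: z)
  thus False using ev_nz_not_zero[OF ev_nz_mult[OF f(2) mer_section_ev_nz[OF L s i]]] by simp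
qed

lemma twist_order: "section_order A L (twist L f s) p = ord f p + section_order A L s p"
proof -
  obtain i where i: "i \<in> lb_idx L" "p \<in> lb_dom L i" using line_bundle_dom(1)[OF L] by blast
  have "section_order A L (twist L f s) p = ord (twist L f s i) p"
    by (rule section_order_eq[OF L twist_mer i])
  also have "\<dots> = ord (\<lambda>x. f x * s i x) p" by (rule ord_cong[OF twist_eventually[OF i]])
  also have "\<dots> = ord f p + ord (s i) p"
    by (intro ord_mult f mer_section_mero[OF L s(1) i] mer_section_ev_nz[OF L s i])
  also have "ord (s i) p = section_order A L s p" by (rule section_order_eq[OF L s(1) i, symmetric])
  finally show ?thesis .
qed

lemma twist_hol:
  assumes "\<And>p. ord f p + section_order A L s p \<ge> 0"
  shows "twist L f s \<in> hol_sections A L"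
  unfolding twist_def
proof (rule normalized_section_hol[OF L twist_mero twist_trans])
  fix i p assume i: "i \<in> lb_idx L" "p \<in> lb_dom L i"
  have "ord (\<lambda>x. f x * s i x) p = ord f p + ord (s i) p"
    by (intro ord_mult f mer_section_mero[OF L s(1) i] mer_section_ev_nz[OF L s i])
  hence "ord (\<lambda>x. f x * s i x) p \<ge> 0"
    using assms[of p] section_order_eq[OF L s(1) i] by simp
  thus "\<exists>c. ((\<lambda>x. f x * s i x) \<longlongrightarrow> c) (at p)"
    by (intro ord_nonneg_imp_tendsto ev_nz_mult f mer_section_ev_nz[OF L s i] twist_mero[OF i])
qed

end

text \<open>The chain rule, which serves both the cocycle identity of the canonical bundle and the
  compatibility of the components of \<open>dz\<close>.\<close>

lemma deriv_transition:
  assumes "(U, \<phi>) \<in> A" "(V, \<psi>) \<in> A" "x \<in> U" "x \<in> V"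
    and "(f \<circ> inv_into V \<psi>) analytic_on {\<psi> x}"
  shows "deriv (f \<circ> inv_into U \<phi>) (\<phi> x) =
    deriv (\<psi> \<circ> inv_into U \<phi>) (\<phi> x) * deriv (f \<circ> inv_into V \<psi>) (\<psi> x)"
proof -
  note t = transition[OF assms(1-4)]
  have "deriv (f \<circ> inv_into U \<phi>) (\<phi> x) = deriv ((f \<circ> inv_into V \<psi>) \<circ> (\<psi> \<circ> inv_into U \<phi>)) (\<phi> x)"
    using t(4)[of f] by (rule deriv_cong_ev) simp
  also have "\<dots> = deriv (f \<circ> inv_into V \<psi>) ((\<psi> \<circ> inv_into U \<phi>) (\<phi> x)) * deriv (\<psi> \<circ> inv_into U \<phi>) (\<phi> x)"
    using t(1,3) assms(5) by (intro deriv_chain) (auto intro: analytic_on_imp_differentiable_at)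
  finally show ?thesis using t(3) by simp
qed

lemma line_bundle_canonical: "line_bundle A (canonical_bundle A)"
  unfolding line_bundle_def
proof (intro conjI ballI)
  show "(\<Union>i\<in>lb_idx (canonical_bundle A). lb_dom (canonical_bundle A) i) = UNIV"
    using atlas_cover by (simp add: canonical_bundle_def case_prod_unfold)
  show "open (lb_dom (canonical_bundle A) c)" if "c \<in> lb_idx (canonical_bundle A)" for c
    using that chart_homeo(1)[of "fst c" "snd c"] by (simp add: canonical_bundle_def)
next
  fix c d assume cd: "c \<in> lb_idx (canonical_bundle A)" "d \<in> lb_idx (canonical_bundle A)"
  obtain U \<phi> where c: "c = (U, \<phi>)" by (cases c)
  obtain V \<psi> where d: "d = (V, \<psi>)" by (cases d)
  have UV: "(U, \<phi>) \<in> A" "(V, \<psi>) \<in> A" using cd by (auto simp: c d canonical_bundle_def)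
  show "hol_on A (lb_dom (canonical_bundle A) c \<inter> lb_dom (canonical_bundle A) d)
      (lb_trans (canonical_bundle A) c d)"
    unfolding hol_on_def
  proof (intro ballI, clarify)
    fix W \<eta> assume W: "(W, \<eta>) \<in> A"
    have UVo: "open (\<phi> ` (U \<inter> V))" using open_chart_image[OF UV(1)] chart_homeo(1)[OF UV(2)] by blast
    have 1: "deriv (\<psi> \<circ> inv_into U \<phi>) holomorphic_on \<phi> ` (U \<inter> V)"
      using atlas_compatible[OF UV] UVo by (rule holomorphic_deriv)
    have 2: "(\<phi> \<circ> inv_into W \<eta>) holomorphic_on \<eta> ` (W \<inter> (U \<inter> V))"
      using atlas_compatible[OF W UV(1)] by (rule holomorphic_on_subset) auto
    have "(deriv (\<psi> \<circ> inv_into U \<phi>) \<circ> (\<phi> \<circ> inv_into W \<eta>)) holomorphic_on \<eta> ` (W \<inter> (U \<inter> V))"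
      by (rule holomorphic_on_compose_gen[OF 2 1]) (use chart_homeo(5)[OF W] in auto)
    thus "(lb_trans (canonical_bundle A) c d \<circ> inv_into W \<eta>) holomorphic_on
        \<eta> ` (W \<inter> (lb_dom (canonical_bundle A) c \<inter> lb_dom (canonical_bundle A) d))"
      by (simp add: canonical_bundle_def c d o_def)
  qed
next
  fix c p assume c: "c \<in> lb_idx (canonical_bundle A)" "p \<in> lb_dom (canonical_bundle A) c"
  obtain U \<phi> where cU: "c = (U, \<phi>)" by (cases c)
  have U: "(U, \<phi>) \<in> A" "p \<in> U" using c by (auto simp: cU canonical_bundle_def)
  have "eventually (\<lambda>w. w \<in> \<phi> ` U) (nhds (\<phi> p))"
    using chart_homeo(2)[OF U(1)] U(2) by (intro eventually_nhds_in_open) auto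
  hence "eventually (\<lambda>w. (\<phi> \<circ> inv_into U \<phi>) w = w) (nhds (\<phi> p))"
    by eventually_elim (simp add: f_inv_into_f)
  hence "deriv (\<phi> \<circ> inv_into U \<phi>) (\<phi> p) = deriv (\<lambda>w. w) (\<phi> p)" by (rule deriv_cong_ev) simp
  thus "lb_trans (canonical_bundle A) c c p = 1" by (simp add: canonical_bundle_def cU)
next
  fix c d e p
  assume cde: "c \<in> lb_idx (canonical_bundle A)" "d \<in> lb_idx (canonical_bundle A)" "e \<in> lb_idx (canonical_bundle A)"
    and p: "p \<in> lb_dom (canonical_bundle A) c \<inter> lb_dom (canonical_bundle A) d \<inter> lb_dom (canonical_bundle A) e"
  obtain U \<phi> V \<psi> W \<eta> where c: "c = (U, \<phi>)" "d = (V, \<psi>)" "e = (W, \<eta>)" by (metis surj_pair)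
  have *: "(U, \<phi>) \<in> A" "(V, \<psi>) \<in> A" "(W, \<eta>) \<in> A" "p \<in> U" "p \<in> V" "p \<in> W"
    using cde p by (auto simp: canonical_bundle_def c)
  show "lb_trans (canonical_bundle A) c d p * lb_trans (canonical_bundle A) d e p = lb_trans (canonical_bundle A) c e p"
    using deriv_transition[OF *(1,2,4,5) transition(1)[OF *(2,3,5,6)]]
    by (simp add: canonical_bundle_def c)
qed

lemma eventually_section_order_zero:
  assumes "line_bundle A L" "s \<in> mer_sections A L" "s \<noteq> 0"
  shows "eventually (\<lambda>x. section_order A L s x = 0) (at p)"
proof -
  obtain i where i: "i \<in> lb_idx L" "p \<in> lb_dom L i" using line_bundle_dom(1)[OF assms(1)] by blast
  show ?thesis
    using eventually_ord_zero[OF mer_section_mero[OF assms(1,2) i] mer_section_ev_nz[OF assms i]]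
      eventually_in_dom[OF assms(1) i]
    by eventually_elim (use section_order_eq[OF assms(1,2) i(1)] in auto)
qed

end

lemma (in compact_riemann_surface) finite_section_support:
  assumes "line_bundle A L" "s \<in> mer_sections A L" "s \<noteq> 0"
  shows "finite {p. section_order A L s p \<noteq> 0}"
proof (rule ccontr)
  assume "infinite {p. section_order A L s p \<noteq> 0}"
  then obtain x where x: "x islimpt {p. section_order A L s p \<noteq> 0}"
    using Heine_Borel_imp_Bolzano_Weierstrass[OF compact_surface] by blast
  have "eventually (\<lambda>y. section_order A L s y = 0) (at x)"
    using eventually_section_order_zero[OF assms] by (rule eventually_mono) auto
  thus False using x by (auto simp: islimpt_conv_frequently_at frequently_def)
qed

context hyperelliptic_surface
begin

abbreviation K :: "('a chart, 'a) cocycle" where "K \<equiv> canonical_bundle A"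

lemma K_simps [simp]:
  "lb_idx K = A" "lb_dom K = fst"
  "lb_trans K (U, \<phi>) (V, \<psi>) = (\<lambda>p. deriv (\<psi> \<circ> inv_into U \<phi>) (\<phi> p))"
  by (simp_all add: canonical_bundle_def)

definition dz0 :: "'a chart \<Rightarrow> 'a \<Rightarrow> complex" where
  "dz0 c x = deriv (z \<circ> inv_into (fst c) (snd c)) (snd c x)"

lemma z_chart_analytic:
  assumes "(U, \<phi>) \<in> A" "x \<in> U" "\<not> pole x"
  shows "(z \<circ> inv_into U \<phi>) analytic_on {\<phi> x}"
proof (rule meromorphic_at_isCont_imp_analytic)
  show "(z \<circ> inv_into U \<phi>) meromorphic_on {\<phi> x}" using z_mero assms by (auto simp: mero_def)
  show "isCont (z \<circ> inv_into U \<phi>) (\<phi> x)"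
    using nonpole_tendsto[OF assms(3)] chart_homeo(5)[OF assms(1)] assms(2)
    unfolding filterlim_chart[OF assms(1,2)] isCont_def by simp
qed

lemma
  assumes c: "(U, \<phi>) \<in> A" "p \<in> U"
  shows dz0_mero: "mero (dz0 (U, \<phi>)) p" and dz0_ev_nz: "ev_nz (dz0 (U, \<phi>)) p"
    and dz0_ord: "ord (dz0 (U, \<phi>)) p = (if pole p then - int (ram p) else int (ram p)) - 1"
proof -
  define G where "G = z \<circ> inv_into U \<phi>"
  have ev: "eventually (\<lambda>w. (dz0 (U, \<phi>) \<circ> inv_into U \<phi>) w = deriv G w) (at (\<phi> p))"
  proof -
    have "eventually (\<lambda>w. w \<in> \<phi> ` U) (at (\<phi> p))"
      using chart_homeo(2)[OF c(1)] c by (intro eventually_at_in_open') auto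
    thus ?thesis by eventually_elim (simp add: dz0_def G_def f_inv_into_f)
  qed
  have mG: "G meromorphic_on {\<phi> p}" using z_mero c by (auto simp: G_def mero_def)
  \<comment> \<open>Differentiation lowers an order by one only if that order is nonzero.
    Subtracting the value at a finite point ensures this and leaves the derivative
    unchanged.\<close>
  define k where "k = (if pole p then 0 else z p)"
  define H where "H = (\<lambda>w. G w - k)"
  have H: "H = (\<lambda>x. z x - k) \<circ> inv_into U \<phi>" by (auto simp: H_def G_def)
  have mH: "H meromorphic_on {\<phi> p}" unfolding H_def by (intro meromorphic_intros mG)
  have nzH: "eventually (\<lambda>w. H w \<noteq> 0) (at (\<phi> p))"
    using z_diff_ev_nz[of k p] unfolding ev_nz_def eventually_chart[OF c] H by simp
  have oH: "zorder H (\<phi> p) = (if pole p then - int (ram p) else int (ram p))"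
    using order_at_chart[OF c z_diff_mero z_diff_ev_nz, of k] ord_z_pole[of p] ord_z_nonpole[of p]
    by (auto simp: H k_def split: if_splits)
  have oH0: "zorder H (\<phi> p) \<noteq> 0" unfolding oH by (simp add: ram_def)
  have dH: "deriv H = deriv G"
  proof
    fix w
    have "(H has_field_derivative D) (at w) \<longleftrightarrow> (G has_field_derivative D) (at w)" for D
      using DERIV_diff[OF _ DERIV_const[of k], of G D w] DERIV_add[OF _ DERIV_const[of k], of H D w]
      unfolding H_def by auto
    thus "deriv H w = deriv G w" by (simp add: deriv_def)
  qed
  show m: "mero (dz0 (U, \<phi>)) p"
    by (rule meroI_chart[OF c]) (use meromorphic_at_cong[OF ev] meromorphic_on_deriv[OF mG] in blast)
  show nz: "ev_nz (dz0 (U, \<phi>)) p"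
    unfolding ev_nz_def eventually_chart[OF c]
    using deriv_eventually_nonzero[OF mH nzH oH0] ev unfolding dH
    by eventually_elim simp
  show "ord (dz0 (U, \<phi>)) p = (if pole p then - int (ram p) else int (ram p)) - 1"
    using order_at_chart[OF c m nz] zorder_cong[OF ev refl] zorder_deriv[OF mH nzH oH0] oH dH by simp
qed

definition dz :: "'a chart \<Rightarrow> 'a \<Rightarrow> complex" where "dz = normalized_section K dz0"

lemma dz0_mero': "c \<in> lb_idx K \<Longrightarrow> p \<in> lb_dom K c \<Longrightarrow> mero (dz0 c) p"
  using dz0_mero by (cases c) auto

lemma dz0_trans:
  assumes "c \<in> lb_idx K" "d \<in> lb_idx K" "p \<in> lb_dom K c" "p \<in> lb_dom K d"
  shows "eventually (\<lambda>x. dz0 c x = lb_trans K c d x * dz0 d x) (at p)"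
proof -
  obtain U \<phi> V \<psi> where cd: "c = (U, \<phi>)" "d = (V, \<psi>)" by (metis surj_pair)
  have *: "(U, \<phi>) \<in> A" "(V, \<psi>) \<in> A" "p \<in> U" "p \<in> V" using assms by (auto simp: cd)
  have "eventually (\<lambda>x. x \<in> U) (at p)" "eventually (\<lambda>x. x \<in> V) (at p)"
    using * chart_homeo(1) by (auto intro!: eventually_at_in_open')
  with eventually_nonpole[of p] show ?thesis
  proof eventually_elim
    case (elim x)
    show ?case using deriv_transition[OF *(1,2) elim(2,3) z_chart_analytic[OF *(2) elim(3,1)]]
      by (simp add: cd dz0_def)
  qed
qed

lemma dz_mer: "dz \<in> mer_sections A K"
  unfolding dz_def by (rule normalized_section_mer[OF line_bundle_canonical dz0_mero' dz0_trans])

lemma dz_eventually: "c \<in> A \<Longrightarrow> p \<in> fst c \<Longrightarrow> eventually (\<lambda>x. dz c x = dz0 c x) (at p)"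
  unfolding dz_def using eventually_normalized_section[OF line_bundle_canonical dz0_mero' dz0_trans, of c p] by simp

lemma dz_nonzero: "dz \<noteq> 0"
proof
  assume z: "dz = 0"
  fix p obtain U \<phi> where U: "(U, \<phi>) \<in> A" "p \<in> U" by (rule obtain_chart)
  have "eventually (\<lambda>x. dz0 (U, \<phi>) x = 0) (at p)"
    using dz_eventually[of "(U, \<phi>)" p] U by (auto simp: z elim!: eventually_mono)
  thus False using ev_nz_not_zero[OF dz0_ev_nz[OF U]] by simp
qed

definition ord_dz :: "'a \<Rightarrow> int" where "ord_dz = section_order A K dz"

lemma ord_dz_eq: "ord_dz p = (if pole p then - int (ram p) else int (ram p)) - 1"
proof -
  obtain U \<phi> where U: "(U, \<phi>) \<in> A" "p \<in> U" by (rule obtain_chart)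
  have "ord_dz p = ord (dz (U, \<phi>)) p"
    unfolding ord_dz_def using U by (intro section_order_eq[OF line_bundle_canonical dz_mer]) auto
  also have "\<dots> = ord (dz0 (U, \<phi>)) p"
    by (rule ord_cong, rule dz_eventually) (use U in auto)
  finally show ?thesis using dz0_ord[OF U] by simp
qed

lemma ord_dz_J [simp]: "ord_dz (J p) = ord_dz p" by (auto simp: ord_dz_eq ram_def)

text \<open>With \<open>ram p = 2\<close> the order is 1, or -3 over infinity.\<close>

lemma ord_dz_odd: "J p = p \<Longrightarrow> odd (ord_dz p)" by (simp add: ord_dz_eq ram_def)

end

section \<open>Zeros of the sections with one simple pole\<close>

locale spin_surface = hyperelliptic_surface A J z
  for A :: "'a::t2_space chart set" and J z +
  fixes \<xi> :: "('i, 'a) cocycle" and g :: nat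
  assumes spin: "nonsingular_even_spin_bundle A \<xi>"
    and genus: "has_genus A g"
begin

lemma xi_bundle: "line_bundle A \<xi>"
  using spin by (simp add: nonsingular_even_spin_bundle_def)

lemma hol_xi_zero: "s \<in> hol_sections A \<xi> \<Longrightarrow> s = 0"
proof -
  obtain B where B: "finite B" "card B = 0" "section_space.span B = hol_sections A \<xi>"
    using spin unfolding nonsingular_even_spin_bundle_def has_h0_def by blast
  hence "B = {}" by simp
  thus "s \<in> hol_sections A \<xi> \<Longrightarrow> s = 0" using B(3)[symmetric] by (simp add: section_space.span_empty)
qed

text \<open>\<open>f s\<close> would be a nonzero holomorphic section of
  \<open>\<xi>\<close>.\<close>

lemma no_effective_twist:
  assumes "s \<in> mer_sections A \<xi>" "s \<noteq> 0" "\<And>p. mero f p" "\<And>p. ev_nz f p"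
    "\<And>p. ord f p + section_order A \<xi> s p \<ge> 0"
  shows False
  using twist_hol[OF xi_bundle assms] twist_nonzero[OF xi_bundle assms(1-4)] hol_xi_zero by blast

abbreviation polar :: "'a \<Rightarrow> ('i \<Rightarrow> 'a \<Rightarrow> complex) \<Rightarrow> bool" where
  "polar \<equiv> simple_polar_section A \<xi>"

abbreviation Z :: "'a \<Rightarrow> 'a set" where "Z \<equiv> spin_zeros A \<xi>"

abbreviation dv :: "('i \<Rightarrow> 'a \<Rightarrow> complex) \<Rightarrow> 'a \<Rightarrow> int" where "dv \<equiv> section_order A \<xi>"

lemma polarD:
  assumes "polar Q s"
  shows "s \<in> mer_sections A \<xi>" "s \<noteq> 0" "dv s Q = -1" "\<And>R. R \<noteq> Q \<Longrightarrow> dv s R \<ge> 0"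
  using assms by (auto simp: simple_polar_section_def)

text \<open>The quotient \<open>f\<close> of the two sections has a finite limit \<open>c\<close> at
  \<open>Q\<close>, because both poles are simple. Then \<open>f - c\<close> cancels the pole of
  \<open>s\<close>, so \<open>t - c s\<close> is holomorphic, hence 0, and \<open>t\<close> is a
  multiple of \<open>s\<close>.\<close>

lemma polar_unique:
  assumes s: "polar Q s" and t: "polar Q t"
  shows "dv t = dv s"
proof -
  note s' = polarD[OF s] and t' = polarD[OF t]
  obtain f where f: "\<And>p. mero f p"
    and eq: "\<And>i p. i \<in> lb_idx \<xi> \<Longrightarrow> p \<in> lb_dom \<xi> i \<Longrightarrow> eventually (\<lambda>x. t i x = f x * s i x) (at p)"
    using that by (rule section_quotient[OF xi_bundle t'(1) s'(1,2)])
  have nz: "ev_nz f p" for p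
  proof (rule ccontr)
    assume "\<not> ev_nz f p"
    hence 0: "eventually (\<lambda>x. f x = 0) (at p)" using mero_eventually_zero_or_nonzero[OF f] by blast
    obtain i where i: "i \<in> lb_idx \<xi>" "p \<in> lb_dom \<xi> i" using line_bundle_dom(1)[OF xi_bundle] by blast
    have "eventually (\<lambda>x. t i x = 0) (at p)" using eq[OF i] 0 by eventually_elim simp
    thus False using ev_nz_not_zero[OF mer_section_ev_nz[OF xi_bundle t'(1,2) i]] by simp
  qed
  have of: "dv t p = ord f p + dv s p" for p
  proof -
    obtain i where i: "i \<in> lb_idx \<xi>" "p \<in> lb_dom \<xi> i" using line_bundle_dom(1)[OF xi_bundle] by blast
    have "dv t p = ord (t i) p" by (rule section_order_eq[OF xi_bundle t'(1) i])
    also have "\<dots> = ord (\<lambda>x. f x * s i x) p" by (rule ord_cong[OF eq[OF i]])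
    also have "\<dots> = ord f p + ord (s i) p"
      by (intro ord_mult f nz mer_section_mero[OF xi_bundle s'(1) i] mer_section_ev_nz[OF xi_bundle s'(1,2) i])
    finally show ?thesis using section_order_eq[OF xi_bundle s'(1) i] by simp
  qed
  have "ord f Q = 0" using of[of Q] s' t' by simp
  then obtain c where c: "(f \<longlongrightarrow> c) (at Q)" using ord_nonneg_imp_tendsto[OF f nz, of Q] by auto
  define F where "F i x = t i x - c * s i x" for i x
  have mF: "mero (F i) p" if "i \<in> lb_idx \<xi>" "p \<in> lb_dom \<xi> i" for i p
    unfolding F_def using mer_section_mero[OF xi_bundle _ that] s' t' by (intro mero_diff mero_mult) auto
  have tF: "eventually (\<lambda>x. F i x = lb_trans \<xi> i j x * F j x) (at p)"
    if i: "i \<in> lb_idx \<xi>" "j \<in> lb_idx \<xi>" "p \<in> lb_dom \<xi> i" "p \<in> lb_dom \<xi> j" for i j p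
    using eventually_in_dom[OF xi_bundle i(1,3)] eventually_in_dom[OF xi_bundle i(2,4)]
  proof eventually_elim
    case (elim x)
    show ?case
      using mer_section_trans[OF xi_bundle s'(1) i(1,2) elim] mer_section_trans[OF xi_bundle t'(1) i(1,2) elim]
      by (simp add: F_def algebra_simps)
  qed
  have lF: "\<exists>l. (F i \<longlongrightarrow> l) (at p)" if i: "i \<in> lb_idx \<xi>" "p \<in> lb_dom \<xi> i" for i p
  proof (cases "p = Q")
    case False
    have "\<exists>l. (u i \<longlongrightarrow> l) (at p)" if "polar Q u" for u
    proof -
      have "ord (u i) p \<ge> 0"
        using polarD[OF that] False section_order_eq[OF xi_bundle polarD(1)[OF that] i] by metis
      thus ?thesis
        using ord_nonneg_imp_tendsto mer_section_mero[OF xi_bundle polarD(1)[OF that] i]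
          mer_section_ev_nz[OF xi_bundle polarD(1,2)[OF that] i] by blast
    qed
    then obtain a b where "(t i \<longlongrightarrow> a) (at p)" "(s i \<longlongrightarrow> b) (at p)" using s t by blast
    hence "(F i \<longlongrightarrow> a - c * b) (at p)" unfolding F_def by (intro tendsto_intros)
    thus ?thesis by blast
  next
    case True
    have ev: "eventually (\<lambda>x. F i x = (f x - c) * s i x) (at p)"
      using eq[OF i] by eventually_elim (simp add: F_def algebra_simps)
    have m: "mero (\<lambda>x. f x - c) p" using f by (intro mero_diff) auto
    show ?thesis
    proof (cases "ev_nz (\<lambda>x. f x - c) p")
      case False
      hence "eventually (\<lambda>x. f x - c = 0) (at p)" using mero_eventually_zero_or_nonzero[OF m] by blast
      with ev have "eventually (\<lambda>x. F i x = 0) (at p)" by eventually_elim simp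
      thus ?thesis using tendsto_eventually by blast
    next
      case n: True
      have "((\<lambda>x. f x - c) \<longlongrightarrow> 0) (at p)" using c True by (simp add: LIM_zero)
      hence 1: "ord (\<lambda>x. f x - c) p > 0" using ord_pos_iff_tendsto[OF m n] by simp
      have ms: "mero (s i) p" "ev_nz (s i) p"
        using mer_section_mero[OF xi_bundle s'(1) i] mer_section_ev_nz[OF xi_bundle s'(1,2) i] by auto
      have "ord (s i) p = -1" using section_order_eq[OF xi_bundle s'(1) i] s'(3) True by simp
      hence "ord (\<lambda>x. (f x - c) * s i x) p \<ge> 0" using ord_mult[OF m n ms] 1 by simp
      hence "\<exists>l. ((\<lambda>x. (f x - c) * s i x) \<longlongrightarrow> l) (at p)"
        by (intro ord_nonneg_imp_tendsto mero_mult ev_nz_mult m n ms)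
      thus ?thesis using filterlim_cong[OF refl refl ev] by blast
    qed
  qed
  have "normalized_section \<xi> F \<in> hol_sections A \<xi>"
    by (rule normalized_section_hol[OF xi_bundle mF tF lF])
  hence 0: "normalized_section \<xi> F = 0" by (rule hol_xi_zero)
  have F0: "eventually (\<lambda>x. t i x = c * s i x) (at p)" if i: "i \<in> lb_idx \<xi>" "p \<in> lb_dom \<xi> i" for i p
    using eventually_normalized_section[OF xi_bundle mF tF i] unfolding 0
    by (rule eventually_mono) (auto simp: F_def)
  show ?thesis
  proof
    fix p
    obtain i where i: "i \<in> lb_idx \<xi>" "p \<in> lb_dom \<xi> i" using line_bundle_dom(1)[OF xi_bundle] by blast
    have ms: "mero (s i) p" "ev_nz (s i) p"
      using mer_section_mero[OF xi_bundle s'(1) i] mer_section_ev_nz[OF xi_bundle s'(1,2) i] by auto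
    have c0: "c \<noteq> 0"
    proof
      assume "c = 0"
      hence "eventually (\<lambda>x. t i x = 0) (at p)" using F0[OF i] by simp
      thus False using ev_nz_not_zero[OF mer_section_ev_nz[OF xi_bundle t'(1,2) i]] by simp
    qed
    have "dv t p = ord (t i) p" by (rule section_order_eq[OF xi_bundle t'(1) i])
    also have "\<dots> = ord (\<lambda>x. c * s i x) p" by (rule ord_cong[OF F0[OF i]])
    also have "\<dots> = ord (s i) p" using ord_mult[OF mero_const _ ms, of c] c0 by simp
    finally show "dv t p = dv s p" using section_order_eq[OF xi_bundle s'(1) i] by simp
  qed
qed

lemma Z_polar: "polar Q s \<Longrightarrow> Z Q = {R. dv s R > 0}"
  unfolding spin_zeros_def by (auto dest: polar_unique)

lemma Z_empty: "\<nexists>s. polar Q s \<Longrightarrow> Z Q = {}"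
  unfolding spin_zeros_def by blast

lemma not_in_Z_self: "Q \<notin> Z Q"
  using Z_polar polarD(3) Z_empty by (cases "\<exists>s. polar Q s") fastforce+

text \<open>The order at \<open>R\<close> cannot exceed -1, since otherwise \<open>f s\<close> would
  be holomorphic. The resulting equality at \<open>R\<close> in turn restricts the orders of
  \<open>s\<close>.\<close>

lemma twist_polar:
  assumes "s \<in> mer_sections A \<xi>" "s \<noteq> 0" "\<And>p. mero f p" "\<And>p. ev_nz f p"
    and "ord f R + dv s R \<ge> -1" "\<And>p. p \<noteq> R \<Longrightarrow> ord f p + dv s p \<ge> 0"
  shows "polar R (twist \<xi> f s)" "dv (twist \<xi> f s) p = ord f p + dv s p" "ord f R + dv s R = -1"
proof -
  show o: "dv (twist \<xi> f s) p = ord f p + dv s p" for p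
    by (rule twist_order[OF xi_bundle assms(1-4)])
  show R: "ord f R + dv s R = -1"
  proof (rule ccontr)
    assume "ord f R + dv s R \<noteq> -1"
    hence "ord f p + dv s p \<ge> 0" for p using assms(5) assms(6)[of p] by (cases "p = R") auto
    thus False using no_effective_twist[OF assms(1-4)] by blast
  qed
  show "polar R (twist \<xi> f s)"
    unfolding simple_polar_section_def
    using o R assms(6) twist_mer[OF xi_bundle assms(1-4)] twist_nonzero[OF xi_bundle assms(1-4)] by simp
qed

definition cls :: "'a \<Rightarrow> 'a set" where "cls Q = insert Q (J ` Z Q)"

lemma in_cls_iff: "p \<in> cls Q \<longleftrightarrow> p = Q \<or> J p \<in> Z Q"
  unfolding cls_def by (metis J_J image_iff insert_iff)

text \<open>
  If \<open>s\<close> has its pole at \<open>Q\<close> and vanishes at \<open>R\<close>, then \<open>s (z - z Q) / (z - z R)\<close> has its pole at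
  \<open>J R\<close>.
\<close>

lemma cls_eq:
  assumes "y \<in> cls Q"
  shows "cls y = cls Q"
proof (cases "y = Q")
  case False
  define R where "R = J y"
  have R: "R \<in> Z Q" and y: "y = J R" using assms False by (auto simp: in_cls_iff R_def)
  obtain s where s: "polar Q s" using R Z_empty by blast
  note s' = polarD[OF s]
  have dR: "dv s R > 0" using R Z_polar[OF s] by simp
  have RQ: "R \<noteq> Q" using R not_in_Z_self by blast
  have JR: "J R \<noteq> Q" using False y by simp
  have fb: "fib Q R = 0" "fib Q (J R) = 0" using RQ JR by (auto simp: fib_def J_swap)
  have fQ: "fib Q Q \<ge> 1" by (simp add: fib_def)
  have fR: "fib R p = 0" if "p \<noteq> R" "p \<noteq> J R" for p using that by (simp add: fib_def)
  have 1: "ord (fquot Q R) (J R) + dv s (J R) \<ge> -1"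
    using dR s'(4)[OF JR] fb by (auto simp: ord_fquot fib_def)
  have 2: "ord (fquot Q R) p + dv s p \<ge> 0" if "p \<noteq> J R" for p
  proof (cases "p = R")
    case True thus ?thesis using dR that fb by (auto simp: ord_fquot fib_def)
  next
    case False
    thus ?thesis using s'(3) s'(4)[of p] fR[OF False that] fQ fib_nonneg[of Q p]
      by (cases "p = Q") (auto simp: ord_fquot)
  qed
  note t = twist_polar[OF s'(1,2) fquot_mero fquot_ev_nz 1 2]
  have Zy: "Z (J R) = {p. fib Q p - fib R p + dv s p > 0}"
    using Z_polar[OF t(1)] t(2) by (simp add: ord_fquot)
  have ZQ: "Z Q = {p. dv s p > 0}" by (rule Z_polar[OF s])
  have "p \<in> cls (J R) \<longleftrightarrow> p \<in> cls Q" for p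
  proof -
    \<comment> \<open>Off the fibres of \<open>Q\<close> and \<open>R\<close> the factor
      \<open>fquot Q R\<close> changes no order, so only the points of these two fibres need
      attention.\<close>
    consider "p = J R" | "p = Q" | "p = J Q" "p \<noteq> Q" | "p = R" "p \<noteq> J R" | "p \<notin> {J R, Q, J Q, R}"
      by blast
    thus ?thesis
    proof cases
      case 1 thus ?thesis using R by (simp add: in_cls_iff)
    next
      case 2
      have "fib Q (J Q) - fib R (J Q) + dv s (J Q) > 0"
      proof (cases "J Q = Q")
        case True thus ?thesis using RQ JR s'(3) by (auto simp: fib_def)
      next
        case False thus ?thesis using RQ JR s'(4)[OF False] by (auto simp: fib_def J_inj J_swap)
      qed
      thus ?thesis using 2 by (simp add: in_cls_iff Zy)
    next
      case 3
      have "fib Q Q = 1" using 3 by (auto simp: fib_def)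
      moreover have "fib R Q = 0" using RQ JR by (auto simp: fib_def)
      ultimately show ?thesis using 3 s'(3) JR RQ by (simp add: in_cls_iff Zy ZQ J_inj)
    next
      case 4
      \<comment> \<open>The product has order exactly -1 at \<open>J R\<close>, and the fibre of
        \<open>R\<close> already contributes -1 there. So \<open>s\<close> cannot vanish at both
        \<open>R\<close> and a different point \<open>J R\<close>.\<close>
      have "dv s (J R) = 0" using t(3) 4 fb by (auto simp: ord_fquot fib_def)
      thus ?thesis using 4 fb RQ fib_nonneg[of R R]
        by (simp add: in_cls_iff Zy ZQ not_less del: fib_nonneg)
    next
      case 5
      have "J p \<noteq> R" "J p \<noteq> J R" "J p \<noteq> Q" "J p \<noteq> J Q" using 5 by (auto simp: J_swap)
      hence "fib Q (J p) = 0" "fib R (J p) = 0" by (auto simp: fib_def)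
      thus ?thesis using 5 by (simp add: in_cls_iff Zy ZQ)
    qed
  qed
  thus ?thesis using y by blast
qed auto

text \<open>Otherwise \<open>x\<close> would be a zero of the section whose pole is
  \<open>x\<close>.\<close>

lemma conjugates_in_cls:
  assumes "x \<in> cls Q" "J x \<in> cls Q"
  shows "J x = x"
proof (rule ccontr)
  assume "J x \<noteq> x"
  moreover have "J x \<in> cls x" using assms cls_eq by blast
  ultimately have "x \<in> Z x" by (simp add: in_cls_iff)
  thus False using not_in_Z_self by blast
qed

text \<open>The image of \<open>s \<otimes> s\<close> under the isomorphism with the canonical
  bundle; the functions that define it have no zeros, so orders are just doubled.\<close>

lemma square_section:
  assumes s: "s \<in> mer_sections A \<xi>" "s \<noteq> 0"
  obtains \<omega> where "\<omega> \<in> mer_sections A K" "\<omega> \<noteq> 0" "\<And>p. section_order A K \<omega> p = 2 * dv s p"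
proof -
  have "bundle_iso A (tensor_bundle \<xi> \<xi>) K"
    using spin by (simp add: nonsingular_even_spin_bundle_def)
  then obtain h where h: "(\<forall>c\<in>lb_idx K. \<forall>i\<in>lb_idx (tensor_bundle \<xi> \<xi>).
      hol_on A (lb_dom K c \<inter> lb_dom (tensor_bundle \<xi> \<xi>) i) (h c i) \<and>
      (\<forall>p\<in>lb_dom K c \<inter> lb_dom (tensor_bundle \<xi> \<xi>) i. h c i p \<noteq> 0)) \<and>
    (\<forall>c\<in>lb_idx K. \<forall>i\<in>lb_idx (tensor_bundle \<xi> \<xi>). \<forall>i'\<in>lb_idx (tensor_bundle \<xi> \<xi>).
      \<forall>p\<in>lb_dom K c \<inter> lb_dom (tensor_bundle \<xi> \<xi>) i \<inter> lb_dom (tensor_bundle \<xi> \<xi>) i'.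
      h c i p * lb_trans (tensor_bundle \<xi> \<xi>) i i' p = h c i' p) \<and>
    (\<forall>c\<in>lb_idx K. \<forall>d\<in>lb_idx K. \<forall>i\<in>lb_idx (tensor_bundle \<xi> \<xi>).
      \<forall>p\<in>lb_dom K c \<inter> lb_dom K d \<inter> lb_dom (tensor_bundle \<xi> \<xi>) i.
      h c i p = lb_trans K c d p * h d i p)"
    unfolding bundle_iso_def by (elim exE) (rule that)
  note h1 = h[THEN conjunct1, rule_format] and h2 = h[THEN conjunct2, THEN conjunct1, rule_format]
    and h3 = h[THEN conjunct2, THEN conjunct2, rule_format]
  define k where "k x = (SOME i. i \<in> lb_idx \<xi> \<and> x \<in> lb_dom \<xi> i)" for x
  have k: "k x \<in> lb_idx \<xi>" "x \<in> lb_dom \<xi> (k x)" for x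
    using someI_ex[of "\<lambda>i. i \<in> lb_idx \<xi> \<and> x \<in> lb_dom \<xi> i"] line_bundle_dom(1)[OF xi_bundle, of x]
    unfolding k_def by auto
  \<comment> \<open>The index \<open>k x\<close> may jump from point to point; \<open>Feq\<close>
    exchanges it for a fixed index, which is what meromorphy near a point requires.\<close>
  define F where "F c x = h c (k x, k x) x * (s (k x) x * s (k x) x)" for c x
  have Feq: "F c x = h c (i, i) x * (s i x * s i x)"
    if "c \<in> A" "x \<in> fst c" "i \<in> lb_idx \<xi>" "x \<in> lb_dom \<xi> i" for c x i
  proof -
    have "h c (k x, k x) x = h c (i, i) x * (lb_trans \<xi> i (k x) x * lb_trans \<xi> i (k x) x)"
      using h2[of c "(i, i)" "(k x, k x)" x] that k[of x] by (simp add: tensor_bundle_def)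
    thus ?thesis using mer_section_trans[OF xi_bundle s(1) that(3) k(1)[of x] that(4) k(2)]
      by (simp add: F_def)
  qed
  have Fev: "eventually (\<lambda>x. F c x = h c (i, i) x * (s i x * s i x)) (at p)"
    if "c \<in> A" "p \<in> fst c" "i \<in> lb_idx \<xi>" "p \<in> lb_dom \<xi> i" for c p i
  proof -
    have "eventually (\<lambda>x. x \<in> fst c) (at p)"
      using that chart_homeo(1)[of "fst c" "snd c"] by (intro eventually_at_in_open') auto
    with eventually_in_dom[OF xi_bundle that(3,4)] show ?thesis
      by eventually_elim (use Feq that in auto)
  qed
  have hh: "mero (h c (i, i)) p" "ev_nz (h c (i, i)) p" "ord (h c (i, i)) p = 0"
    if c: "c \<in> A" "p \<in> fst c" "i \<in> lb_idx \<xi>" "p \<in> lb_dom \<xi> i" for c p i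
  proof -
    have ho: "hol_on A (fst c \<inter> lb_dom \<xi> i) (h c (i, i))" and n: "h c (i, i) p \<noteq> 0"
      using h1[of c "(i, i)"] c by (auto simp: tensor_bundle_def)
    have op: "open (fst c \<inter> lb_dom \<xi> i)"
      using chart_homeo(1)[of "fst c" "snd c"] c line_bundle_dom(2)[OF xi_bundle] by auto
    have pin: "p \<in> fst c \<inter> lb_dom \<xi> i" using c by simp
    note m = hol_on_mero_isCont[OF ho op pin]
    show "mero (h c (i, i)) p" by (rule m)
    show "ev_nz (h c (i, i)) p" "ord (h c (i, i)) p = 0" using ord_eq_0I[OF m n] by auto
  qed
  have sm: "mero (s i) p" "ev_nz (s i) p" "ord (s i) p = dv s p" if "i \<in> lb_idx \<xi>" "p \<in> lb_dom \<xi> i" for i p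
    using mer_section_mero[OF xi_bundle s(1) that] mer_section_ev_nz[OF xi_bundle s that]
      section_order_eq[OF xi_bundle s(1) that] by auto
  have mF: "mero (F c) p" and nF: "ev_nz (F c) p" and oF: "ord (F c) p = 2 * dv s p" if c: "c \<in> A" "p \<in> fst c" for c p
  proof -
    note i = k[of p]
    note hi = hh[OF c i] and si = sm[OF i]
    note mss = mero_mult[OF si(1,1)] and nss = ev_nz_mult[OF si(2,2)]
    show "mero (F c) p" using mero_cong[OF Fev[OF c i]] mero_mult[OF hi(1) mss] by simp
    show "ev_nz (F c) p" using ev_nz_cong[OF Fev[OF c i]] ev_nz_mult[OF hi(2) nss] by simp
    show "ord (F c) p = 2 * dv s p"
      using ord_cong[OF Fev[OF c i]] ord_mult[OF hi(1,2) mss nss] ord_mult[OF si(1,2) si(1,2)] hi(3) si(3) by simp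
  qed
  have mF': "mero (F c) p" if "c \<in> lb_idx K" "p \<in> lb_dom K c" for c p using mF that by simp
  have tF: "eventually (\<lambda>x. F c x = lb_trans K c d x * F d x) (at p)"
    if c: "c \<in> lb_idx K" "d \<in> lb_idx K" "p \<in> lb_dom K c" "p \<in> lb_dom K d" for c d p
    using eventually_in_dom[OF line_bundle_canonical c(1,3)] eventually_in_dom[OF line_bundle_canonical c(2,4)]
  proof eventually_elim
    case (elim x)
    have "h c (k x, k x) x = lb_trans K c d x * h d (k x, k x) x"
      using h3[of c d "(k x, k x)" x] c elim k[of x] by (simp add: tensor_bundle_def)
    thus ?case by (simp add: F_def)
  qed
  define \<omega> where "\<omega> = normalized_section K F"
  have m: "\<omega> \<in> mer_sections A K" unfolding \<omega>_def
    by (rule normalized_section_mer[OF line_bundle_canonical mF' tF])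
  have ev: "eventually (\<lambda>x. \<omega> c x = F c x) (at p)" if "c \<in> A" "p \<in> fst c" for c p
    unfolding \<omega>_def using eventually_normalized_section[OF line_bundle_canonical mF' tF, of c p] that by simp
  show thesis
  proof (rule that[OF m])
    show "section_order A K \<omega> p = 2 * dv s p" for p
    proof -
      obtain U \<phi> where U: "(U, \<phi>) \<in> A" "p \<in> U" by (rule obtain_chart)
      have "section_order A K \<omega> p = ord (\<omega> (U, \<phi>)) p"
        using U by (intro section_order_eq[OF line_bundle_canonical m]) auto
      also have "\<dots> = ord (F (U, \<phi>)) p" using U by (intro ord_cong ev) auto
      finally show ?thesis using oF[of "(U, \<phi>)" p] U by simp
    qed
    show "\<omega> \<noteq> 0"
    proof
      assume z: "\<omega> = 0"
      fix p obtain U \<phi> where U: "(U, \<phi>) \<in> A" "p \<in> U" by (rule obtain_chart)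
      have "eventually (\<lambda>x. F (U, \<phi>) x = 0) (at p)"
        using ev[of "(U, \<phi>)" p] U by (auto simp: z elim!: eventually_mono)
      thus False using ev_nz_not_zero[OF nF[of "(U, \<phi>)" p]] U by simp
    qed
  qed
qed

lemma square_function:
  assumes s: "s \<in> mer_sections A \<xi>" "s \<noteq> 0"
  obtains f where "\<And>p. mero f p" "\<And>p. ev_nz f p" "\<And>p. ord f p = 2 * dv s p - ord_dz p"
proof -
  obtain \<omega> where w: "\<omega> \<in> mer_sections A K" "\<omega> \<noteq> 0" "\<And>p. section_order A K \<omega> p = 2 * dv s p"
    using that by (rule square_section[OF s])
  obtain f where f: "\<And>p. mero f p"
    and eq: "\<And>c p. c \<in> lb_idx K \<Longrightarrow> p \<in> lb_dom K c \<Longrightarrow> eventually (\<lambda>x. \<omega> c x = f x * dz c x) (at p)"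
    using that by (rule section_quotient[OF line_bundle_canonical w(1) dz_mer dz_nonzero])
  have *: "ev_nz f p \<and> ord f p = 2 * dv s p - ord_dz p" for p
  proof -
    obtain U \<phi> where "(U, \<phi>) \<in> A" "p \<in> U" by (rule obtain_chart)
    hence c: "(U, \<phi>) \<in> lb_idx K" "p \<in> lb_dom K (U, \<phi>)" by auto
    note wn = mer_section_ev_nz[OF line_bundle_canonical w(1,2) c]
    have nz: "ev_nz f p"
    proof (rule ccontr)
      assume "\<not> ev_nz f p"
      hence "eventually (\<lambda>x. f x = 0) (at p)" using mero_eventually_zero_or_nonzero[OF f] by blast
      with eq[OF c] have "eventually (\<lambda>x. \<omega> (U, \<phi>) x = 0) (at p)" by eventually_elim simp
      thus False using ev_nz_not_zero[OF wn] by simp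
    qed
    have "ord (\<omega> (U, \<phi>)) p = ord f p + ord (dz (U, \<phi>)) p"
      using ord_cong[OF eq[OF c]] ord_mult[OF f nz mer_section_mero[OF line_bundle_canonical dz_mer c]
          mer_section_ev_nz[OF line_bundle_canonical dz_mer dz_nonzero c]] by simp
    thus ?thesis using nz w(3)[of p] section_order_eq[OF line_bundle_canonical w(1) c]
        section_order_eq[OF line_bundle_canonical dz_mer c] by (simp add: ord_dz_def)
  qed
  show thesis by (rule that[of f]) (use f * in auto)
qed

end

section \<open>Conjugate sections, the genus bound and the shape of a standard graph\<close>

context spin_surface
begin

text \<open>
  The antisymmetrization \<open>f - f \<circ> J\<close> of \<open>f = s\<^sup>2 / dz\<close> has odd order at the fixed points of \<open>J\<close>,
  exactly like \<open>dz\<close>. Hence it can be multiplied by a function of \<open>z\<close> so that the product \<open>u\<close>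
  satisfies \<open>u dz = s \<cdot> J\<^sup>*s\<close> on the level of divisors. Away from one fibre this is a matter of local
  orders; at the remaining fibre it follows because \<open>u\<^sup>2 / (f \<cdot> f \<circ> J)\<close> is then constant.
\<close>

lemma obtain_norm_root:
  assumes s: "polar Q s"
    and f: "\<And>p. mero f p" "\<And>p. ev_nz f p" "\<And>p. ord f p = 2 * dv s p - ord_dz p"
  obtains u where "\<And>p. mero u p" "\<And>p. ev_nz u p" "\<And>p. ord u p = dv s p + dv s (J p) - ord_dz p"
proof -
  note s' = polarD[OF s]
  define fJ where "fJ = (\<lambda>x. f (J x))"
  have fJ: "mero fJ p" "ev_nz fJ p" "ord fJ p = 2 * dv s (J p) - ord_dz p" for p
    using mero_J[OF f(1)] ev_nz_J[of f p] f ord_J[OF f(1,2), of p] by (auto simp: fJ_def)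
  define v where "v = (\<lambda>x. f x - f (J x))"
  have mv: "mero v p" for p unfolding v_def using f(1) mero_J[OF f(1)] by (rule mero_diff)
  \<comment> \<open>If \<open>f\<close> were \<open>J\<close>-invariant near \<open>Q\<close>, the
    pole of \<open>s\<close> would recur at \<open>J Q\<close>, forcing \<open>J Q = Q\<close>.
    Invariance then makes \<open>ord f Q\<close> even, whereas it is \<open>- 2 - ord_dz Q\<close>
    with \<open>ord_dz Q\<close> odd.\<close>
  have "ev_nz v Q"
  proof (rule ccontr)
    assume "\<not> ev_nz v Q"
    hence "eventually (\<lambda>x. v x = 0) (at Q)" using mero_eventually_zero_or_nonzero[OF mv] by blast
    hence ev: "eventually (\<lambda>x. f (J x) = 1 * f x) (at Q)" by eventually_elim (simp add: v_def)
    hence "ord fJ Q = ord f Q" by (intro ord_cong) (simp add: fJ_def)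
    hence "dv s (J Q) = -1" using fJ(3) f(3) s'(3) by simp
    hence fixQ: "J Q = Q" using s'(4)[of "J Q"] by force
    have "1 = (-1 :: complex) powi ord f Q" by (rule J_parity[OF fixQ f(1,2) ev])
    hence "even (ord f Q)" by (auto simp: power_int_minus_left split: if_splits)
    thus False using ord_dz_odd[OF fixQ] f(3)[of Q] by simp
  qed
  hence nv: "ev_nz v p" for p using nonzero_everywhere[of v Q p] mv by blast
  have vJ: "v (J x) = - 1 * v x" for x by (simp add: v_def)
  have ovJ: "ord v (J p) = ord v p" for p
  proof -
    have "ord v (J p) = ord (\<lambda>x. v (J x)) p" using ord_J[OF mv nv] by simp
    also have "\<dots> = ord (\<lambda>x. - 1 * v x) p" unfolding vJ ..
    also have "\<dots> = ord v p" using ord_mult[OF mero_const _ mv nv, of "-1" p] by simp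
    finally show ?thesis .
  qed
  have vodd: "odd (ord v p)" if "J p = p" for p
  proof -
    have "- 1 = (-1 :: complex) powi ord v p"
      by (rule J_parity[OF that mv nv]) (rule always_eventually, rule allI, rule vJ)
    thus ?thesis by (auto simp: power_int_minus_left split: if_splits)
  qed
  \<comment> \<open>What the divisor of \<open>v\<close> lacks. It is even at fixed points because
    \<open>ord v\<close> and \<open>ord_dz\<close> are both odd there, so
    \<open>invariant_divisor\<close> applies.\<close>
  define D where "D p = dv s p + dv s (J p) - ord_dz p - ord v p" for p
  have "D p = 0" if "ord f p = 0" "ord fJ p = 0" "ord v p = 0" for p
    using f(3)[of p] fJ(3)[of p] that by (simp add: D_def)
  hence "{p. D p \<noteq> 0} \<subseteq> {p. ord f p \<noteq> 0} \<union> {p. ord fJ p \<noteq> 0} \<union> {p. ord v p \<noteq> 0}" by auto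
  hence finD: "finite {p. D p \<noteq> 0}"
    by (rule finite_subset) (intro finite_UnI finite_support_ord f(1,2) fJ(1,2) mv nv)
  have DJ: "D (J p) = D p" for p by (simp add: D_def ovJ)
  have Deven: "even (D p)" if "J p = p" for p
    using vodd[OF that] ord_dz_odd[OF that] that by (simp add: D_def)
  obtain r where r: "\<And>p. mero r p" "\<And>p. ev_nz r p" "\<And>x. r (J x) = r x"
    "\<And>p. fib Q p = 0 \<Longrightarrow> ord r p = D p"
    using invariant_divisor[OF finD DJ Deven, of Q] by blast
  define u where "u = (\<lambda>x. v x * r x)"
  have u: "mero u p" "ev_nz u p" "ord u p = ord v p + ord r p" for p
    unfolding u_def by (intro mero_mult ev_nz_mult ord_mult mv nv r)+
  define G where "G = (\<lambda>x. (u x * u x) / (f x * fJ x))"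
  note muu = mero_mult[OF u(1,1)] and nuu = ev_nz_mult[OF u(2,2)]
    and mff = mero_mult[OF f(1) fJ(1)] and nff = ev_nz_mult[OF f(2) fJ(2)]
  have G: "mero G p" "ev_nz G p" for p
    unfolding G_def by (intro mero_divide ev_nz_divide muu nuu mff nff)+
  have oG: "ord G p = 2 * (ord u p - (dv s p + dv s (J p) - ord_dz p))" for p
    unfolding G_def using ord_divide[OF muu nuu mff nff] ord_mult[OF u(1,2) u(1,2)]
      ord_mult[OF f(1,2) fJ(1,2)] f(3) fJ(3) by simp
  have orJ: "ord r (J p) = ord r p" for p using ord_J[OF r(1,2), of p] r(3) by simp
  have oGJ: "ord G (J p) = ord G p" for p by (simp add: oG u(3) ovJ orJ)
  have G0: "ord G p = 0" if "fib Q p = 0" for p using r(4)[OF that] by (simp add: oG u(3) D_def)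
  \<comment> \<open>Zeros and poles of \<open>G\<close> lie on the fibre of \<open>Q\<close>, with
    the same order at its points. So one of \<open>G\<close> and \<open>1 / G\<close> has no poles,
    and therefore no zeros.\<close>
  have GQ: "ord G p = 0 \<or> ord G p = ord G Q" for p
    using G0[of p] oGJ[of Q] by (cases "p = Q"; cases "p = J Q") (simp_all add: fib_def)
  have "ord G p = 0" for p
  proof (cases "ord G Q \<ge> 0")
    case True
    have "ord G p \<ge> 0" for p using GQ[of p] True by auto
    thus ?thesis by (rule no_zeros_no_poles[OF G])
  next
    case False
    define H where "H = (\<lambda>x. 1 / G x)"
    have H: "mero H p" "ev_nz H p" "ord H p = - ord G p" for p
      unfolding H_def using ord_divide[OF mero_const _ G, of 1 p]
      by (auto intro!: mero_divide ev_nz_divide G)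
    have "ord H p \<ge> 0" for p using GQ[of p] False H(3)[of p] by auto
    hence "ord H p = 0" by (rule no_zeros_no_poles[OF H(1,2)])
    thus ?thesis using H(3) by simp
  qed
  hence "ord u p = dv s p + dv s (J p) - ord_dz p" for p using oG[of p] by simp
  thus thesis using that[OF u(1,2)] by blast
qed

text \<open>\<open>u dz\<close> has divisor \<open>div s + J (div s)\<close> and \<open>f dz\<close>
  has divisor \<open>2 div s\<close>, so \<open>(u / f) s\<close> has divisor
  \<open>J (div s)\<close>. The conjugate section is thus found in \<open>\<xi>\<close> itself,
  without comparing \<open>\<xi>\<close> with its pullback under \<open>J\<close>.\<close>

lemma polar_J:
  assumes "polar Q s"
  obtains t where "polar (J Q) t" "\<And>p. dv t p = dv s (J p)"
proof -
  note s' = polarD[OF assms]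
  obtain f where f: "\<And>p. mero f p" "\<And>p. ev_nz f p" "\<And>p. ord f p = 2 * dv s p - ord_dz p"
    using that by (rule square_function[OF s'(1,2)])
  obtain u where u: "\<And>p. mero u p" "\<And>p. ev_nz u p" "\<And>p. ord u p = dv s p + dv s (J p) - ord_dz p"
    using that by (rule obtain_norm_root[OF assms f])
  have w: "mero (\<lambda>x. u x / f x) p" "ev_nz (\<lambda>x. u x / f x) p" "ord (\<lambda>x. u x / f x) p = dv s (J p) - dv s p" for p
    using ord_divide[OF u(1,2) f(1,2)] u(3) f(3) by (auto intro!: mero_divide ev_nz_divide u f)
  have 1: "ord (\<lambda>x. u x / f x) (J Q) + dv s (J Q) \<ge> -1" using s'(3) by (simp add: w(3))
  have 2: "ord (\<lambda>x. u x / f x) p + dv s p \<ge> 0" if "p \<noteq> J Q" for p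
    using s'(4)[of "J p"] that by (auto simp: w(3) J_swap)
  note t = twist_polar[OF s'(1,2) w(1,2) 1 2]
  show thesis by (rule that[OF t(1)]) (use t(2) w(3) in auto)
qed

lemma Z_J: "Z (J Q) = J ` Z Q"
proof (cases "\<exists>s. polar Q s")
  case True
  then obtain s where s: "polar Q s" by blast
  obtain t where t: "polar (J Q) t" "\<And>p. dv t p = dv s (J p)" using that by (rule polar_J[OF s])
  have "{R. dv s (J R) > 0} = J ` {R. dv s R > 0}"
  proof (intro equalityI subsetI)
    fix R assume "R \<in> {R. dv s (J R) > 0}"
    thus "R \<in> J ` {R. dv s R > 0}" by (intro image_eqI[of _ _ "J R"]) simp_all
  qed auto
  thus ?thesis unfolding Z_polar[OF t(1)] Z_polar[OF s] t(2) .
next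
  case False
  have "\<not> (\<exists>s. polar (J Q) s)"
  proof
    assume "\<exists>s. polar (J Q) s"
    then obtain s where s: "polar (J Q) s" by blast
    obtain t where "polar (J (J Q)) t" "\<And>p. dv t p = dv s (J p)" using that by (rule polar_J[OF s])
    thus False using False by simp
  qed
  thus ?thesis using False by (simp add: Z_empty)
qed

text \<open>
  The zeros \<open>A\<close> of the section with pole \<open>Q\<close> give the linearly independent holomorphic differentials
  \<open>u (z - z Q) / (z - z A) dz\<close>.
\<close>

lemma Z_bound: "finite (Z Q) \<and> card (Z Q) \<le> g"
proof (cases "\<exists>s. polar Q s")
  case False
  thus ?thesis by (simp add: Z_empty)
next
  case True
  then obtain s where s: "polar Q s" by blast
  note s' = polarD[OF s]
  have ZQ: "Z Q = {R. dv s R > 0}" by (rule Z_polar[OF s])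
  have "Z Q \<subseteq> {p. dv s p \<noteq> 0}" by (auto simp: ZQ)
  hence fin: "finite (Z Q)"
    using finite_section_support[OF xi_bundle s'(1,2)] finite_subset by blast
  obtain f where f: "\<And>p. mero f p" "\<And>p. ev_nz f p" "\<And>p. ord f p = 2 * dv s p - ord_dz p"
    using that by (rule square_function[OF s'(1,2)])
  obtain u where u: "\<And>p. mero u p" "\<And>p. ev_nz u p" "\<And>p. ord u p = dv s p + dv s (J p) - ord_dz p"
    using that by (rule obtain_norm_root[OF s f])
  define w where "w a = (\<lambda>x. u x * fquot Q a x)" for a
  have w: "mero (w a) p" "ev_nz (w a) p" "ord (w a) p = ord u p + fib Q p - fib a p" for a p
    unfolding w_def using ord_mult[OF u(1,2) fquot_mero fquot_ev_nz, of Q a p]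
    by (auto intro!: mero_mult ev_nz_mult u simp: ord_fquot)
  define E where "E a = twist K (w a) dz" for a
  have Ehol: "E a \<in> hol_sections A K" if "a \<in> Z Q" for a
    unfolding E_def
  proof (rule twist_hol[OF line_bundle_canonical dz_mer dz_nonzero w(1,2)])
    fix p
    \<comment> \<open>Adding this inequality at \<open>p\<close> and at \<open>J p\<close>: the
      fibre of \<open>Q\<close> cancels the poles of \<open>u dz\<close>, and the zeros of
      \<open>s\<close> and of its conjugate at \<open>a\<close> and \<open>J a\<close> absorb the
      denominator.\<close>
    have *: "dv s p \<ge> of_bool (p = a) - of_bool (p = Q)" for p
      using s'(3) s'(4)[of p] that ZQ by (cases "p = Q"; cases "p = a") auto
    show "ord (w a) p + section_order A K dz p \<ge> 0"
      using *[of p] *[of "J p"] by (simp add: w(3) u(3) fib_def J_swap flip: ord_dz_def)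
  qed
  have Eev: "eventually (\<lambda>x. E a c x = w a x * dz c x) (at p)" if "c \<in> A" "p \<in> fst c" for a c p
    unfolding E_def
    using twist_eventually[OF line_bundle_canonical dz_mer dz_nonzero w(1,2), of c p] that by simp
  have dznz: "ev_nz (dz c) p" if "c \<in> A" "p \<in> fst c" for c p
    using mer_section_ev_nz[OF line_bundle_canonical dz_mer dz_nonzero, of c p] that by simp
  have rel: "eventually (\<lambda>x. (\<Sum>a\<in>Z Q. k a * fquot Q a x) = 0) (at p)"
    if k: "(\<Sum>a\<in>Z Q. scale_section (k a) (E a)) = 0" for k p
  proof -
    obtain U \<phi> where U: "(U, \<phi>) \<in> A" "p \<in> U" by (rule obtain_chart)
    have c: "(U, \<phi>) \<in> A" "p \<in> fst (U, \<phi>)" using U by auto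
    have sum0: "(\<Sum>a\<in>Z Q. k a * E a (U, \<phi>) x) = 0" for x
    proof -
      have "(\<Sum>a\<in>Z Q. scale_section (k a) (E a)) (U, \<phi>) x = (\<Sum>a\<in>Z Q. k a * E a (U, \<phi>) x)"
        using fin by (induction rule: finite_induct) (auto simp: scale_section_def)
      thus ?thesis using k by simp
    qed
    have "eventually (\<lambda>x. \<forall>a\<in>Z Q. E a (U, \<phi>) x = w a x * dz (U, \<phi>) x) (at p)"
      using Eev[OF c] fin by (intro eventually_ball_finite) auto
    thus ?thesis using dznz[OF c] u(2)[of p] unfolding ev_nz_def
    proof eventually_elim
      case (elim x)
      have "(\<Sum>a\<in>Z Q. k a * fquot Q a x) * (u x * dz (U, \<phi>) x) = (\<Sum>a\<in>Z Q. k a * E a (U, \<phi>) x)"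
        unfolding sum_distrib_right
        by (intro sum.cong refl) (use elim in \<open>auto simp: w_def mult_ac\<close>)
      hence "(\<Sum>a\<in>Z Q. k a * fquot Q a x) * (u x * dz (U, \<phi>) x) = 0" unfolding sum0 .
      thus ?case using elim by simp
    qed
  qed
  \<comment> \<open>Distinct zeros lie in distinct fibres, so among the quotients only
    \<open>fquot Q a\<close> can have a pole at the zero \<open>a\<close>.\<close>
  have fib_other: "fib b a = 0" if "a \<in> Z Q" "b \<in> Z Q" "a \<noteq> b" for a b
  proof -
    have "a \<noteq> J b"
    proof
      assume ab: "a = J b"
      have "J a \<in> cls Q" "a \<in> cls Q" using that ab by (auto simp: in_cls_iff)
      hence "J a = a" using conjugates_in_cls by blast
      thus False using ab that(3) by simp
    qed
    thus ?thesis using that by (simp add: fib_def)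
  qed
  have indep: "k a = 0" if k: "(\<Sum>a\<in>Z Q. scale_section (k a) (E a)) = 0" and a: "a \<in> Z Q" for k a
  proof -
    \<comment> \<open>With a nonzero coefficient, the relation would express
      \<open>fquot Q a\<close> by functions that are finite at \<open>a\<close>, where it has a
      pole.\<close>
    have main: "k a = 0" if a: "a \<in> Z Q" "a \<noteq> J Q" for a
    proof (rule ccontr)
      assume ka: "k a \<noteq> 0"
      have "a \<noteq> Q" using a not_in_Z_self by blast
      hence fQ: "fib Q a = 0" using a by (simp add: fib_def)
      have "\<exists>l. (fquot Q b \<longlongrightarrow> l) (at a)" if "b \<in> Z Q - {a}" for b
        by (rule ord_nonneg_imp_tendsto) (use fib_other[OF a(1), of b] that fQ in \<open>auto simp: ord_fquot\<close>)
      then obtain l where l: "\<And>b. b \<in> Z Q - {a} \<Longrightarrow> (fquot Q b \<longlongrightarrow> l b) (at a)" by metis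
      have "((\<lambda>x. - (\<Sum>b\<in>Z Q - {a}. k b * fquot Q b x) / k a) \<longlongrightarrow> - (\<Sum>b\<in>Z Q - {a}. k b * l b) / k a) (at a)"
        using l ka by (intro tendsto_intros) auto
      moreover have "eventually (\<lambda>x. - (\<Sum>b\<in>Z Q - {a}. k b * fquot Q b x) / k a = fquot Q a x) (at a)"
        using rel[OF k, of a]
      proof eventually_elim
        case (elim x)
        have "k a * fquot Q a x + (\<Sum>b\<in>Z Q - {a}. k b * fquot Q b x) = 0"
          using elim sum.remove[OF fin a(1), of "\<lambda>b. k b * fquot Q b x"] by simp
        hence "- (\<Sum>b\<in>Z Q - {a}. k b * fquot Q b x) = k a * fquot Q a x" by (simp add: add_eq_0_iff)
        thus ?case using ka by simp
      qed
      ultimately have "(fquot Q a \<longlongrightarrow> - (\<Sum>b\<in>Z Q - {a}. k b * l b) / k a) (at a)"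
        using filterlim_cong[OF refl refl] by fast
      hence "ord (fquot Q a) a \<ge> 0" by (intro tendsto_imp_ord_nonneg) auto
      thus False using fQ by (auto simp: ord_fquot fib_def[of a] of_bool_def split: if_splits)
    qed
    show ?thesis
    \<comment> \<open>For \<open>a = J Q\<close> the two fibres cancel and there is no pole to
      exploit; but all other coefficients are already known to vanish.\<close>
    proof (cases "a = J Q")
      case True
      have "(\<Sum>b\<in>Z Q. k b * fquot Q b x) = k a * fquot Q a x" for x
        using sum.remove[OF fin a, of "\<lambda>b. k b * fquot Q b x"] main True by simp
      hence ev: "eventually (\<lambda>x. k a * fquot Q a x = 0) (at Q)" using rel[OF k, of Q] by simp
      show ?thesis
      proof (rule ccontr)
        assume "k a \<noteq> 0"
        hence "eventually (\<lambda>x. fquot Q a x = 0) (at Q)" using ev by simp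
        thus False using ev_nz_not_zero[OF fquot_ev_nz] by blast
      qed
    qed (use main a in blast)
  qed
  have inj: "inj_on E (Z Q)"
  proof (rule inj_onI, rule ccontr)
    fix a b assume ab: "a \<in> Z Q" "b \<in> Z Q" "E a = E b" "a \<noteq> b"
    define k where "k c = (if c = a then 1 else if c = b then -1 else 0 :: complex)" for c
    have "(\<Sum>c\<in>Z Q. scale_section (k c) (E c)) = (\<Sum>c\<in>{a, b}. scale_section (k c) (E c))"
      using ab fin by (intro sum.mono_neutral_right) (auto simp: k_def scale_section_def fun_eq_iff)
    also have "\<dots> = 0" using ab by (simp add: k_def scale_section_def fun_eq_iff)
    finally show False using indep[of k a] ab by (simp add: k_def)
  qed
  have "section_space.independent (E ` Z Q)"
  proof (rule section_space.independent_if_scalars_zero)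
    show "finite (E ` Z Q)" using fin by simp
    fix k x assume k: "(\<Sum>x\<in>E ` Z Q. scale_section (k x) x) = 0" and x: "x \<in> E ` Z Q"
    have "(\<Sum>a\<in>Z Q. scale_section (k (E a)) (E a)) = 0"
      using k by (simp add: sum.reindex[OF inj])
    thus "k x = 0" using indep[of "\<lambda>a. k (E a)"] x by auto
  qed
  moreover obtain B where B: "finite B" "card B = g" "section_space.span B = hol_sections A K"
    using genus unfolding has_genus_def has_h0_def by blast
  ultimately have "card (E ` Z Q) \<le> g"
    using section_space.independent_span_bound[of B "E ` Z Q"] Ehol by auto
  thus ?thesis using fin by (simp add: card_image[OF inj])
qed

text \<open>Edges lead from the class of \<open>P\<close> to its conjugate and back. Each of the two
  has at most \<open>g + 1\<close> points, so \<open>2 * g + 2\<close> vertices force both to be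
  full and disjoint.\<close>

lemma standard_graph:
  assumes "standard_point Z g P"
  obtains C where "P \<in> C" "finite C" "card C = Suc g" "C \<inter> J ` C = {}" "spin_vertices Z P = C \<union> J ` C"
    "\<And>x. x \<in> C \<Longrightarrow> Z x = J ` (C - {x})" "\<And>x. x \<in> C \<Longrightarrow> Z (J x) = C - {x}"
proof -
  define C where "C = cls P"
  have fin: "finite (cls x)" and le: "card (cls x) \<le> Suc g" for x
  proof -
    show "finite (cls x)" using Z_bound[of x] by (simp add: cls_def)
    have "card (cls x) \<le> Suc (card (J ` Z x))"
      using Z_bound[of x] by (simp add: cls_def card_insert_if)
    also have "card (J ` Z x) \<le> card (Z x)" using Z_bound[of x] by (intro card_image_le) auto
    finally show "card (cls x) \<le> Suc g" using Z_bound[of x] by simp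
  qed
  have injJ: "inj_on J X" for X by (auto simp: inj_on_def J_inj)
  have sub: "spin_vertices Z P \<subseteq> C \<union> J ` C"
  proof
    fix x assume "x \<in> spin_vertices Z P"
    thus "x \<in> C \<union> J ` C"
    proof induction
      case base thus ?case by (simp add: C_def in_cls_iff)
    next
      case (step Q R)
      have *: "J r \<in> C" if "c \<in> C" "r \<in> Z c" for c r
        using that cls_eq[of c P] in_cls_iff[of "J r" c] by (simp add: C_def)
      show ?case
      proof (cases "Q \<in> C")
        case True
        thus ?thesis using *[OF True step.hyps(2)] by (metis J_J UnI2 imageI)
      next
        case False
        then obtain c where c: "c \<in> C" "Q = J c" using step.IH by blast
        then obtain r where "r \<in> Z c" "R = J r" using step.hyps(2) Z_J by auto
        thus ?thesis using * c by blast
      qed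
    qed
  qed
  have finC: "finite C" by (simp add: C_def fin)
  have cardV: "card (spin_vertices Z P) = 2 * Suc g"
    using assms by (simp add: standard_point_def)
  have cJ: "card (J ` C) = card C" by (rule card_image[OF injJ])
  have un: "card (C \<union> J ` C) + card (C \<inter> J ` C) = card C + card (J ` C)"
    using finC by (intro card_Un_Int[symmetric]) auto
  have 1: "card (spin_vertices Z P) \<le> card (C \<union> J ` C)"
    using sub finC by (intro card_mono) auto
  have cC: "card C \<le> Suc g" by (simp add: C_def le)
  have un': "card (C \<union> J ` C) + card (C \<inter> J ` C) = 2 * card C" using un cJ by simp
  have ge: "2 * Suc g \<le> card (C \<union> J ` C)" using 1 cardV by simp
  have C: "card C = Suc g" using un' ge cC by simp
  have disj: "card (C \<inter> J ` C) = 0" using un' ge C by simp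
  have cUn: "card (C \<union> J ` C) = 2 * Suc g" using un' disj C by simp
  have V: "spin_vertices Z P = C \<union> J ` C"
    using sub cardV cUn finC by (intro card_subset_eq) auto
  have Zx: "J ` Z x = C - {x}" if "x \<in> C" for x
  proof -
    have eq: "insert x (J ` Z x) = C" using cls_eq[of x P] that by (simp add: C_def cls_def)
    \<comment> \<open>Otherwise the \<open>g + 1\<close> points of \<open>C\<close> would all be
      conjugates of the at most \<open>g\<close> points of \<open>Z x\<close>.\<close>
    have "x \<notin> J ` Z x"
    proof
      assume "x \<in> J ` Z x"
      hence "J ` Z x = C" using eq by auto
      hence "card C \<le> card (Z x)" using Z_bound[of x] card_image_le[of "Z x" J] by auto
      thus False using C Z_bound[of x] by simp
    qed
    thus ?thesis using eq by auto
  qed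
  show thesis
  proof (rule that[of C])
    show "P \<in> C" by (simp add: C_def in_cls_iff)
    show "C \<inter> J ` C = {}" using disj finC by simp
    show "Z x = J ` (C - {x})" if "x \<in> C" for x
      using Zx[OF that, symmetric] by (simp add: image_image)
    show "Z (J x) = C - {x}" if "x \<in> C" for x using Zx[OF that] Z_J by simp
  qed (use finC C V in auto)
qed

end

section \<open>The group of a standard spin graph\<close>

text \<open>In the edge set, \<open>S\<close> is the other neighbour of \<open>R\<close> and
  \<open>T\<close> the other neighbour of \<open>Q\<close>. This evaluates the description operator
  in \<open>transport\<close>.\<close>

lemma four_cycle_unique:
  assumes "distinct [Q, R, S, T]" "distinct [Q, R, S', T']" "four_cycle Q R S T = four_cycle Q R S' T'"
  shows "S = S' \<and> T = T'"
proof -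
  have "{R, S} \<in> four_cycle Q R S' T'" "{T, Q} \<in> four_cycle Q R S' T'"
    unfolding assms(3)[symmetric] by (simp_all add: four_cycle_def)
  thus ?thesis using assms(1,2) by (auto simp: four_cycle_def doubleton_eq_iff)
qed

lemma transport_four_cycle:
  assumes "distinct [Q, R, S, T]"
  shows "transport J (four_cycle Q R S T) Q R X =
    (if X = T then Q else if X = R then S else if X = J S then J T else J X)"
proof -
  have "(THE (S', T'). distinct [Q, R, S', T'] \<and> four_cycle Q R S T = four_cycle Q R S' T') = (S, T)"
    by (rule the_equality) (use assms four_cycle_unique[OF assms] in auto)
  thus ?thesis unfolding transport_def by simp
qed

lemma four_cycle_edge:
  assumes "distinct [a, b, c, d]" "{Q, R} \<in> four_cycle a b c d"
  obtains S T where "distinct [Q, R, S, T]" "four_cycle a b c d = four_cycle Q R S T"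
proof -
  have cyc: "four_cycle a b c d = four_cycle b c d a" "four_cycle a b c d = four_cycle c d a b"
     "four_cycle a b c d = four_cycle d a b c"
    and rev: "four_cycle a b c d = four_cycle b a d c" "four_cycle a b c d = four_cycle c b a d"
     "four_cycle a b c d = four_cycle d c b a" "four_cycle a b c d = four_cycle a d c b"
    unfolding four_cycle_def by (auto simp: insert_commute)
  consider "Q = a" "R = b" | "Q = b" "R = a" | "Q = b" "R = c" | "Q = c" "R = b"
    | "Q = c" "R = d" | "Q = d" "R = c" | "Q = d" "R = a" | "Q = a" "R = d"
    using assms(2) by (auto simp: four_cycle_def doubleton_eq_iff)
  thus thesis
  proof cases
    case 1 show ?thesis by (rule that[of c d]) (use 1 assms(1) in auto)
  next
    case 2 show ?thesis by (rule that[of d c]) (use 2 assms(1) rev(1) in auto)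
  next
    case 3 show ?thesis by (rule that[of d a]) (use 3 assms(1) cyc(1) in auto)
  next
    case 4 show ?thesis by (rule that[of a d]) (use 4 assms(1) rev(2) in auto)
  next
    case 5 show ?thesis by (rule that[of a b]) (use 5 assms(1) cyc(2) in auto)
  next
    case 6 show ?thesis by (rule that[of b a]) (use 6 assms(1) rev(3) in auto)
  next
    case 7 show ?thesis by (rule that[of b c]) (use 7 assms(1) cyc(3) in auto)
  next
    case 8 show ?thesis by (rule that[of c b]) (use 8 assms(1) rev(4) in auto)
  qed
qed

text \<open>Written with three transpositions to make its sign immediate; for distinct arguments it
  is the cycle \<open>i \<mapsto> j \<mapsto> k \<mapsto> l \<mapsto> i\<close>.\<close>

definition rot :: "'a \<Rightarrow> 'a \<Rightarrow> 'a \<Rightarrow> 'a \<Rightarrow> 'a \<Rightarrow> 'a" where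
  "rot i j k l = Transposition.transpose i j \<circ> Transposition.transpose j k \<circ> Transposition.transpose k l"

lemma rot_apply:
  assumes "distinct [i, j, k, l]"
  shows "rot i j k l x = (if x = i then j else if x = j then k else if x = k then l else if x = l then i else x)"
  using assms by (auto simp: rot_def Transposition.transpose_def)

lemma rot_permutes: "{i, j, k, l} \<subseteq> C \<Longrightarrow> rot i j k l permutes C"
  unfolding rot_def by (intro permutes_compose permutes_swap_id) auto

lemma rot_odd:
  assumes "distinct [i, j, k, l]"
  shows "\<not> evenperm (rot i j k l)"
  using assms unfolding rot_def
  by (simp add: evenperm_comp evenperm_swap permutation_swap_id permutation_compose)

locale standard_spin_graph =
  fixes Z :: "'a \<Rightarrow> 'a set" and J :: "'a \<Rightarrow> 'a" and P :: 'a and C :: "'a set" and g :: nat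
  assumes finite_C: "finite C" and card_C: "card C = Suc g" and g3: "g \<ge> 3"
    and JJ [simp]: "J (J x) = x"
    and disjoint: "C \<inter> J ` C = {}"
    and vertices: "spin_vertices Z P = C \<union> J ` C"
    and Z_C: "x \<in> C \<Longrightarrow> Z x = J ` (C - {x})"
    and Z_JC: "x \<in> C \<Longrightarrow> Z (J x) = C - {x}"
begin

text \<open>
  The graph is \<open>K\<^bsub>g+1,g+1\<^esub>\<close> without a perfect matching. Its vertices are labelled by their
  conjugation classes, which are represented by the points of \<open>C\<close>.
\<close>

abbreviation V :: "'a set" where "V \<equiv> spin_vertices Z P"

definition lab :: "'a \<Rightarrow> 'a" where "lab x = (if x \<in> C then x else J x)"

text \<open>The vertex labelled \<open>c\<close> on the side of the bipartition opposite to
  \<open>Q\<close>; on labels other than \<open>lab Q\<close> this inverts \<open>lab\<close> on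
  \<open>Z Q\<close>.\<close>

definition opp :: "'a \<Rightarrow> 'a \<Rightarrow> 'a" where "opp Q c = (if Q \<in> C then J c else c)"

lemma J_eq_iff [simp]: "J x = J y \<longleftrightarrow> x = y" by (metis JJ)

lemma V_cases: "x \<in> V \<longleftrightarrow> x \<in> C \<or> J x \<in> C"
  unfolding vertices by (metis JJ UnE UnI1 UnI2 imageE imageI)

lemma J_notin_C: "x \<in> C \<Longrightarrow> J x \<notin> C"
  using disjoint by (metis IntI empty_iff imageI)

lemma J_in_V [simp]: "J x \<in> V \<longleftrightarrow> x \<in> V" by (auto simp: V_cases)

lemma J_side: "x \<in> V \<Longrightarrow> J x \<in> C \<longleftrightarrow> x \<notin> C" using J_notin_C by (auto simp: V_cases)

lemma lab_in [simp]: "x \<in> V \<Longrightarrow> lab x \<in> C" by (auto simp: lab_def V_cases)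

lemma lab_J [simp]: "x \<in> V \<Longrightarrow> lab (J x) = lab x"
  using J_side by (auto simp: lab_def)

lemma lab_eqI: "x \<in> V \<Longrightarrow> y \<in> V \<Longrightarrow> (x \<in> C \<longleftrightarrow> y \<in> C) \<Longrightarrow> lab x = lab y \<Longrightarrow> x = y"
  by (auto simp: lab_def split: if_splits)

lemma Z_iff:
  assumes "Q \<in> V"
  shows "y \<in> Z Q \<longleftrightarrow> y \<in> V \<and> (y \<in> C \<longleftrightarrow> Q \<notin> C) \<and> lab y \<noteq> lab Q"
proof (cases "Q \<in> C")
  case True
  have "y \<in> Z Q \<longleftrightarrow> J y \<in> C - {Q}" unfolding Z_C[OF True] by (metis JJ image_iff)
  thus ?thesis using True J_notin_C[of y] J_notin_C[of "J y"] by (auto simp: V_cases lab_def)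
next
  case False
  hence JQ: "J Q \<in> C" using assms by (simp add: V_cases)
  have "y \<in> Z Q \<longleftrightarrow> y \<in> C - {J Q}" using Z_JC[OF JQ] by simp
  thus ?thesis using False JQ by (auto simp: V_cases lab_def)
qed

lemma opp:
  assumes "Q \<in> V" "c \<in> C"
  shows "opp Q c \<in> V" "opp Q c \<in> C \<longleftrightarrow> Q \<notin> C" "lab (opp Q c) = c"
  using assms J_notin_C by (auto simp: opp_def lab_def V_cases)

lemma opp_lab: "Q \<in> V \<Longrightarrow> y \<in> Z Q \<Longrightarrow> opp Q (lab y) = y"
  by (rule lab_eqI) (auto simp: opp Z_iff)

lemma Z_subset_V: "Q \<in> V \<Longrightarrow> y \<in> Z Q \<Longrightarrow> y \<in> V" by (simp add: Z_iff)

lemma edge_iff: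
  assumes "x \<in> V" "y \<in> V"
  shows "{x, y} \<in> spin_edges Z P \<longleftrightarrow> y \<in> Z x"
proof
  assume "{x, y} \<in> spin_edges Z P"
  then obtain Q R where "{x, y} = {Q, R}" "Q \<in> V" "R \<in> Z Q" by (auto simp: spin_edges_def)
  thus "y \<in> Z x" using assms by (auto simp: doubleton_eq_iff Z_iff)
next
  assume "y \<in> Z x"
  thus "{x, y} \<in> spin_edges Z P" using assms(1) unfolding spin_edges_def by blast
qed

lemma edge_V: "{x, y} \<in> spin_edges Z P \<Longrightarrow> x \<in> V \<and> y \<in> V"
  unfolding spin_edges_def using Z_subset_V by (auto simp: doubleton_eq_iff)

definition quad :: "'a \<Rightarrow> 'a \<Rightarrow> 'a \<Rightarrow> 'a \<Rightarrow> bool" where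
  "quad a b c d \<longleftrightarrow> {a, b, c, d} \<subseteq> V \<and> distinct [lab a, lab b, lab c, lab d] \<and>
     (b \<in> C \<longleftrightarrow> a \<notin> C) \<and> (c \<in> C \<longleftrightarrow> a \<in> C) \<and> (d \<in> C \<longleftrightarrow> a \<notin> C)"

lemma quad_distinct: "quad a b c d \<Longrightarrow> distinct [a, b, c, d]"
  by (auto simp: quad_def)

text \<open>Opposite corners lie on the same side, so being distinct they have distinct labels;
  neighbouring corners have distinct labels because conjugate points are never joined.\<close>

lemma quad_iff:
  "distinct [a, b, c, d] \<and> four_cycle a b c d \<subseteq> spin_edges Z P \<longleftrightarrow> quad a b c d"
proof
  assume *: "distinct [a, b, c, d] \<and> four_cycle a b c d \<subseteq> spin_edges Z P"
  hence e: "{a, b} \<in> spin_edges Z P" "{b, c} \<in> spin_edges Z P" "{c, d} \<in> spin_edges Z P" "{d, a} \<in> spin_edges Z P"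
    by (auto simp: four_cycle_def)
  hence V: "a \<in> V" "b \<in> V" "c \<in> V" "d \<in> V" using edge_V by blast+
  have z: "b \<in> Z a" "c \<in> Z b" "d \<in> Z c" "a \<in> Z d" using e V by (simp_all add: edge_iff)
  have "lab a \<noteq> lab c" "lab b \<noteq> lab d"
    using * z V lab_eqI[of a c] lab_eqI[of b d] by (auto simp: Z_iff)
  thus "quad a b c d" using z V by (auto simp: Z_iff quad_def)
next
  assume *: "quad a b c d"
  hence V: "a \<in> V" "b \<in> V" "c \<in> V" "d \<in> V" by (auto simp: quad_def)
  have "b \<in> Z a" "c \<in> Z b" "d \<in> Z c" "a \<in> Z d" using * V by (auto simp: quad_def Z_iff)
  hence "four_cycle a b c d \<subseteq> spin_edges Z P" using V by (auto simp: four_cycle_def edge_iff)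
  thus "distinct [a, b, c, d] \<and> four_cycle a b c d \<subseteq> spin_edges Z P" using quad_distinct[OF *] by blast
qed

lemma quad_nonconj:
  assumes "quad a b c d"
  shows "pairwise (\<lambda>x y. x \<noteq> J y) {a, b, c, d}"
proof (rule pairwiseI)
  fix x y assume xy: "x \<in> {a, b, c, d}" "y \<in> {a, b, c, d}" "x \<noteq> y"
  have "lab x \<noteq> lab y" using assms xy by (auto simp: quad_def)
  moreover have "y \<in> V" using assms xy by (auto simp: quad_def)
  ultimately show "x \<noteq> J y" by auto
qed

lemma quad_face: "quad a b c d \<Longrightarrow> spin_face Z J P (four_cycle a b c d)"
  unfolding spin_face_def using quad_iff[of a b c d] quad_nonconj[of a b c d] by blast

lemma face_edge:
  assumes "spin_face Z J P F" "{Q, R} \<in> F"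
  obtains S T where "quad Q R S T" "F = four_cycle Q R S T"
proof -
  obtain a b c d where F: "distinct [a, b, c, d]" "F = four_cycle a b c d" "F \<subseteq> spin_edges Z P"
    using assms(1) unfolding spin_face_def by blast
  obtain S T where "distinct [Q, R, S, T]" "four_cycle a b c d = four_cycle Q R S T"
    using four_cycle_edge[OF F(1)] assms(2) F(2) by metis
  thus thesis using that[of S T] quad_iff[of Q R S T] F by simp
qed

text \<open>All of \<open>Z Q\<close> lies on one side, so comparing \<open>X\<close> with
  \<open>T\<close>, \<open>R\<close> and \<open>J S\<close> means comparing labels; the remaining
  branch \<open>J X\<close> keeps the label. Since \<open>lab Q\<close> does not occur in
  \<open>Z Q\<close>, \<open>rot\<close> is free to send it to \<open>lab R\<close>, the label
  missing from \<open>Z R\<close>.\<close>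

lemma transport_quad:
  assumes q: "quad Q R S T" and X: "X \<in> Z Q"
  defines "Y \<equiv> transport J (four_cycle Q R S T) Q R X"
  shows "Y \<in> Z R" "lab Y = rot (lab Q) (lab R) (lab S) (lab T) (lab X)"
proof -
  have V: "Q \<in> V" "R \<in> V" "S \<in> V" "T \<in> V" "X \<in> V"
    using q X Z_subset_V by (auto simp: quad_def)
  have d: "distinct [lab Q, lab R, lab S, lab T]" using q by (simp add: quad_def)
  have side: "R \<in> C \<longleftrightarrow> Q \<notin> C" "S \<in> C \<longleftrightarrow> Q \<in> C" "T \<in> C \<longleftrightarrow> Q \<notin> C" "X \<in> C \<longleftrightarrow> Q \<notin> C" "lab X \<noteq> lab Q"
    using q X V by (auto simp: quad_def Z_iff)
  have Y: "Y = (if X = T then Q else if X = R then S else if X = J S then J T else J X)"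
    unfolding Y_def by (rule transport_four_cycle[OF quad_distinct[OF q]])
  have eq: "X = T \<longleftrightarrow> lab X = lab T" "X = R \<longleftrightarrow> lab X = lab R" "X = J S \<longleftrightarrow> lab X = lab S"
    using lab_eqI[of X T] lab_eqI[of X R] lab_eqI[of X "J S"] V side J_side[of S] by auto
  show "lab Y = rot (lab Q) (lab R) (lab S) (lab T) (lab X)"
    unfolding rot_apply[OF d] Y using eq d side(5) V by auto
  show "Y \<in> Z R"
    unfolding Z_iff[OF V(2)] Y using eq d side V J_side[of T] J_side[of X] by auto
qed

text \<open>Spin chains that may be open or empty, so that induction and concatenation are
  possible.\<close>

definition walk :: "'a list \<Rightarrow> 'a set set list \<Rightarrow> bool" where
  "walk vs Fs \<longleftrightarrow> length vs = Suc (length Fs) \<and>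
     (\<forall>i<length Fs. {vs ! i, vs ! Suc i} \<in> spin_edges Z P \<and>
        spin_face Z J P (Fs ! i) \<and> {vs ! i, vs ! Suc i} \<in> Fs ! i)"

lemma walk_Cons:
  "walk (Q # R # vs) (F # Fs) \<longleftrightarrow>
     {Q, R} \<in> spin_edges Z P \<and> spin_face Z J P F \<and> {Q, R} \<in> F \<and> walk (R # vs) Fs"
  unfolding walk_def by (auto simp: less_Suc_eq_0_disj)

lemma spin_chain_walk:
  "spin_chain Z J P Q vs Fs \<longleftrightarrow> Fs \<noteq> [] \<and> hd vs = Q \<and> last vs = Q \<and> walk vs Fs"
  unfolding spin_chain_def walk_def by auto

text \<open>Transports relate different neighbour sets. Permuting all \<open>g + 1\<close> labels,
  with the missing label carried along, puts them into one symmetric group in which they compose;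
  each step contributes an odd cycle and changes the side.\<close>

lemma walk_permutation:
  assumes "walk (Q # vs) Fs" "Q \<in> V"
  shows "\<exists>\<pi>. \<pi> permutes C \<and> (evenperm \<pi> \<longleftrightarrow> even (length Fs)) \<and>
    last (Q # vs) \<in> V \<and> \<pi> (lab Q) = lab (last (Q # vs)) \<and>
    (last (Q # vs) \<in> C \<longleftrightarrow> (Q \<in> C \<longleftrightarrow> even (length Fs))) \<and>
    (\<forall>X\<in>Z Q. chain_map J (Q # vs) Fs X \<in> Z (last (Q # vs)) \<and>
       lab (chain_map J (Q # vs) Fs X) = \<pi> (lab X))"
  using assms
proof (induction Fs arbitrary: Q vs)
  case Nil
  hence "vs = []" by (simp add: walk_def)
  show ?case unfolding \<open>vs = []\<close>
  proof (intro exI[of _ id] conjI ballI)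
    show "id permutes C" by (rule permutes_id)
  qed (use Nil.prems in auto)
next
  case (Cons F Fs)
  obtain R ws where vs: "vs = R # ws" using Cons.prems(1) by (cases vs) (auto simp: walk_def)
  have w: "{Q, R} \<in> spin_edges Z P" "spin_face Z J P F" "{Q, R} \<in> F" "walk (R # ws) Fs"
    using Cons.prems(1) unfolding vs walk_Cons by auto
  obtain S T where q: "quad Q R S T" and F: "F = four_cycle Q R S T"
    by (rule face_edge[OF w(2,3)])
  have V: "R \<in> V" using q by (simp add: quad_def)
  have d: "distinct [lab Q, lab R, lab S, lab T]" using q by (simp add: quad_def)
  obtain \<pi> where \<pi>: "\<pi> permutes C" "evenperm \<pi> \<longleftrightarrow> even (length Fs)"
    "last (R # ws) \<in> V" "\<pi> (lab R) = lab (last (R # ws))"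
    "last (R # ws) \<in> C \<longleftrightarrow> (R \<in> C \<longleftrightarrow> even (length Fs))"
    "\<And>X. X \<in> Z R \<Longrightarrow> chain_map J (R # ws) Fs X \<in> Z (last (R # ws))"
    "\<And>X. X \<in> Z R \<Longrightarrow> lab (chain_map J (R # ws) Fs X) = \<pi> (lab X)"
    using Cons.IH[OF w(4) V] by blast
  let ?r = "rot (lab Q) (lab R) (lab S) (lab T)"
  have r: "?r permutes C" using q by (intro rot_permutes) (auto simp: quad_def)
  have "evenperm (\<pi> \<circ> ?r) \<longleftrightarrow> even (length (F # Fs))"
    using evenperm_comp[of \<pi> ?r] \<pi>(1,2) r rot_odd[OF d] finite_C
    by (auto simp: permutation_permutes)
  moreover have "(\<pi> \<circ> ?r) (lab Q) = lab (last (Q # vs))"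
    using \<pi>(4) by (simp add: vs rot_apply[OF d])
  moreover have "(\<pi> \<circ> ?r) permutes C" using permutes_compose[OF r \<pi>(1)] .
  moreover have "R \<in> C \<longleftrightarrow> Q \<notin> C" using q by (simp add: quad_def)
  hence "last (Q # vs) \<in> C \<longleftrightarrow> (Q \<in> C \<longleftrightarrow> even (length (F # Fs)))" using \<pi>(5) by (auto simp: vs)
  moreover have "chain_map J (Q # vs) (F # Fs) X \<in> Z (last (Q # vs)) \<and>
      lab (chain_map J (Q # vs) (F # Fs) X) = (\<pi> \<circ> ?r) (lab X)" if X: "X \<in> Z Q" for X
    using \<pi>(6,7)[OF transport_quad(1)[OF q X]] transport_quad(2)[OF q X] by (simp add: vs F)
  moreover have "last (Q # vs) \<in> V" using \<pi>(3) by (simp add: vs)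
  ultimately show ?case by blast
qed

lemma walk_append:
  assumes "walk vs Fs" "walk ws Gs" "last vs = hd ws"
  shows "walk (vs @ tl ws) (Fs @ Gs) \<and>
    chain_map J (vs @ tl ws) (Fs @ Gs) = chain_map J ws Gs \<circ> chain_map J vs Fs"
  using assms
proof (induction Fs arbitrary: vs)
  case Nil
  then obtain Q where "vs = [Q]" by (cases vs) (auto simp: walk_def)
  moreover have "ws = hd ws # tl ws" using Nil.prems(2) by (cases ws) (auto simp: walk_def)
  ultimately have "vs @ tl ws = ws" "chain_map J vs [] = id" using Nil.prems(3) by auto
  thus ?case using Nil.prems by simp
next
  case (Cons F Fs)
  obtain Q R us where vs: "vs = Q # R # us"
    using Cons.prems(1) by (cases vs rule: list.exhaust; cases "tl vs") (auto simp: walk_def)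
  have w: "{Q, R} \<in> spin_edges Z P" "spin_face Z J P F" "{Q, R} \<in> F" "walk (R # us) Fs"
    using Cons.prems(1) unfolding vs walk_Cons by auto
  have "walk ((R # us) @ tl ws) (Fs @ Gs) \<and>
    chain_map J ((R # us) @ tl ws) (Fs @ Gs) = chain_map J ws Gs \<circ> chain_map J (R # us) Fs"
    by (rule Cons.IH[OF w(4) Cons.prems(2)]) (use Cons.prems(3) in \<open>simp add: vs\<close>)
  thus ?case using w by (simp add: vs walk_Cons o_assoc)
qed

section \<open>Spin chains at a fixed vertex\<close>

context
  fixes Q assumes Q: "Q \<in> V"
begin

definition D :: "'a set" where "D = C - {lab Q}"

lemma D_facts: "finite D" "card D = g" "D \<subseteq> C"
  using finite_C card_C lab_in[OF Q] by (auto simp: D_def)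

lemma bij_lab: "bij_betw lab (Z Q) D"
  by (rule bij_betw_byWitness[where f' = "opp Q"])
     (use Q opp[OF Q] opp_lab[OF Q] in \<open>auto simp: D_def Z_iff[OF Q]\<close>)

lemma opp_D: "c \<in> D \<Longrightarrow> opp Q c \<in> Z Q" "c \<in> D \<Longrightarrow> lab (opp Q c) = c"
  using opp[OF Q, of c] D_facts(3) by (auto simp: Z_iff[OF Q] D_def)

lemma card_Z: "card (Z Q) = g"
  using bij_betw_same_card[OF bij_lab] D_facts by simp

definition lift :: "('a \<Rightarrow> 'a) \<Rightarrow> 'a \<Rightarrow> 'a" where
  "lift \<pi> = restrict (\<lambda>X. opp Q (\<pi> (lab X))) (Z Q)"

definition realized :: "('a \<Rightarrow> 'a) \<Rightarrow> bool" where
  "realized \<pi> \<longleftrightarrow> \<pi> permutes D \<and> lift \<pi> \<in> spin_perms Z J P Q"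

lemma lab_Z: "X \<in> Z Q \<Longrightarrow> lab X \<in> D"
  using bij_lab by (auto simp: bij_betw_def)

text \<open>A closed walk returns to the label of \<open>Q\<close>, so its permutation of
  \<open>C\<close> fixes \<open>lab Q\<close> and permutes the remaining labels; returning to the
  side of \<open>Q\<close> makes the number of steps even.\<close>

lemma chain_in_lift:
  assumes "spin_chain Z J P Q vs Fs"
  obtains \<pi> where "\<pi> permutes D" "evenperm \<pi>" "restrict (chain_map J vs Fs) (Z Q) = lift \<pi>"
proof -
  have w: "hd vs = Q" "last vs = Q" "walk vs Fs" using assms by (auto simp: spin_chain_walk)
  then obtain us where vs: "vs = Q # us" by (cases vs) (auto simp: walk_def)
  obtain \<pi> where \<pi>: "\<pi> permutes C" "evenperm \<pi> \<longleftrightarrow> even (length Fs)" "\<pi> (lab Q) = lab Q"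
    "Q \<in> C \<longleftrightarrow> (Q \<in> C \<longleftrightarrow> even (length Fs))"
    "\<And>X. X \<in> Z Q \<Longrightarrow> chain_map J vs Fs X \<in> Z Q \<and> lab (chain_map J vs Fs X) = \<pi> (lab X)"
    using walk_permutation[of Q us Fs] w Q unfolding vs by auto
  show thesis
  proof (rule that)
    show "\<pi> permutes D"
      using permutes_superset[OF \<pi>(1), of D] \<pi>(3) by (auto simp: D_def)
    show "evenperm \<pi>" using \<pi>(2,4) by auto
    show "restrict (chain_map J vs Fs) (Z Q) = lift \<pi>"
      unfolding lift_def
    proof (rule restrict_ext)
      fix X assume "X \<in> Z Q"
      thus "chain_map J vs Fs X = opp Q (\<pi> (lab X))" using \<pi>(5)[of X] opp_lab[OF Q] by metis
    qed
  qed
qed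

lemma lift_compose:
  assumes "\<rho> permutes D"
  shows "lift (\<pi> \<circ> \<rho>) = compose (Z Q) (lift \<pi>) (lift \<rho>)"
proof
  fix X
  show "lift (\<pi> \<circ> \<rho>) X = compose (Z Q) (lift \<pi>) (lift \<rho>) X"
  proof (cases "X \<in> Z Q")
    case True
    have "\<rho> (lab X) \<in> D" using permutes_in_image[OF assms] lab_Z[OF True] by simp
    thus ?thesis using True opp_D by (simp add: lift_def compose_def)
  qed (simp add: lift_def compose_def)
qed

text \<open>Concatenation of chains, with the chain of \<open>\<rho>\<close> walked first.\<close>

lemma realized_comp:
  assumes "realized \<pi>" "realized \<rho>"
  shows "realized (\<pi> \<circ> \<rho>)"
proof -
  have p: "\<pi> permutes D" "\<rho> permutes D" using assms by (auto simp: realized_def)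
  obtain vs Fs where 1: "lift \<rho> = restrict (chain_map J vs Fs) (Z Q)" "spin_chain Z J P Q vs Fs"
    using assms(2) by (auto simp: realized_def spin_perms_def)
  obtain ws Gs where 2: "lift \<pi> = restrict (chain_map J ws Gs) (Z Q)" "spin_chain Z J P Q ws Gs"
    using assms(1) by (auto simp: realized_def spin_perms_def)
  have w: "hd vs = Q" "last vs = Q" "walk vs Fs" "hd ws = Q" "last ws = Q" "walk ws Gs" "Fs \<noteq> []"
    using 1(2) 2(2) by (auto simp: spin_chain_walk)
  have app: "walk (vs @ tl ws) (Fs @ Gs)"
    "chain_map J (vs @ tl ws) (Fs @ Gs) = chain_map J ws Gs \<circ> chain_map J vs Fs"
    using walk_append[OF w(3,6)] w by auto
  have ne: "vs \<noteq> []" "ws \<noteq> []" using w(3,6) by (auto simp: walk_def)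
  have "last (vs @ tl ws) = Q"
    using w ne by (cases ws) (auto simp: last_append)
  hence "spin_chain Z J P Q (vs @ tl ws) (Fs @ Gs)"
    using app(1) w ne by (auto simp: spin_chain_walk)
  moreover have "lift (\<pi> \<circ> \<rho>) = restrict (chain_map J (vs @ tl ws) (Fs @ Gs)) (Z Q)"
  proof
    fix X
    show "lift (\<pi> \<circ> \<rho>) X = restrict (chain_map J (vs @ tl ws) (Fs @ Gs)) (Z Q) X"
    proof (cases "X \<in> Z Q")
      case True
      have "\<rho> (lab X) \<in> D" using permutes_in_image[OF p(2)] lab_Z[OF True] by simp
      moreover have "chain_map J vs Fs X = opp Q (\<rho> (lab X))"
        using fun_cong[OF 1(1), of X] True by (simp add: lift_def)
      ultimately have "chain_map J vs Fs X \<in> Z Q" using opp_D(1) by simp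
      thus ?thesis
        using True fun_cong[OF 1(1), of X] fun_cong[OF 2(1), of "chain_map J vs Fs X"]
        by (simp add: lift_compose[OF p(2)] compose_def 1(1) 2(1) app(2))
    qed (simp add: lift_def)
  qed
  ultimately show ?thesis
    using permutes_compose[OF p(2,1)] by (auto simp: realized_def spin_perms_def)
qed

text \<open>
  Going from \<open>Q\<close> to the neighbour labelled \<open>a\<close> through one face and back through another one with
  the same labels realizes the three-cycle \<open>a \<mapsto> b \<mapsto> c \<mapsto> a\<close>.
\<close>

lemma realized_three_cycle:
  assumes "{a, b, c} \<subseteq> D" "distinct [a, b, c]"
  shows "realized (cycle_of_list [a, b, c])"
proof -
  have abc: "a \<in> C" "b \<in> C" "c \<in> C" "a \<noteq> lab Q" "b \<noteq> lab Q" "c \<noteq> lab Q" using assms by (auto simp: D_def)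
  define y where "y = opp Q a"
  \<comment> \<open>With \<open>q = lab Q\<close>, the labels run \<open>q, a, c, b\<close> around
    \<open>F\<close> and \<open>a, q, c, b\<close> around \<open>G\<close>. The two rotations in
    succession give \<open>a \<mapsto> c \<mapsto> b\<close>,
    \<open>b \<mapsto> q \<mapsto> c\<close>, \<open>c \<mapsto> b \<mapsto> a\<close> and
    \<open>q \<mapsto> a \<mapsto> q\<close>.\<close>
  define F where "F = four_cycle Q y (J (opp Q c)) (opp Q b)"
  define G where "G = four_cycle y Q (opp Q c) (J (opp Q b))"
  note oa = opp[OF Q abc(1)] and ob = opp[OF Q abc(2)] and oc = opp[OF Q abc(3)]
  have q1: "quad Q y (J (opp Q c)) (opp Q b)"
    using Q oa ob oc abc assms(2) J_side[OF oc(1)] by (auto simp: quad_def y_def)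
  have q2: "quad y Q (opp Q c) (J (opp Q b))"
    using Q oa ob oc abc assms(2) J_side[OF ob(1)] by (auto simp: quad_def y_def)
  have yV: "y \<in> V" using oa by (simp add: y_def)
  have yZ: "y \<in> Z Q" "Q \<in> Z y" using oa yV abc Q by (auto simp: y_def Z_iff)
  have w: "walk [Q, y, Q] [F, G]"
    unfolding walk_Cons using yZ Q yV quad_face[OF q1] quad_face[OF q2]
    by (auto simp: edge_iff F_def G_def four_cycle_def walk_def)
  hence sc: "spin_chain Z J P Q [Q, y, Q] [F, G]" by (simp add: spin_chain_walk)
  have "lift (cycle_of_list [a, b, c]) = restrict (chain_map J [Q, y, Q] [F, G]) (Z Q)"
    unfolding lift_def
  proof (rule restrict_ext)
    fix X assume X: "X \<in> Z Q"
    let ?Y = "transport J F Q y X"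
    have Y: "?Y \<in> Z y" "lab ?Y = rot (lab Q) a c b (lab X)"
      using transport_quad[OF q1 X] oa ob oc by (auto simp: F_def y_def)
    have X': "transport J G y Q ?Y \<in> Z Q" "lab (transport J G y Q ?Y) = rot a (lab Q) c b (lab ?Y)"
      using transport_quad[OF q2 Y(1)] oa ob oc by (auto simp: G_def y_def)
    have d: "distinct [lab Q, a, c, b]" "distinct [a, lab Q, c, b]" using assms(2) abc by auto
    have "rot a (lab Q) c b (rot (lab Q) a c b (lab X)) = cycle_of_list [a, b, c] (lab X)"
      unfolding rot_apply[OF d(1)] rot_apply[OF d(2)]
      using lab_Z[OF X] assms by (auto simp: D_def Transposition.transpose_def)
    hence "lab (transport J G y Q ?Y) = cycle_of_list [a, b, c] (lab X)" using X' Y by simp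
    thus "opp Q (cycle_of_list [a, b, c] (lab X)) = chain_map J [Q, y, Q] [F, G] X"
      using opp_lab[OF Q X'(1)] by simp
  qed
  hence "lift (cycle_of_list [a, b, c]) \<in> spin_perms Z J P Q"
    unfolding spin_perms_def using sc by blast
  moreover have "cycle_of_list [a, b, c] permutes D"
    using cycle_permutes[of "[a, b, c]"] permutes_subset assms(1) by fastforce
  ultimately show ?thesis unfolding realized_def by blast
qed

lemma lift_Bij:
  assumes "\<pi> permutes D"
  shows "lift \<pi> \<in> Bij (Z Q)"
proof -
  have "bij_betw (opp Q) D (Z Q)"
    by (rule bij_betw_byWitness[where f' = lab]) (use opp_D lab_Z opp_lab[OF Q] in auto)
  hence "bij_betw (opp Q \<circ> (\<pi> \<circ> lab)) (Z Q) (Z Q)"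
    using bij_lab permutes_imp_bij[OF assms] by (intro bij_betw_trans)
  hence "bij_betw (lift \<pi>) (Z Q) (Z Q)"
    by (rule bij_betw_cong[THEN iffD1, rotated]) (simp add: lift_def)
  thus ?thesis by (simp add: Bij_def lift_def)
qed

text \<open>\<open>\<Psi>\<close> renames \<open>{1..g}\<close> to the labels in \<open>D\<close>
  and these to the neighbours of \<open>Q\<close>. The subgroup property follows because
  \<open>spin_perms\<close> is the image of this homomorphism.\<close>

theorem spin_perms_alt_group:
  "subgroup (spin_perms Z J P Q) (BijGroup (Z Q)) \<and>
   (BijGroup (Z Q))\<lparr>carrier := spin_perms Z J P Q\<rparr> \<cong> alt_group g"
proof -
  obtain b where b: "bij_betw b {1..g} D"
    using ex_bij_betw_nat_finite_1[OF D_facts(1)] D_facts(2) by auto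
  have bi: "inj_on b {1..g}" "b ` {1..g} = D" using b by (auto simp: bij_betw_def)
  define \<beta> where "\<beta> = map_permutation {1..g} b"
  define \<Psi> where "\<Psi> p = lift (\<beta> p)" for p
  have \<beta>p: "\<beta> p permutes D" if "p permutes {1..g}" for p
    unfolding \<beta>_def by (rule map_permutation_permutes[OF b that])
  have \<beta>c: "\<beta> (p \<circ> r) = \<beta> p \<circ> \<beta> r" if "r permutes {1..g}" for p r
    unfolding \<beta>_def by (rule map_permutation_compose'[OF bi(1) that])
  interpret alt: group "alt_group g" by (rule alt_group_is_group)
  have hom: "\<Psi> \<in> hom (alt_group g) (BijGroup (Z Q))"
  proof (rule homI)
    fix p r assume p: "p \<in> carrier (alt_group g)" "r \<in> carrier (alt_group g)"
    hence pp: "p permutes {1..g}" "r permutes {1..g}" by (auto simp: alt_group_carrier)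
    show "\<Psi> p \<in> carrier (BijGroup (Z Q))"
      using lift_Bij[OF \<beta>p[OF pp(1)]] by (simp add: BijGroup_def \<Psi>_def)
    show "\<Psi> (p \<otimes>\<^bsub>alt_group g\<^esub> r) = \<Psi> p \<otimes>\<^bsub>BijGroup (Z Q)\<^esub> \<Psi> r"
      using lift_Bij \<beta>p pp by (simp add: BijGroup_def \<Psi>_def alt_group_mult \<beta>c lift_compose)
  qed
  have inj: "inj_on \<Psi> (carrier (alt_group g))"
  proof (rule inj_onI)
    fix p r assume p: "p \<in> carrier (alt_group g)" "r \<in> carrier (alt_group g)" and eq: "\<Psi> p = \<Psi> r"
    hence pp: "p permutes {1..g}" "r permutes {1..g}" by (auto simp: alt_group_carrier)
    have "p n = r n" if n: "n \<in> {1..g}" for n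
    proof -
      have bn: "b n \<in> D" using n bi by blast
      have "opp Q (\<beta> p (b n)) = opp Q (\<beta> r (b n))"
        using fun_cong[OF eq, of "opp Q (b n)"] opp_D[OF bn] by (simp add: \<Psi>_def lift_def)
      moreover have "\<beta> p (b n) \<in> D" "\<beta> r (b n) \<in> D"
        using permutes_in_image[OF \<beta>p] pp bn by auto
      ultimately have "\<beta> p (b n) = \<beta> r (b n)" using opp_D(2) by metis
      hence "b (p n) = b (r n)"
        unfolding \<beta>_def using map_permutation_apply[OF bi(1) n] by metis
      thus ?thesis using inj_onD[OF bi(1)] permutes_in_image[OF pp(1)] permutes_in_image[OF pp(2)] n by blast
    qed
    thus "p = r" using pp by (metis permutes_not_in ext)
  qed
  have three: "realized (\<beta> h)" "h \<circ> h \<circ> h = id" if hc: "h \<in> three_cycles g" for h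
  proof -
    obtain cs where cs: "h = cycle_of_list cs" "distinct cs" "length cs = 3" "set cs \<subseteq> {1..g}"
      using hc by blast
    then obtain i j k where ijk: "cs = [i, j, k]" using stupid_lemma by blast
    have in_g: "i \<in> {1..g}" "j \<in> {1..g}" "k \<in> {1..g}" using cs ijk by auto
    have "\<beta> h = Transposition.transpose (b i) (b j) \<circ> Transposition.transpose (b j) (b k)"
      using in_g bi(1) permutes_swap_id[of j "{1..g}" k]
      by (simp add: cs(1) ijk \<beta>_def map_permutation_compose' map_permutation_transpose)
    also have "\<dots> = cycle_of_list [b i, b j, b k]" by simp
    finally have eq: "\<beta> h = cycle_of_list [b i, b j, b k]" .
    have "distinct [b i, b j, b k]" using cs(2) ijk in_g inj_onD[OF bi(1)] by auto
    thus "realized (\<beta> h)" unfolding eq using in_g bi(2) by (intro realized_three_cycle) auto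
    show "h \<circ> h \<circ> h = id" using cs(2) unfolding cs(1) ijk
      by (auto simp: fun_eq_iff Transposition.transpose_def)
  qed
  have tp: "h permutes {1..g}" if "h \<in> three_cycles g" for h
    using three_cycles_incl[of g] that alt_group_carrier by blast
  have rc: "realized (\<beta> (p \<circ> r))" if "realized (\<beta> p)" "realized (\<beta> r)" "r permutes {1..g}" for p r
    using realized_comp[OF that(1,2)] \<beta>c[OF that(3)] by simp
  \<comment> \<open>The empty chain is not a spin chain, so the identity is realized as the cube of
    a three-cycle, which exists because \<open>g \<ge> 3\<close>.\<close>
  have id3: "realized (\<beta> id)"
  proof -
    define h where "h = cycle_of_list [1, 2, 3 :: nat]"
    have h: "h \<in> three_cycles g"
      unfolding h_def using g3 by (intro CollectI exI[of _ "[1, 2, 3]"]) auto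
    note hh = three[OF h] and hp = tp[OF h]
    have "realized (\<beta> (h \<circ> h \<circ> h))" by (intro rc hh(1) hp)
    thus ?thesis unfolding hh(2) .
  qed
  have real: "realized (\<beta> p)" if "p \<in> carrier (alt_group g)" for p
  proof -
    have "p \<in> generate (alt_group g) (three_cycles g)" using that alt_group_carrier_as_three_cycles by blast
    thus ?thesis
    proof induction
      case one show ?case unfolding alt_group_one by (rule id3)
    next
      case (incl h) show ?case by (rule three(1)[OF incl])
    next
      \<comment> \<open>The inverse of a three-cycle is its square, so closure under composition
        suffices.\<close>
      case (inv h)
      note hh = three[OF inv] and hp = tp[OF inv]
      have "h \<in> carrier (alt_group g)" using inv three_cycles_incl by blast
      hence "inv\<^bsub>alt_group g\<^esub> h = inv' h" by (rule alt_group_inv_equality)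
      also have "inv' h = h \<circ> h"
        by (rule inv_unique_comp) (use hh(2) in \<open>auto simp: o_assoc\<close>)
      finally show ?case using rc[OF hh(1,1) hp] by (simp only:)
    next
      case (eng p r)
      have "r permutes {1..g}"
        using eng.hyps(2) alt_group_carrier_as_three_cycles[of g] alt_group_carrier by blast
      thus ?case unfolding alt_group_mult using rc eng.IH by blast
    qed
  qed
  have img: "\<Psi> ` carrier (alt_group g) = spin_perms Z J P Q"
  proof (intro equalityI subsetI)
    fix f assume "f \<in> \<Psi> ` carrier (alt_group g)"
    thus "f \<in> spin_perms Z J P Q" using real by (auto simp: realized_def \<Psi>_def)
  next
    fix f assume "f \<in> spin_perms Z J P Q"
    then obtain vs Fs where f: "f = restrict (chain_map J vs Fs) (Z Q)" "spin_chain Z J P Q vs Fs"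
      by (auto simp: spin_perms_def)
    obtain \<pi> where \<pi>: "\<pi> permutes D" "evenperm \<pi>" "f = lift \<pi>"
      using chain_in_lift[OF f(2)] f(1) by metis
    \<comment> \<open>Renaming back along the inverse of \<open>b\<close> preserves the sign and
      yields the preimage of \<open>f\<close>.\<close>
    define b' where "b' = inv_into {1..g} b"
    have b': "bij_betw b' D {1..g}" unfolding b'_def by (rule bij_betw_inv_into[OF b])
    define p where "p = map_permutation D b' \<pi>"
    have "p permutes {1..g}" unfolding p_def by (rule map_permutation_permutes[OF b' \<pi>(1)])
    moreover have "evenperm p"
      unfolding p_def using evenperm_map_permutation[of b' D \<pi>] b' \<pi> D_facts(1)
      by (simp add: bij_betw_def)
    ultimately have "p \<in> carrier (alt_group g)" by (simp add: alt_group_carrier)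
    moreover have "\<beta> p = \<pi>"
      unfolding \<beta>_def p_def
      by (rule map_permutation_compose_inv[OF b' \<pi>(1)]) (use bi(2) in \<open>auto simp: b'_def intro: f_inv_into_f\<close>)
    ultimately show "f \<in> \<Psi> ` carrier (alt_group g)" using \<pi>(3) by (auto simp: \<Psi>_def)
  qed
  interpret h: group_hom "alt_group g" "BijGroup (Z Q)" \<Psi>
    using hom alt_group_is_group group_BijGroup by (simp add: group_hom_def group_hom_axioms_def)
  have sub: "subgroup (spin_perms Z J P Q) (BijGroup (Z Q))"
    using h.img_is_subgroup by (simp add: img)
  have "\<Psi> \<in> iso (alt_group g) ((BijGroup (Z Q))\<lparr>carrier := spin_perms Z J P Q\<rparr>)"
    using hom inj img by (auto simp: iso_def hom_def bij_betw_def)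
  hence "alt_group g \<cong> (BijGroup (Z Q))\<lparr>carrier := spin_perms Z J P Q\<rparr>" by (rule is_isoI)
  thus ?thesis using sub alt.iso_sym by blast
qed

end

end

theorem lemma7:
  fixes A :: "'a::t2_space chart set"
    and J :: "'a \<Rightarrow> 'a"
    and \<xi> :: "('i, 'a) cocycle"
    and g :: nat
    and P Q :: 'a
  assumes "compact_riemann_surface A"
    and "has_genus A g"
    and "g \<ge> 3"
    and "hyperelliptic_involution A J"
    and "nonsingular_even_spin_bundle A \<xi>"
    and "standard_point (spin_zeros A \<xi>) g P"
    and "Q \<in> spin_vertices (spin_zeros A \<xi>) P"
  shows "card (spin_zeros A \<xi> Q) = g \<and>
    subgroup (spin_perms (spin_zeros A \<xi>) J P Q) (BijGroup (spin_zeros A \<xi> Q)) \<and>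
    (BijGroup (spin_zeros A \<xi> Q))\<lparr>carrier := spin_perms (spin_zeros A \<xi>) J P Q\<rparr> \<cong> alt_group g"
proof -
  obtain z where z: "mer_on A UNIV z" "\<exists>p q. z p \<noteq> z q"
    "\<And>p q. fibre_mult A z p q = of_bool (q = p) + of_bool (q = J p)"
    using assms(4) unfolding hyperelliptic_involution_def by blast
  interpret compact_riemann_surface A by fact
  interpret spin_surface A J z \<xi> g
    by unfold_locales (use z assms in auto)
  obtain C where C: "P \<in> C" "finite C" "card C = Suc g" "C \<inter> J ` C = {}"
    "spin_vertices (spin_zeros A \<xi>) P = C \<union> J ` C"
    "\<And>x. x \<in> C \<Longrightarrow> spin_zeros A \<xi> x = J ` (C - {x})"
    "\<And>x. x \<in> C \<Longrightarrow> spin_zeros A \<xi> (J x) = C - {x}"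
    using that by (rule standard_graph[OF assms(6)])
  interpret G: standard_spin_graph "spin_zeros A \<xi>" J P C g
    by unfold_locales (use C assms(3) in auto)
  show ?thesis
    using G.card_Z[OF assms(7)] G.spin_perms_alt_group[OF assms(7)] by blast
qed

end
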